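(* Let $d\ge 1$ and let $\Phi\in C([0,\infty))\cap C^\infty((0,\infty))$ be a real-valued function satisfying: (a) there is $z_0\ge 2$ such that for every integer $k\ge 0$ there are $C_{\Phi,k,z_0}>0$ and $n_k$ with $|\partial^k\Phi(z)|\le C_{\Phi,k,z_0}z^{n_k}$ for all $z\ge z_0$; (b) for some $0<\varepsilon_0\le\frac12$, $\sum_{j=0}^{d+1}\int_0^{\varepsilon_0}|z|^j|(\partial_z^j\Phi)(z)|\frac{dz}{z}<\infty$; (c) $\Phi'(1)\ne 0$ and $\Phi(t)\ne\Phi(1)$ for all $t\in(0,1)\cup(1,\infty)$. Suppose $u\in L^\infty(\mathbb R^d)$ satisfies $$\langle u,\Phi(-\Delta)\psi\rangle=\langle u,\Phi(1)\psi\rangle\qquad\text{for all }\psi\in\mathcal S(\mathbb R^d).$$ Let $K=\{\xi\in\mathbb R^d:\ \xi=0\text{ or }|\xi|=1\}$. Then: (1) $\operatorname{supp}(\widehat u)\subset K$; more precisely $\langle\widehat u,\phi\rangle=0$ for all $\phi\in C_c^\infty(\mathbb R^d\setminus K)$. (2) If $\Phi(1)\ne 0$, then $\operatorname{supp}(\widehat u)\subset\{\xi:|\xi|=1\}$, i.e. $\langle\widehat u,\phi\rangle=0$ for all $\phi\in C_c^\infty(\mathbb R^d\setminus\{\xi:|\xi|=1\})$, and moreover $$\Big\langle u,\ \mathcal F^{-1}\big((|\xi|^2-1)\psi(\xi)\big)\Big\rangle=0\qquad\text{for all }\psi\in\mathcal S(\mathbb R^d).$$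
   Context: Fourier transform convention: $\widehat u(\xi)=\int_{\mathbb R^d}u(y)e^{-iy\cdot\xi}dy$, $(\mathcal F^{-1}g)(x)=(2\pi)^{-d}\int g(\xi)e^{i\xi\cdot x}d\xi$. The pairing is $\langle f_1,f_2\rangle=\int_{\mathbb R^d}f_1(x)\overline{f_2(x)}\,dx$. For $\psi\in\mathcal S(\mathbb R^d)$, $\Phi(-\Delta)\psi$ is defined by $\widehat{\Phi(-\Delta)\psi}(\xi)=\Phi(|\xi|^2)\widehat\psi(\xi)$; under the hypotheses it lies in $L^1(\mathbb R^d)$, so $\langle u,\Phi(-\Delta)\psi\rangle$ is well defined for $u\in L^\infty$. For a tempered distribution $u$, $\widehat u$ is the tempered distribution with $\langle\widehat u,\phi\rangle=(2\pi)^d\langle u,\mathcal F^{-1}(\phi)\rangle$ for $\phi\in\mathcal S(\mathbb R^d)$. *)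

theory Defs
  imports "HOL-Analysis.Analysis"
begin

fun dderiv :: "'a::real_normed_vector list \<Rightarrow> ('a \<Rightarrow> 'b::real_normed_vector) \<Rightarrow> 'a \<Rightarrow> 'b" where
  "dderiv [] f = f"
| "dderiv (v # vs) f = (\<lambda>x. frechet_derivative (dderiv vs f) (at x) v)"

definition smooth :: "('a::euclidean_space \<Rightarrow> 'b::real_normed_vector) \<Rightarrow> bool" where
  "smooth f \<longleftrightarrow> (\<forall>vs. set vs \<subseteq> Basis \<longrightarrow> (\<forall>x. dderiv vs f differentiable (at x)))"

definition schwartz :: "('a::euclidean_space \<Rightarrow> complex) \<Rightarrow> bool" where
  "schwartz f \<longleftrightarrow> smooth f \<and>
     (\<forall>vs k. set vs \<subseteq> Basis \<longrightarrow> bounded (range (\<lambda>x. norm x ^ k *\<^sub>R dderiv vs f x)))"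

definition test_fun_on :: "'a::euclidean_space set \<Rightarrow> ('a \<Rightarrow> complex) \<Rightarrow> bool" where
  "test_fun_on \<Omega> f \<longleftrightarrow> smooth f \<and> compact (closure {x. f x \<noteq> 0}) \<and> closure {x. f x \<noteq> 0} \<subseteq> \<Omega>"

definition Linfty :: "('a::euclidean_space \<Rightarrow> complex) \<Rightarrow> bool" where
  "Linfty u \<longleftrightarrow> u \<in> borel_measurable lebesgue \<and> (\<exists>C. AE x in lebesgue. norm (u x) \<le> C)"

definition FT :: "('a::euclidean_space \<Rightarrow> complex) \<Rightarrow> 'a \<Rightarrow> complex" where
  "FT f \<xi> = (LINT y|lebesgue. f y * cis (- (y \<bullet> \<xi>)))"

definition iFT :: "('a::euclidean_space \<Rightarrow> complex) \<Rightarrow> 'a \<Rightarrow> complex" where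
  "iFT g x = complex_of_real ((2 * pi) powr (- real DIM('a))) * (LINT \<xi>|lebesgue. g \<xi> * cis (\<xi> \<bullet> x))"

definition pairing :: "('a::euclidean_space \<Rightarrow> complex) \<Rightarrow> ('a \<Rightarrow> complex) \<Rightarrow> complex" where
  "pairing f1 f2 = (LINT x|lebesgue. f1 x * cnj (f2 x))"

definition fmult :: "(real \<Rightarrow> real) \<Rightarrow> ('a::euclidean_space \<Rightarrow> complex) \<Rightarrow> 'a \<Rightarrow> complex" where
  "fmult \<Phi> \<psi> = iFT (\<lambda>\<xi>. complex_of_real (\<Phi> ((norm \<xi>)\<^sup>2)) * FT \<psi> \<xi>)"

definition dist_FT :: "('a::euclidean_space \<Rightarrow> complex) \<Rightarrow> ('a \<Rightarrow> complex) \<Rightarrow> complex" where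
  "dist_FT u \<phi> = complex_of_real ((2 * pi) ^ DIM('a)) * pairing u (iFT \<phi>)"

end

theory Submission
  imports Defs "HOL-Probability.Probability"
begin

text \<open>
  For a test function \<open>g\<close> supported away from the origin, \<open>\<psi> = \<F>\<^sup>-\<^sup>1 g\<close> is Schwartz, and the hypothesis says
  that \<open>u\<close> annihilates \<open>\<F>\<^sup>-\<^sup>1((\<Phi>(|\<xi>|\<^sup>2) - \<Phi>(1)) g)\<close>. Off the zero set of \<open>\<Phi>(|\<xi>|\<^sup>2) - \<Phi>(1)\<close> one may divide,
  which gives (1). For (2), by (1) a test function \<open>\<phi>\<close> may be localised to \<open>|\<xi>|\<^sup>2 \<le> 2r\<close> without changing
  \<open>c = \<langle>u, \<F>\<^sup>-\<^sup>1 \<phi>\<rangle>\<close>; the hypothesis then bounds \<open>|\<Phi>(1) c|\<close> by the \<open>L\<^sup>1\<close> norm of the inverse transform of the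
  localised \<open>\<Phi>(|\<xi>|\<^sup>2) \<phi>\<close>. Splitting the frequencies at \<open>1 / |x|\<close> and integrating by parts \<open>d + 1\<close> times in
  the upper range, this norm is at most a constant times
  \<open>\<Sum>\<^sub>j \<integral>\<^sub>0\<^sup>2\<^sup>r z\<^sup>j |\<Phi>\<^sup>(\<^sup>j\<^sup>)(z)| dz / z\<close>, which tends to \<open>0\<close> with \<open>r\<close>, so \<open>c = 0\<close>. Near the sphere
  \<open>(t - 1) / (\<Phi>(t) - \<Phi>(1))\<close> is smooth because \<open>\<Phi>'(1) \<noteq> 0\<close>, so \<open>u\<close> also annihilates
  \<open>\<F>\<^sup>-\<^sup>1((|\<xi>|\<^sup>2 - 1) \<psi>)\<close> for compactly supported \<open>\<psi>\<close>, and truncation removes the support condition.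
\<close>

section \<open>Smooth functions on open sets\<close>

text \<open>The obstacle is the origin: \<Phi> is only continuous there, so \<Phi>(|\<xi>|^2) g need
  not be Schwartz, and division by \<Phi> - \<Phi>(1) is available only away from 0. What is known
  near 0 is the weighted integral of hypothesis (b), and its measure dz/z is exactly the one that
  the L1 estimate produces. Fix \<xi> and integrate over x: the frequencies below 1/|x| contribute
  the volume of a ball of radius about 1/|\<xi>|, the others |\<xi>|^-(d+1) times the integral of
  |x|^-(d+1) outside such a ball. Both are multiples of |\<xi>|^-d, and |\<xi>|^-d d\<xi> becomes a
  multiple of dz/z under z = |\<xi>|^2. The order d + 1 is the least integer for which that tail
  converges. All cutoffs are functions of |\<xi>|^2 with derivative bounds of the dilation invariant
  form C |\<xi>|^-j, so the constants depend neither on r nor on the point x. Decay of a transform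
  follows from repeated derivatives in one coordinate, hence no multi-index calculus. In the final
  truncation u is merely bounded, so pointwise convergence of the transforms is not enough: they
  must share an integrable majorant.\<close>

abbreviation (input) nsq :: "'a::real_normed_vector \<Rightarrow> real" where
  "nsq x \<equiv> (norm x)\<^sup>2"

text \<open>Only repeated derivatives in a single direction are ever estimated: \<open>n\<close> of
  them along a basis vector give a factor \<open>(x \<bullet> b) ^ n\<close> on the Fourier side.
  With \<open>b = 1\<close> on the reals this is the ordinary \<open>n\<close>-th
  derivative.\<close>

abbreviation (input) dn :: "nat \<Rightarrow> 'a::real_normed_vector \<Rightarrow> ('a \<Rightarrow> 'b::real_normed_vector) \<Rightarrow> 'a \<Rightarrow> 'b" where
  "dn n b \<equiv> dderiv (replicate n b)"

text \<open>The order serves as induction variable: one differentiation turns a claim about products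
  or compositions into the same claim at lower order. Order \<open>n\<close> includes
  differentiability of the \<open>n\<close>-th derivatives, so order 0 already means
  differentiable.\<close>

definition ksmooth_on :: "nat \<Rightarrow> 'a::euclidean_space set \<Rightarrow> ('a \<Rightarrow> 'b::real_normed_vector) \<Rightarrow> bool" where
  "ksmooth_on n S f \<longleftrightarrow> (\<forall>vs. set vs \<subseteq> Basis \<and> length vs \<le> n \<longrightarrow> (\<forall>x\<in>S. dderiv vs f differentiable (at x)))"

definition smooth_on :: "'a::euclidean_space set \<Rightarrow> ('a \<Rightarrow> 'b::real_normed_vector) \<Rightarrow> bool" where
  "smooth_on S f \<longleftrightarrow> (\<forall>vs. set vs \<subseteq> Basis \<longrightarrow> (\<forall>x\<in>S. dderiv vs f differentiable (at x)))"

lemma smooth_iff_smooth_on: "smooth f \<longleftrightarrow> smooth_on UNIV f"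
  by (simp add: smooth_def smooth_on_def)

lemma smooth_on_iff_ksmooth_on: "smooth_on S f \<longleftrightarrow> (\<forall>n. ksmooth_on n S f)"
  unfolding smooth_on_def ksmooth_on_def by blast

lemma smooth_on_subset: "smooth_on S f \<Longrightarrow> T \<subseteq> S \<Longrightarrow> smooth_on T f"
  unfolding smooth_on_def by blast

lemma smooth_on_Un: "smooth_on S f \<Longrightarrow> smooth_on T f \<Longrightarrow> smooth_on (S \<union> T) f"
  unfolding smooth_on_def by blast

lemma dderiv_append: "dderiv (vs @ ws) f = dderiv vs (dderiv ws f)"
  by (induction vs) auto

text \<open>The recursion of \<open>dderiv\<close> exposes the outermost derivative, whereas the
  product and chain rules must be applied to the innermost one.\<close>

lemma dderiv_replicate_Suc: "dn (Suc n) b f = dn n b (dderiv [b] f)"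
proof -
  have "replicate (Suc n) b = replicate n b @ [b]"
    by (simp add: replicate_append_same)
  then show ?thesis
    by (simp only: dderiv_append)
qed

lemma dderiv_zero: "dderiv vs (\<lambda>x. 0) = (\<lambda>x. 0)"
  by (induction vs) auto

lemma dderiv_replicate_const: "dn (Suc n) b (\<lambda>x. c) = (\<lambda>x. 0)"
  unfolding dderiv_replicate_Suc by (simp add: dderiv_zero)

section \<open>Locality of iterated derivatives\<close>

lemma frechet_derivative_cong_open:
  assumes "open S" "x \<in> S" "\<And>y. y \<in> S \<Longrightarrow> f y = g y"
  shows "frechet_derivative f (at x) = frechet_derivative g (at x)"
proof -
  have "(f has_derivative D) (at x) \<longleftrightarrow> (g has_derivative D) (at x)" for D
    using has_derivative_transform_within_open[OF _ assms(1,2)] assms(3) by metis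
  then show ?thesis
    unfolding frechet_derivative_def by simp
qed

lemma differentiable_cong_open:
  assumes "open S" "x \<in> S" "\<And>y. y \<in> S \<Longrightarrow> f y = g y" "f differentiable (at x)"
  shows "g differentiable (at x)"
  using assms has_derivative_transform_within_open[of f _ x UNIV S g] unfolding differentiable_def by auto

text \<open>Openness makes equality at a point hold in a neighbourhood, which is what the induction
  differentiates. Later this evaluates derivatives wherever a function is locally constant or has a
  simpler formula.\<close>

lemma dderiv_cong_open:
  assumes "open S" "\<And>y. y \<in> S \<Longrightarrow> f y = g y" "x \<in> S"
  shows "dderiv vs f x = dderiv vs g x"
  using assms(3)
proof (induction vs arbitrary: x)
  case (Cons v vs)
  then show ?case
    using frechet_derivative_cong_open[OF assms(1) Cons.prems, of "dderiv vs f" "dderiv vs g"] by simp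
qed (use assms in auto)

lemma ksmooth_on_cong:
  assumes "open S" "\<And>y. y \<in> S \<Longrightarrow> f y = g y" "ksmooth_on n S f"
  shows "ksmooth_on n S g"
  unfolding ksmooth_on_def
proof (intro allI impI ballI)
  fix vs :: "'a list" and x assume vs: "set vs \<subseteq> Basis \<and> length vs \<le> n" and x: "x \<in> S"
  show "dderiv vs g differentiable at x"
    by (rule differentiable_cong_open[OF assms(1) x dderiv_cong_open[OF assms(1,2)]])
       (use vs x assms(3) in \<open>auto simp: ksmooth_on_def\<close>)
qed

lemma smooth_on_cong:
  assumes "open S" "\<And>y. y \<in> S \<Longrightarrow> f y = g y" "smooth_on S f"
  shows "smooth_on S g"
  using assms ksmooth_on_cong unfolding smooth_on_iff_ksmooth_on by blast

lemma ksmooth_on_0: "ksmooth_on 0 S f \<longleftrightarrow> (\<forall>x\<in>S. f differentiable (at x))"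
  unfolding ksmooth_on_def by auto

text \<open>Splitting the list at its end makes the first derivatives of \<open>f\<close> the new
  functions, so that inductions can rewrite them by a differentiation rule.\<close>

lemma ksmooth_on_Suc:
  "ksmooth_on (Suc n) S f \<longleftrightarrow> (\<forall>x\<in>S. f differentiable (at x)) \<and> (\<forall>b\<in>Basis. ksmooth_on n S (dderiv [b] f))"
proof safe
  assume *: "ksmooth_on (Suc n) S f"
  show "f differentiable at x" if "x \<in> S" for x
    using * that by (auto simp: ksmooth_on_def dest!: spec[of _ "[]"])
  show "ksmooth_on n S (dderiv [b] f)" if b: "b \<in> Basis" for b
    unfolding ksmooth_on_def
  proof (intro allI impI ballI)
    fix vs :: "'a list" and x assume "set vs \<subseteq> Basis \<and> length vs \<le> n" "x \<in> S"
    then show "dderiv vs (dderiv [b] f) differentiable at x"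
      using b * spec[OF *[unfolded ksmooth_on_def], of "vs @ [b]"] by (simp add: dderiv_append)
  qed
next
  assume *: "\<forall>x\<in>S. f differentiable at x" "\<forall>b\<in>Basis. ksmooth_on n S (dderiv [b] f)"
  show "ksmooth_on (Suc n) S f"
    unfolding ksmooth_on_def
  proof (intro allI impI ballI)
    fix vs :: "'a list" and x assume vs: "set vs \<subseteq> Basis \<and> length vs \<le> Suc n" and x: "x \<in> S"
    show "dderiv vs f differentiable at x"
    proof (cases vs rule: rev_cases)
      case (snoc ws b)
      then have "ksmooth_on n S (dderiv [b] f)" "set ws \<subseteq> Basis" "length ws \<le> n"
        using vs * by auto
      then show ?thesis
        using x unfolding snoc dderiv_append ksmooth_on_def by blast
    qed (use * x in auto)
  qed
qed

lemma ksmooth_on_mono: "ksmooth_on n S f \<Longrightarrow> m \<le> n \<Longrightarrow> ksmooth_on m S f"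
  unfolding ksmooth_on_def by auto

lemma smooth_on_dderiv: "smooth_on S f \<Longrightarrow> set vs \<subseteq> Basis \<Longrightarrow> smooth_on S (dderiv vs f)"
  unfolding smooth_on_def dderiv_append[symmetric] by simp

lemma smooth_on_differentiable: "smooth_on S f \<Longrightarrow> x \<in> S \<Longrightarrow> f differentiable (at x)"
  unfolding smooth_on_def by (auto dest!: spec[of _ "[]"])

lemma smooth_on_continuous_on: "smooth_on S f \<Longrightarrow> continuous_on S f"
  by (auto intro!: continuous_at_imp_continuous_on differentiable_imp_continuous_within
      dest: smooth_on_differentiable)

lemma dderiv1_eqI: "(f has_derivative D) (at x) \<Longrightarrow> dderiv [b] f x = D b"
  by (simp add: frechet_derivative_at[symmetric])

lemma smooth_onI_step:
  assumes "\<And>x. x \<in> S \<Longrightarrow> f differentiable (at x)" "\<And>b. b \<in> Basis \<Longrightarrow> smooth_on S (dderiv [b] f)"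
  shows "smooth_on S f"
  unfolding smooth_on_iff_ksmooth_on
proof
  fix n show "ksmooth_on n S f"
    using assms by (cases n) (auto simp: ksmooth_on_0 ksmooth_on_Suc smooth_on_iff_ksmooth_on simp del: dderiv.simps)
qed

section \<open>Closure of smoothness under algebraic operations and composition\<close>

lemma ksmooth_on_const: "ksmooth_on n S (\<lambda>x. c)"
proof (induction n arbitrary: c)
  case (Suc n)
  have "dderiv [b] (\<lambda>x::'a. c) = (\<lambda>x. 0)" for b
    by (intro ext dderiv1_eqI[where D="\<lambda>x. 0"]) (auto intro!: derivative_eq_intros)
  then show ?case using Suc by (simp add: ksmooth_on_Suc del: dderiv.simps)
qed (simp add: ksmooth_on_0)

lemma smooth_on_const: "smooth_on S (\<lambda>x. c)"
  by (simp add: smooth_on_iff_ksmooth_on ksmooth_on_const)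

lemma dderiv1_bounded_linear: "bounded_linear f \<Longrightarrow> dderiv [b] f = (\<lambda>x. f b)"
  by (intro ext dderiv1_eqI bounded_linear_imp_has_derivative)

lemma smooth_on_bounded_linear:
  assumes "bounded_linear f" shows "smooth_on S f"
  by (rule smooth_onI_step)
     (auto simp: dderiv1_bounded_linear[OF assms] smooth_on_const bounded_linear_imp_differentiable[OF assms]
       simp del: dderiv.simps)

lemma dderiv1_add:
  assumes "f differentiable (at x)" "g differentiable (at x)"
  shows "dderiv [b] (\<lambda>x. f x + g x) x = dderiv [b] f x + dderiv [b] g x"
proof -
  have "dderiv [b] (\<lambda>x. f x + g x) x = frechet_derivative f (at x) b + frechet_derivative g (at x) b"
    by (rule dderiv1_eqI[where D="\<lambda>h. frechet_derivative f (at x) h + frechet_derivative g (at x) h"])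
       (use assms in \<open>auto intro!: has_derivative_add simp: frechet_derivative_works\<close>)
  then show ?thesis by simp
qed

lemma ksmooth_on_add:
  "open S \<Longrightarrow> ksmooth_on n S f \<Longrightarrow> ksmooth_on n S g \<Longrightarrow> ksmooth_on n S (\<lambda>x. f x + g x)"
proof (induction n arbitrary: f g)
  case (Suc n)
  note d = Suc.prems(2,3)[unfolded ksmooth_on_Suc]
  have "ksmooth_on n S (dderiv [b] (\<lambda>x. f x + g x))" if "b \<in> Basis" for b
    by (rule ksmooth_on_cong[OF Suc.prems(1) dderiv1_add[symmetric] Suc.IH])
       (use d that Suc.prems in auto)
  then show ?case using d by (simp add: ksmooth_on_Suc del: dderiv.simps)
qed (auto simp: ksmooth_on_0)

lemma smooth_on_add:
  "open S \<Longrightarrow> smooth_on S f \<Longrightarrow> smooth_on S g \<Longrightarrow> smooth_on S (\<lambda>x. f x + g x)"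
  by (simp add: smooth_on_iff_ksmooth_on ksmooth_on_add)

lemma dderiv_add:
  assumes "open S" "smooth_on S f" "smooth_on S g" "set vs \<subseteq> Basis" "x \<in> S"
  shows "dderiv vs (\<lambda>x. f x + g x) x = dderiv vs f x + dderiv vs g x"
  using assms(4,5)
proof (induction vs arbitrary: x)
  case (Cons v vs)
  have "dderiv (v # vs) (\<lambda>x. f x + g x) x = dderiv [v] (\<lambda>x. dderiv vs f x + dderiv vs g x) x"
    using frechet_derivative_cong_open[OF assms(1) Cons.prems(2), of "dderiv vs (\<lambda>x. f x + g x)"] Cons by simp
  also have "\<dots> = dderiv [v] (dderiv vs f) x + dderiv [v] (dderiv vs g) x"
    using assms(2,3) Cons.prems by (intro dderiv1_add) (auto simp: smooth_on_def)
  finally show ?case by simp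
qed auto

lemma dderiv1_bilinear:
  assumes "bounded_bilinear p" "f differentiable (at x)" "g differentiable (at x)"
  shows "dderiv [b] (\<lambda>x. p (f x) (g x)) x = p (f x) (dderiv [b] g x) + p (dderiv [b] f x) (g x)"
proof -
  have "dderiv [b] (\<lambda>x. p (f x) (g x)) x
      = p (f x) (frechet_derivative g (at x) b) + p (frechet_derivative f (at x) b) (g x)"
    by (rule dderiv1_eqI[where D="\<lambda>h. p (f x) (frechet_derivative g (at x) h) + p (frechet_derivative f (at x) h) (g x)"])
       (use assms in \<open>auto intro!: bounded_bilinear.FDERIV simp: frechet_derivative_works\<close>)
  then show ?thesis by simp
qed

text \<open>The product rule gives two terms of the same shape with one factor differentiated, so
  the induction is over all pairs \<open>f\<close>, \<open>g\<close>. Scalar multiplication and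
  multiplication are both instances.\<close>

lemma ksmooth_on_bilinear:
  assumes "bounded_bilinear p" "open S"
  shows "ksmooth_on n S f \<Longrightarrow> ksmooth_on n S g \<Longrightarrow> ksmooth_on n S (\<lambda>x. p (f x) (g x))"
proof (induction n arbitrary: f g)
  case 0
  then show ?case
    unfolding ksmooth_on_0 differentiable_def using bounded_bilinear.FDERIV[OF assms(1)] by blast
next
  case (Suc n)
  note d = Suc.prems[unfolded ksmooth_on_Suc]
  have "ksmooth_on n S (dderiv [b] (\<lambda>x. p (f x) (g x)))" if "b \<in> Basis" for b
    by (rule ksmooth_on_cong[OF assms(2) dderiv1_bilinear[OF assms(1), symmetric]
          ksmooth_on_add[OF assms(2) Suc.IH Suc.IH]])
       (use d that Suc.prems in \<open>auto intro: ksmooth_on_mono\<close>)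
  then show ?case using d bounded_bilinear.FDERIV[OF assms(1)]
    unfolding ksmooth_on_Suc differentiable_def by blast
qed

lemma smooth_on_bilinear:
  "bounded_bilinear p \<Longrightarrow> open S \<Longrightarrow> smooth_on S f \<Longrightarrow> smooth_on S g \<Longrightarrow> smooth_on S (\<lambda>x. p (f x) (g x))"
  by (simp add: smooth_on_iff_ksmooth_on ksmooth_on_bilinear)

lemmas smooth_on_scaleR = smooth_on_bilinear[OF bounded_bilinear_scaleR]

lemma smooth_on_mult:
  fixes f g :: "'a::euclidean_space \<Rightarrow> 'b::real_normed_algebra"
  shows "open S \<Longrightarrow> smooth_on S f \<Longrightarrow> smooth_on S g \<Longrightarrow> smooth_on S (\<lambda>x. f x * g x)"
  by (rule smooth_on_bilinear[OF bounded_bilinear_mult])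

lemma smooth_on_diff:
  assumes "open S" "smooth_on S f" "smooth_on S g" shows "smooth_on S (\<lambda>x. f x - g x)"
proof -
  have "smooth_on S (\<lambda>x. f x + (-1) *\<^sub>R g x)"
    using assms smooth_on_const by (intro smooth_on_add smooth_on_scaleR) auto
  then show ?thesis by simp
qed

lemma dderiv1_compose_real:
  fixes h :: "real \<Rightarrow> real"
  assumes "f differentiable (at x)" "h differentiable (at (f x))"
  shows "dderiv [b] (\<lambda>x. h (f x)) x = dderiv [1] h (f x) * dderiv [b] f x"
proof -
  have "((\<lambda>x. h (f x)) has_derivative (\<lambda>v. frechet_derivative h (at (f x)) (frechet_derivative f (at x) v))) (at x)"
    using diff_chain_at[of f _ x h] assms unfolding frechet_derivative_works o_def by blast
  then have "dderiv [b] (\<lambda>x. h (f x)) x = frechet_derivative h (at (f x)) (frechet_derivative f (at x) b)"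
    by (rule dderiv1_eqI)
  also have "\<dots> = frechet_derivative f (at x) b * frechet_derivative h (at (f x)) 1"
    using linear_scale[OF linear_frechet_derivative[OF assms(2)], of "frechet_derivative f (at x) b" 1] by simp
  finally show ?thesis by simp
qed

text \<open>The chain rule yields \<open>h'\<close> composed with \<open>f\<close>, times a
  derivative of \<open>f\<close>; the induction hypothesis is used for \<open>h'\<close>, hence
  \<open>h\<close> is generalised while \<open>f\<close> stays fixed.\<close>

lemma ksmooth_on_compose_real:
  fixes h :: "real \<Rightarrow> real"
  assumes "open S" "f ` S \<subseteq> U"
  shows "ksmooth_on n U h \<Longrightarrow> ksmooth_on n S f \<Longrightarrow> ksmooth_on n S (\<lambda>x. h (f x))"
proof (induction n arbitrary: h)
  case 0
  then show ?case
    using assms differentiable_chain_at[of f _ h] by (auto simp: ksmooth_on_0 o_def)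
next
  case (Suc n)
  have d: "f differentiable at x" "h differentiable at (f x)" if "x \<in> S" for x
    using Suc.prems that assms by (auto simp: ksmooth_on_Suc)
  have "ksmooth_on n S (dderiv [b] (\<lambda>x. h (f x)))" if "b \<in> Basis" for b
  proof (rule ksmooth_on_cong[OF assms(1)])
    show "ksmooth_on n S (\<lambda>x. dderiv [1] h (f x) * dderiv [b] f x)"
      by (rule ksmooth_on_bilinear[OF bounded_bilinear_mult assms(1) Suc.IH])
         (use that Suc.prems ksmooth_on_mono[OF Suc.prems(2)] in \<open>auto simp: ksmooth_on_Suc\<close>)
  qed (simp only: dderiv1_compose_real d)
  then show ?case using d differentiable_chain_at[of f _ h]
    unfolding ksmooth_on_Suc by (auto simp: o_def)
qed

lemma smooth_on_compose_real:
  fixes h :: "real \<Rightarrow> real"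
  assumes "open S" "smooth_on U h" "smooth_on S f" "f ` S \<subseteq> U"
  shows "smooth_on S (\<lambda>x. h (f x))"
  using assms ksmooth_on_compose_real unfolding smooth_on_iff_ksmooth_on by blast

lemma smooth_on_inner_Basis: "smooth_on S (\<lambda>x. x \<bullet> b)"
  by (intro smooth_on_bounded_linear bounded_linear_inner_left)

lemma dderiv1_norm_sq: "dderiv [b] (\<lambda>x::'a::euclidean_space. nsq x) = (\<lambda>x. 2 * (x \<bullet> b))"
proof
  fix x :: 'a
  have "((\<lambda>x::'a. nsq x) has_derivative (\<lambda>h. 2 * (x \<bullet> h))) (at x)"
    unfolding dot_square_norm[symmetric] by (auto intro!: derivative_eq_intros simp: inner_commute)
  then show "dderiv [b] (\<lambda>x::'a. nsq x) x = 2 * (x \<bullet> b)"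
    by (rule dderiv1_eqI)
qed

lemma smooth_on_norm_sq: "smooth_on S (\<lambda>x::'a::euclidean_space. nsq x)"
proof (rule smooth_onI_step)
  fix x :: 'a
  show "(\<lambda>x::'a. nsq x) differentiable at x"
    unfolding dot_square_norm[symmetric] by (intro differentiable_inner differentiable_ident)
  fix b :: 'a
  have "smooth_on S (\<lambda>x::'a. x \<bullet> (2 *\<^sub>R b))"
    by (rule smooth_on_inner_Basis)
  then show "smooth_on S (dderiv [b] (\<lambda>x::'a. nsq x))"
    unfolding dderiv1_norm_sq by (simp add: inner_commute)
qed

section \<open>Smooth functions of one real variable\<close>

lemma dderiv1_real:
  fixes h :: "real \<Rightarrow> real"
  assumes "(h has_real_derivative d) (at x)" shows "dderiv [1] h x = d"
  using dderiv1_eqI[OF assms[unfolded has_field_derivative_def], of 1] by simp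

text \<open>A sequence in which each function is the derivative of its predecessor certifies
  smoothness without any computation of \<open>dderiv\<close>. It serves for the reciprocal, the
  flat exponential, dilated cutoffs, integrals with a parameter, and finally for \<Phi>
  itself.\<close>

lemma ksmooth_on_tower:
  fixes H :: "nat \<Rightarrow> real \<Rightarrow> real"
  assumes "open U" "\<And>k x. x \<in> U \<Longrightarrow> (H k has_real_derivative H (Suc k) x) (at x)"
  shows "ksmooth_on n U (H k)"
proof (induction n arbitrary: k)
  case 0
  then show ?case
    using assms(2) unfolding ksmooth_on_0 differentiable_def has_field_derivative_def by blast
next
  case (Suc n)
  have "ksmooth_on n U (dderiv [1] (H k))"
    by (rule ksmooth_on_cong[OF assms(1) dderiv1_real[symmetric] Suc.IH[of "Suc k"]]) (use assms in auto)
  then show ?case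
    using assms(2) unfolding ksmooth_on_Suc differentiable_def has_field_derivative_def by auto
qed

lemma smooth_on_tower:
  fixes H :: "nat \<Rightarrow> real \<Rightarrow> real"
  assumes "open U" "\<And>k x. x \<in> U \<Longrightarrow> (H k has_real_derivative H (Suc k) x) (at x)"
  shows "smooth_on U (H k)"
  unfolding smooth_on_iff_ksmooth_on by (intro allI ksmooth_on_tower assms)

lemma dderiv_replicate_tower:
  fixes H :: "nat \<Rightarrow> real \<Rightarrow> real"
  assumes "open U" "\<And>k x. x \<in> U \<Longrightarrow> (H k has_real_derivative H (Suc k) x) (at x)"
  shows "x \<in> U \<Longrightarrow> dn n 1 (H k) x = H (n + k) x"
proof (induction n arbitrary: x)
  case (Suc n)
  have "dderiv [1] (dn n 1 (H k)) x = dderiv [1] (H (n + k)) x"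
    by (rule dderiv_cong_open[OF assms(1)]) (use Suc in auto)
  then show ?case
    using dderiv1_real[OF assms(2)[of x "n + k"]] Suc.prems by simp
qed auto

lemma smooth_on_inverse: "smooth_on (-{0}) (inverse :: real \<Rightarrow> real)"
proof -
  define H :: "nat \<Rightarrow> real \<Rightarrow> real" where "H k x = (- 1) ^ k * fact k * inverse x ^ Suc k" for k x
  have "(H k has_real_derivative H (Suc k) x) (at x)" if "x \<noteq> 0" for k x
    unfolding H_def using DERIV_cmult[OF DERIV_power_Suc[OF DERIV_inverse[OF that]], of "(- 1) ^ k * fact k" k]
    by (simp add: algebra_simps)
  then have "smooth_on (-{0}) (H 0)"
    by (intro smooth_on_tower) auto
  then show ?thesis
    by (simp add: H_def[abs_def])
qed

text \<open>The Leibniz rule without binomial coefficients: each derivative doubles the number of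
  terms, which accounts for the 2 in \<open>(2 * \<rho>) ^ n\<close>. The scale
  \<open>\<rho>\<close> is later \<open>1 / norm x\<close> or 1.\<close>

lemma dderiv_scaleR_bound:
  fixes a :: "'a::euclidean_space \<Rightarrow> real" and f :: "'a \<Rightarrow> 'b::real_normed_vector"
  assumes "open S" "x \<in> S" "b \<in> Basis" "0 \<le> \<rho>"
  shows "\<lbrakk>smooth_on S a; smooth_on S f; \<And>j. j \<le> n \<Longrightarrow> \<bar>dn j b a x\<bar> \<le> A * \<rho> ^ j;
     \<And>j. j \<le> n \<Longrightarrow> norm (dn j b f x) \<le> B * \<rho> ^ j\<rbrakk>
     \<Longrightarrow> norm (dn n b (\<lambda>x. a x *\<^sub>R f x) x) \<le> A * B * (2 * \<rho>) ^ n"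
proof (induction n arbitrary: a f A B)
  case 0
  from 0(3)[of 0] 0(4)[of 0] show ?case by (auto intro!: mult_mono)
next
  case (Suc n)
  have bb: "set (replicate k b) \<subseteq> Basis" for k using assms(3) by auto
  have s: "smooth_on S (dderiv [b] a)" "smooth_on S (dderiv [b] f)"
    using Suc.prems(1,2) assms(3) by (auto intro!: smooth_on_dderiv simp del: dderiv.simps)
  have "dn (Suc n) b (\<lambda>x. a x *\<^sub>R f x) x
      = dn n b (\<lambda>x. a x *\<^sub>R dderiv [b] f x + dderiv [b] a x *\<^sub>R f x) x"
    unfolding dderiv_replicate_Suc
    by (intro dderiv_cong_open[OF assms(1) _ assms(2)] dderiv1_bilinear[OF bounded_bilinear_scaleR]
        smooth_on_differentiable[OF Suc.prems(1)] smooth_on_differentiable[OF Suc.prems(2)])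
  also have "\<dots> = dn n b (\<lambda>x. a x *\<^sub>R dderiv [b] f x) x
      + dn n b (\<lambda>x. dderiv [b] a x *\<^sub>R f x) x"
    by (intro dderiv_add[OF assms(1)] smooth_on_scaleR s Suc.prems(1,2) assms(1,2) bb)
  \<comment> \<open>A derivative falling on \<open>f\<close> turns \<open>B\<close> into
    \<open>B * \<rho>\<close>, one falling on \<open>a\<close> turns \<open>A\<close> into
    \<open>A * \<rho>\<close>; the induction hypothesis then gives the same bound for both
    terms.\<close>
  also have "norm \<dots> \<le> A * (B * \<rho>) * (2 * \<rho>) ^ n + (A * \<rho>) * B * (2 * \<rho>) ^ n"
  proof (intro norm_triangle_le add_mono Suc.IH s Suc.prems(1,2))
    fix j assume "j \<le> n"
    then show "\<bar>dn j b (dderiv [b] a) x\<bar> \<le> A * \<rho> * \<rho> ^ j"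
      "norm (dn j b (dderiv [b] f) x) \<le> B * \<rho> * \<rho> ^ j"
      "\<bar>dn j b a x\<bar> \<le> A * \<rho> ^ j"
      "norm (dn j b f x) \<le> B * \<rho> ^ j"
      using Suc.prems(3)[of "Suc j"] Suc.prems(4)[of "Suc j"] Suc.prems(3)[of j] Suc.prems(4)[of j]
      unfolding dderiv_replicate_Suc by (auto simp: mult_ac simp del: dderiv.simps)
  qed
  finally show ?case by (simp add: algebra_simps)
qed

lemma dderiv_replicate_inner:
  "dn j b (\<lambda>x. 2 * (x \<bullet> b)) x
    = (if j = 0 then 2 * (x \<bullet> b) else if j = 1 then 2 * (b \<bullet> b) else 0)"
proof -
  have 1: "dderiv [b] (\<lambda>x. 2 * (x \<bullet> b)) = (\<lambda>x. 2 * (b \<bullet> b))"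
    by (rule dderiv1_bounded_linear)
       (auto intro!: bounded_linear_intros bounded_linear_compose[OF bounded_linear_mult_right])
  consider "j = 0" | "j = 1" | i where "j = Suc (Suc i)"
    by (metis One_nat_def not0_implies_Suc)
  then show ?thesis
  proof cases
    case 3
    show ?thesis unfolding 3 dderiv_replicate_Suc[of "Suc i"] 1 dderiv_replicate_const by simp
  next
    case 2
    have "dn j b = dderiv [b]" using 2 by simp
    then show ?thesis unfolding 1 using 2 by (simp del: dderiv.simps add: 1)
  qed simp
qed

text \<open>The quantities z^k h^(k)(z) at z = |x|^2 are invariant under dilation, and each
  derivative in x costs one factor 1/|x|. The constant is uniform in \<open>h\<close>,
  \<open>x\<close> and \<open>M\<close>, which permits dilated cutoffs and, for \<Phi>, a bound
  \<open>M\<close> that depends on the point.\<close>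

lemma dderiv_radial_bound:
  "\<exists>C\<ge>1. \<forall>b\<in>(Basis::'a::euclidean_space set). \<forall>h x M j. j \<le> n \<longrightarrow> smooth_on {0<..} h \<longrightarrow> x \<noteq> 0 \<longrightarrow>
     (\<forall>k\<le>n. norm x ^ (2 * k) * \<bar>dn k 1 h (nsq x)\<bar> \<le> M) \<longrightarrow>
     \<bar>dn j b (\<lambda>x. h (nsq x)) x\<bar> \<le> C * M * (1 / norm x) ^ j"
proof (induction n)
  case 0
  show ?case by (intro exI[of _ 1]) auto
next
  case (Suc n)
  then obtain C where C: "C \<ge> 1" and *: "\<And>b::'a. \<And>h x M j. b \<in> Basis \<Longrightarrow> j \<le> n \<Longrightarrow> smooth_on {0<..} h \<Longrightarrow> x \<noteq> 0 \<Longrightarrow>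
     (\<And>k. k\<le>n \<Longrightarrow> norm x ^ (2 * k) * \<bar>dn k 1 h (nsq x)\<bar> \<le> M) \<Longrightarrow>
     \<bar>dn j b (\<lambda>x. h (nsq x)) x\<bar> \<le> C * M * (1 / norm x) ^ j"
    by blast
  show ?case
  proof (intro exI[of _ "2 ^ Suc n * C"] conjI ballI allI impI)
    show "1 \<le> 2 ^ Suc n * C"
      using C mult_mono[of 1 "2 ^ Suc n" 1 C] by (simp del: power_Suc)
    fix b :: 'a and h x M j
    assume b: "b \<in> Basis" and j: "j \<le> Suc n" and h: "smooth_on {0<..} h" and x: "x \<noteq> (0::'a)"
      and M: "\<forall>k\<le>Suc n. norm x ^ (2 * k) * \<bar>dn k 1 h (nsq x)\<bar> \<le> M"
    have M0: "M \<ge> 0" using M[rule_format, of 0] by auto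
    show "\<bar>dn j b (\<lambda>x. h (nsq x)) x\<bar> \<le> 2 ^ Suc n * C * M * (1 / norm x) ^ j"
    proof (cases j)
      case 0
      have "\<bar>h (nsq x)\<bar> \<le> 1 * M" using M[rule_format, of 0] by auto
      also have "1 * M \<le> 2 ^ Suc n * C * M"
        using \<open>1 \<le> 2 ^ Suc n * C\<close> M0 by (intro mult_right_mono)
      finally show ?thesis using 0 by simp
    next
      case (Suc i)
      have i: "i \<le> n" using Suc j by simp
      have h': "smooth_on {0<..} (dderiv [1] h)"
        by (rule smooth_on_dderiv[OF h]) auto
      have op: "open (- {0::'a})" by auto
      have "dn j b (\<lambda>x. h (nsq x)) x
          = dn i b (\<lambda>x. dderiv [1] h (nsq x) *\<^sub>R (2 * (x \<bullet> b))) x"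
        unfolding Suc dderiv_replicate_Suc
      proof (rule dderiv_cong_open[OF op])
        fix y :: 'a assume y: "y \<in> - {0}"
        have "dderiv [b] (\<lambda>x. h (nsq x)) y = dderiv [1] h (nsq y) * dderiv [b] (\<lambda>x. nsq x) y"
          using y by (intro dderiv1_compose_real smooth_on_differentiable[OF smooth_on_norm_sq UNIV_I]
              smooth_on_differentiable[OF h]) auto
        then show "dderiv [b] (\<lambda>x. h (nsq x)) y = dderiv [1] h (nsq y) *\<^sub>R (2 * (y \<bullet> b))"
          unfolding dderiv1_norm_sq by (simp del: dderiv.simps)
      qed (use x in auto)
      \<comment> \<open>The derivative of \<open>h\<close> satisfies the hypothesis with
        \<open>M / nsq x\<close>, since one power of z is used up; the inner derivative
        \<open>2 * (x \<bullet> b)\<close> gives back \<open>2 * norm x\<close>. Its 2 and the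
        Leibniz factor \<open>2 ^ i\<close> make up the constant of the induction step.\<close>
      also have "norm \<dots> \<le> (C * (M / nsq x)) * (2 * norm x) * (2 * (1 / norm x)) ^ i"
      proof (rule dderiv_scaleR_bound[OF op _ b])
        show "smooth_on (- {0}) (\<lambda>x::'a. dderiv [1] h (nsq x))"
          by (rule smooth_on_compose_real[OF op h' smooth_on_norm_sq]) auto
        show "smooth_on (- {0}) (\<lambda>x. 2 * (x \<bullet> b))"
          by (intro smooth_on_mult op smooth_on_const smooth_on_inner_Basis)
        fix j assume ji: "j \<le> i"
        show "\<bar>dn j b (\<lambda>x. dderiv [1] h (nsq x)) x\<bar> \<le> C * (M / nsq x) * (1 / norm x) ^ j"
        proof (rule *[OF b _ h' x])
          fix k assume "k \<le> n"
          then show "norm x ^ (2 * k) * \<bar>dn k 1 (dderiv [1] h) (nsq x)\<bar> \<le> M / nsq x"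
            using M[rule_format, of "Suc k"] x unfolding dderiv_replicate_Suc
            by (simp add: field_simps power2_eq_square del: dderiv.simps)
        qed (use ji i in auto)
        show "norm (dn j b (\<lambda>x. 2 * (x \<bullet> b)) x) \<le> 2 * norm x * (1 / norm x) ^ j"
          unfolding dderiv_replicate_inner using b x Basis_le_norm[OF b, of x] by (auto simp: inner_commute)
      qed (use x in auto)
      also have "\<dots> = 2 ^ Suc i * (C * M * (1 / norm x) ^ Suc i)"
        using x by (simp add: field_simps power2_eq_square)
      also have "\<dots> \<le> 2 ^ Suc n * (C * M * (1 / norm x) ^ Suc i)"
        using i C M0 by (intro mult_right_mono power_increasing mult_nonneg_nonneg) auto
      finally show ?thesis using Suc by (simp add: mult_ac)
    qed
  qed
qed

lemma smooth_on_has_real_derivative: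
  fixes h :: "real \<Rightarrow> real"
  assumes "smooth_on U h" "x \<in> U"
  shows "(dn k 1 h has_real_derivative dn (Suc k) 1 h x) (at x)"
proof -
  have "smooth_on U (dn k 1 h)"
    by (rule smooth_on_dderiv[OF assms(1)]) auto
  from smooth_on_differentiable[OF this assms(2)]
  obtain d where d: "(dn k 1 h has_real_derivative d) (at x)"
    by (auto simp: real_differentiable_def)
  with dderiv1_real[OF d] show ?thesis by simp
qed

subsection \<open>A smooth cutoff\<close>

text \<open>The family p(1/x) exp(-1/x), extended by 0, is closed under differentiation: in t = 1/x
  the polynomial p becomes t^2 (p - p'), and \<open>[:0, 0, 1:]\<close> is t^2.\<close>

definition flat_exp :: "real poly \<Rightarrow> real \<Rightarrow> real" where
  "flat_exp p x = (if x > 0 then poly p (1 / x) / exp (1 / x) else 0)"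

primrec flat_exp_poly :: "nat \<Rightarrow> real poly" where
  "flat_exp_poly 0 = 1"
| "flat_exp_poly (Suc n) = [:0, 0, 1:] * (flat_exp_poly n - pderiv (flat_exp_poly n))"

lemma tendsto_poly_div_exp_0: "((\<lambda>x. poly p x / exp x) \<longlongrightarrow> (0::real)) at_top"
proof -
  have "((\<lambda>x. \<Sum>i\<le>degree p. coeff p i * (x ^ i / exp x)) \<longlongrightarrow> (\<Sum>i\<le>degree p. coeff p i * 0)) at_top"
    by (intro tendsto_sum tendsto_mult tendsto_const tendsto_power_div_exp_0)
  then show ?thesis by (simp add: poly_altdef sum_divide_distrib)
qed

lemma flat_exp_has_derivative:
  "(flat_exp p has_real_derivative flat_exp ([:0, 0, 1:] * (p - pderiv p)) x) (at x)"
proof -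
  consider "x > 0" | "x < 0" | "x = 0" by linarith
  then show ?thesis
  proof cases
    case 1
    have "((\<lambda>x. poly p (1 / x) / exp (1 / x)) has_real_derivative
        flat_exp ([:0, 0, 1:] * (p - pderiv p)) x) (at x)"
      using 1 unfolding flat_exp_def
      by (auto intro!: derivative_eq_intros DERIV_chain'[OF _ poly_DERIV] simp: field_simps power2_eq_square)
    then show ?thesis
      by (rule has_field_derivative_transform_within_open[of _ _ _ "{0<..}"]) (use 1 in \<open>auto simp: flat_exp_def\<close>)
  next
    case 2
    have "((\<lambda>x. 0) has_real_derivative 0) (at x)" by simp
    then have "(flat_exp p has_real_derivative 0) (at x)"
      by (rule has_field_derivative_transform_within_open[of _ _ _ "{..<0}"]) (use 2 in \<open>auto simp: flat_exp_def\<close>)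
    then show ?thesis using 2 by (simp add: flat_exp_def)
  next
    case 3
    have "((\<lambda>h. (flat_exp p (0 + h) - flat_exp p 0) / h) \<longlongrightarrow> 0) (at 0)"
    proof (rule filterlim_split_at)
      show "((\<lambda>h. (flat_exp p (0 + h) - flat_exp p 0) / h) \<longlongrightarrow> 0) (at_left 0)"
        by (rule tendsto_eventually) (auto simp: eventually_at_filter flat_exp_def)
      \<comment> \<open>Dividing by \<open>h\<close> multiplies the polynomial in 1/h by its
        variable, which is \<open>pCons 0 p\<close>; the exponential still wins.\<close>
      have "((\<lambda>h. poly (pCons 0 p) (inverse h) / exp (inverse h)) \<longlongrightarrow> 0) (at_right (0::real))"
        by (rule filterlim_compose[OF tendsto_poly_div_exp_0 filterlim_inverse_at_top_right])
      then show "((\<lambda>h. (flat_exp p (0 + h) - flat_exp p 0) / h) \<longlongrightarrow> 0) (at_right 0)"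
        by (rule Lim_transform_eventually) (auto simp: eventually_at_filter flat_exp_def field_simps)
    qed
    then show ?thesis
      using 3 by (simp add: DERIV_def flat_exp_def)
  qed
qed

lemma smooth_on_flat_exp: "smooth_on UNIV (flat_exp 1)"
proof -
  have "smooth_on UNIV (flat_exp (flat_exp_poly 0))"
    by (rule smooth_on_tower[where H="\<lambda>k. flat_exp (flat_exp_poly k)"])
       (use flat_exp_has_derivative in auto)
  then show ?thesis by simp
qed

text \<open>The denominator is positive everywhere because \<open>2 - s\<close> and
  \<open>s - 1\<close> add up to 1 and cannot both be nonpositive. The transition takes place on the
  interval from 1 to 2.\<close>

definition cutoff :: "real \<Rightarrow> real" where
  "cutoff s = flat_exp 1 (2 - s) * inverse (flat_exp 1 (2 - s) + flat_exp 1 (s - 1))"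

lemma cutoff_eq_1: "s \<le> 1 \<Longrightarrow> cutoff s = 1"
  by (simp add: cutoff_def flat_exp_def)

lemma cutoff_eq_0: "s \<ge> 2 \<Longrightarrow> cutoff s = 0"
  by (simp add: cutoff_def flat_exp_def)

lemma smooth_on_cutoff: "smooth_on UNIV cutoff"
proof -
  have id: "smooth_on UNIV (\<lambda>s::real. s)"
    by (rule smooth_on_bounded_linear) (rule bounded_linear_ident)
  have 1: "smooth_on UNIV (\<lambda>s. flat_exp 1 (2 - s))" "smooth_on UNIV (\<lambda>s. flat_exp 1 (s - 1))"
    by (rule smooth_on_compose_real[OF open_UNIV smooth_on_flat_exp]; 
        (intro smooth_on_diff smooth_on_const id open_UNIV)?; simp)+
  have "smooth_on UNIV (\<lambda>s. inverse (flat_exp 1 (2 - s) + flat_exp 1 (s - 1)))"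
    by (rule smooth_on_compose_real[OF open_UNIV smooth_on_inverse smooth_on_add[OF open_UNIV 1]])
       (auto simp: flat_exp_def add_pos_pos less_imp_neq[symmetric])
  then show ?thesis
    unfolding cutoff_def[abs_def] by (intro smooth_on_mult 1 open_UNIV)
qed

lemma cutoff_abs_le_1: "\<bar>cutoff s\<bar> \<le> 1"
proof -
  have "flat_exp 1 (2 - s) \<ge> 0" "flat_exp 1 (s - 1) \<ge> 0" "flat_exp 1 (2 - s) + flat_exp 1 (s - 1) > 0"
    by (auto simp: flat_exp_def add_pos_pos)
  then show ?thesis unfolding cutoff_def by (simp add: abs_mult field_simps)
qed

text \<open>For \<open>k\<close> at least 1 the derivative vanishes off the interval from 1 to 2,
  where \<open>cutoff\<close> is locally constant, and compactness bounds it on that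
  interval.\<close>

lemma cutoff_derivative_bound: "\<exists>B\<ge>1. \<forall>k\<le>n. \<forall>s>0. s ^ k * \<bar>dn k 1 cutoff s\<bar> \<le> B"
proof -
  have ex: "\<exists>B. \<forall>s>0. s ^ k * \<bar>dn k 1 cutoff s\<bar> \<le> B" for k
  proof (cases k)
    case 0
    then show ?thesis using cutoff_abs_le_1 by auto
  next
    case (Suc m)
    have sm: "smooth_on UNIV (dn k 1 cutoff)"
      by (rule smooth_on_dderiv[OF smooth_on_cutoff]) auto
    have "continuous_on {1..2} (\<lambda>s. s ^ k * \<bar>dn k 1 cutoff s\<bar>)"
      by (intro continuous_intros continuous_on_subset[OF smooth_on_continuous_on[OF sm]]) auto
    then have "bounded ((\<lambda>s. s ^ k * \<bar>dn k 1 cutoff s\<bar>) ` {1..2})"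
      by (intro compact_imp_bounded compact_continuous_image) auto
    then obtain B where B: "\<And>s. s \<in> {1..2} \<Longrightarrow> s ^ k * \<bar>dn k 1 cutoff s\<bar> \<le> B"
      by (force simp: bounded_iff)
    have z: "dn k 1 cutoff s = 0" if "s \<notin> {1..2}" for s
    proof -
      have c: "dn k 1 (\<lambda>s::real. c) s = 0" for c :: real
        unfolding Suc dderiv_replicate_const ..
      show ?thesis
      proof (cases "s < 1")
        case True
        have "dn k 1 cutoff s = dn k 1 (\<lambda>s. 1) s"
          by (rule dderiv_cong_open[of "{..<1}"]) (use True in \<open>auto simp: cutoff_eq_1\<close>)
        then show ?thesis using c by simp
      next
        case False
        have "dn k 1 cutoff s = dn k 1 (\<lambda>s. 0) s"
          by (rule dderiv_cong_open[of "{2<..}"]) (use False that in \<open>auto simp: cutoff_eq_0\<close>)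
        then show ?thesis using c by simp
      qed
    qed
    show ?thesis
      by (rule exI[of _ "max B 0"]) (metis B z abs_zero max.cobounded1 max.cobounded2 mult_zero_right order_trans)
  qed
  then obtain B where B: "\<And>k s. s > 0 \<Longrightarrow> s ^ k * \<bar>dn k 1 cutoff s\<bar> \<le> B k"
    by metis
  have "s ^ k * \<bar>dn k 1 cutoff s\<bar> \<le> max 1 (Max (B ` {..n}))" if "k \<le> n" "s > 0" for k s
  proof -
    have "B k \<le> Max (B ` {..n})" using that by (intro Max_ge) auto
    then show ?thesis using B[OF that(2), of k] by linarith
  qed
  then show ?thesis by (intro exI[of _ "max 1 (Max (B ` {..n}))"]) auto
qed

lemma smooth_on_cutoff_norm: "smooth_on S (\<lambda>x::'a::euclidean_space. cutoff (l * nsq x))"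
proof -
  have "smooth_on UNIV (\<lambda>x::'a. l * nsq x)"
    by (intro smooth_on_mult open_UNIV smooth_on_const smooth_on_norm_sq)
  from smooth_on_compose_real[OF open_UNIV smooth_on_cutoff this] show ?thesis
    by (auto intro: smooth_on_subset)
qed

text \<open>The bound is uniform in the dilation parameter because \<open>z\<^sup>k \<partial>\<^sub>z\<^sup>k\<close> commutes with dilations.\<close>

lemma cutoff_norm_derivative_bound:
  "\<exists>C\<ge>1. \<forall>b\<in>(Basis::'a::euclidean_space set). \<forall>l x j. j \<le> n \<longrightarrow> l > 0 \<longrightarrow> x \<noteq> 0 \<longrightarrow>
     \<bar>dn j b (\<lambda>x. cutoff (l * nsq x)) x\<bar> \<le> C * (1 / norm x) ^ j"
proof -
  obtain C where C: "C \<ge> 1" and *: "\<And>b::'a. \<And>h x M j. b \<in> Basis \<Longrightarrow> j \<le> n \<Longrightarrow> smooth_on {0<..} h \<Longrightarrow> x \<noteq> 0 \<Longrightarrow>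
     (\<And>k. k\<le>n \<Longrightarrow> norm x ^ (2 * k) * \<bar>dn k 1 h (nsq x)\<bar> \<le> M) \<Longrightarrow>
     \<bar>dn j b (\<lambda>x. h (nsq x)) x\<bar> \<le> C * M * (1 / norm x) ^ j"
    using dderiv_radial_bound[of n] by blast
  obtain B where B: "B \<ge> 1" "\<And>k s. k \<le> n \<Longrightarrow> s > 0 \<Longrightarrow> s ^ k * \<bar>dn k 1 cutoff s\<bar> \<le> B"
    using cutoff_derivative_bound[of n] by blast
  show ?thesis
  proof (intro exI[of _ "C * B"] conjI ballI allI impI)
    show "1 \<le> C * B" using C B mult_mono[of 1 C 1 B] by simp
    fix b :: 'a and l :: real and x :: 'a and j assume b: "b \<in> Basis" and j: "j \<le> n" "l > 0" "x \<noteq> 0"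
    have t: "((\<lambda>z. l ^ k * dn k 1 cutoff (l * z)) has_real_derivative
        l ^ Suc k * dn (Suc k) 1 cutoff (l * z)) (at z)" for k z
      using DERIV_cmult[OF DERIV_chain'[OF DERIV_cmult[OF DERIV_ident]
        smooth_on_has_real_derivative[OF smooth_on_cutoff UNIV_I]], of "l ^ k" k l z UNIV]
      by (simp add: mult_ac del: dderiv.simps replicate_Suc)
    have "smooth_on UNIV (\<lambda>z. l ^ 0 * dn 0 1 cutoff (l * z))"
      by (rule smooth_on_tower[where H="\<lambda>k z. l ^ k * dn k 1 cutoff (l * z)", OF open_UNIV t])
    then have sm: "smooth_on {0<..} (\<lambda>z. cutoff (l * z))"
      by (auto intro: smooth_on_subset)
    have tw: "dn k 1 (\<lambda>z. cutoff (l * z)) z = l ^ k * dn k 1 cutoff (l * z)" for k z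
      using dderiv_replicate_tower[where H="\<lambda>k z. l ^ k * dn k 1 cutoff (l * z)" and U=UNIV and n=k and k=0 and x=z, OF open_UNIV t]
      by simp
    show "\<bar>dn j b (\<lambda>x. cutoff (l * nsq x)) x\<bar> \<le> C * B * (1 / norm x) ^ j"
    proof (rule *[OF b j(1) sm j(3)])
      fix k assume "k \<le> n"
      then show "norm x ^ (2 * k) * \<bar>dn k 1 (\<lambda>z. cutoff (l * z)) (nsq x)\<bar> \<le> B"
        using B(2)[of k "l * nsq x"] j unfolding tw
        by (simp add: abs_mult power_mult_distrib power_mult[symmetric] mult_ac)
    qed
  qed
qed

subsection \<open>Division by a simple zero\<close>

text \<open>Hadamard's lemma at the point 1: k(t) is the average of h' over the segment from 1 to t,
  the integral of h'(1 + s (t - 1)) over s in [0, 1]. Smoothness follows by differentiating under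
  the integral.\<close>

lemma smooth_on_divided_difference:
  fixes h :: "real \<Rightarrow> real"
  assumes h: "smooth_on {0<..} h"
  obtains k where "smooth_on {0<..} k" "\<And>t. t > 0 \<Longrightarrow> h t - h 1 = (t - 1) * k t" "k 1 = dderiv [1] h 1"
proof -
  define D where "D j = dn j 1 h" for j
  have D: "(D j has_real_derivative D (Suc j) z) (at z)" if "z > 0" for j z
    using smooth_on_has_real_derivative[OF h, of z j] that unfolding D_def by (simp del: dderiv.simps replicate_Suc)
  have cD: "continuous_on {0<..} (D j)" for j
    by (intro continuous_at_imp_continuous_on ballI DERIV_isCont[OF D]) auto
  \<comment> \<open>The segment from 1 to \<open>t\<close> stays in the half line on which
    \<open>h\<close> is smooth.\<close>
  have pos: "1 + s * (t - 1) > 0" if "t > 0" "s \<in> {0..1}" for s t :: real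
  proof -
    have "1 + s * (t - 1) = (1 - s) + s * t" by (simp add: algebra_simps)
    moreover have "(1 - s) + s * t > 0"
      using that by (cases "s = 1") (auto intro: add_pos_nonneg)
    ultimately show ?thesis by simp
  qed
  \<comment> \<open>The candidate for the \<open>j\<close>-th derivative: each differentiation in
    \<open>t\<close> brings out one more factor \<open>s\<close>, so \<open>K\<close> is a
    tower.\<close>
  define K where "K j t = integral {0..1} (\<lambda>s. s ^ j * D (Suc j) (1 + s * (t - 1)))" for j t
  have K: "(K j has_real_derivative K (Suc j) t) (at t)" if t: "t \<in> {0<..}" for j t
  proof -
    have "((\<lambda>t. integral (cbox 0 1) (\<lambda>s. s ^ j * D (Suc j) (1 + s * (t - 1)))) has_real_derivative
       integral (cbox 0 1) (\<lambda>s. s ^ Suc j * D (Suc (Suc j)) (1 + s * (t - 1)))) (at t within {0<..})"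
    proof (rule leibniz_rule_field_derivative)
      fix x s :: real assume xs: "x \<in> {0<..}" "s \<in> cbox 0 1"
      have "((\<lambda>x. s ^ j * D (Suc j) (1 + s * (x - 1))) has_real_derivative
             s ^ j * (D (Suc (Suc j)) (1 + s * (x - 1)) * s)) (at x)"
        using xs pos
        by (intro DERIV_cmult DERIV_chain'[of "\<lambda>x. 1 + s * (x - 1)" s x UNIV "D (Suc j)", OF _ D])
           (auto intro!: derivative_eq_intros)
      then show "((\<lambda>x. s ^ j * D (Suc j) (1 + s * (x - 1))) has_real_derivative
             s ^ Suc j * D (Suc (Suc j)) (1 + s * (x - 1))) (at x within {0<..})"
        by (auto simp: mult_ac intro: has_field_derivative_at_within)
    next
      fix x :: real assume "x \<in> {0<..}"
      then show "(\<lambda>s. s ^ j * D (Suc j) (1 + s * (x - 1))) integrable_on cbox 0 1"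
        using pos by (intro integrable_continuous continuous_intros continuous_on_compose2[OF cD]) auto
    next
      show "continuous_on ({0<..} \<times> cbox 0 1) (\<lambda>(x, t). t ^ Suc j * D (Suc (Suc j)) (1 + t * (x - 1)))"
        using pos unfolding split_beta by (intro continuous_intros continuous_on_compose2[OF cD]) auto
    qed (use t in auto)
    moreover have "at t within {0<..} = at t"
      using t by (intro at_within_open) auto
    moreover have "K i = (\<lambda>t. integral (cbox 0 1) (\<lambda>s. s ^ i * D (Suc i) (1 + s * (t - 1))))" for i
      by (rule ext) (simp only: K_def box_real)
    ultimately show ?thesis
      by (simp only:)
  qed
  show ?thesis
  proof
    show "smooth_on {0<..} (K 0)"
      by (rule smooth_on_tower[where H=K, OF _ K]) auto
    show "K 0 1 = dderiv [1] h 1" by (simp add: K_def D_def)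
    fix t :: real assume t: "t > 0"
    have "((\<lambda>s. D 1 (1 + s * (t - 1)) * (t - 1)) has_integral D 0 (1 + 1 * (t - 1)) - D 0 (1 + 0 * (t - 1))) {0..1}"
    proof (rule fundamental_theorem_of_calculus)
      fix s :: real assume s: "s \<in> {0..1}"
      have "((\<lambda>s. D 0 (1 + s * (t - 1))) has_real_derivative D 1 (1 + s * (t - 1)) * (t - 1)) (at s)"
        unfolding One_nat_def
        by (rule DERIV_chain'[of "\<lambda>s. 1 + s * (t - 1)" "t - 1" s UNIV "D 0", OF _ D[OF pos[OF t s]]])
           (auto intro!: derivative_eq_intros)
      then show "((\<lambda>s. D 0 (1 + s * (t - 1))) has_vector_derivative D 1 (1 + s * (t - 1)) * (t - 1)) (at s within {0..1})"
        by (auto simp: has_real_derivative_iff_has_vector_derivative intro: has_vector_derivative_at_within)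
    qed auto
    then have "integral {0..1} (\<lambda>s. D 1 (1 + s * (t - 1)) * (t - 1)) = h t - h 1"
      by (auto dest!: integral_unique simp: D_def)
    then show "h t - h 1 = (t - 1) * K 0 t"
      by (simp add: K_def mult_ac)
  qed
qed

section \<open>Integrals of radial functions\<close>

text \<open>The image of Lebesgue measure under z = |\<xi>|^2 is determined by the volumes of balls,
  v z^(d/2) with v the volume of the unit ball; differentiating in z gives the density c z^(d/2 -
  1).\<close>

lemma nn_integral_radial:
  fixes F :: "real \<Rightarrow> ennreal"
  assumes [measurable]: "F \<in> borel_measurable borel"
  defines "d \<equiv> real DIM('a::euclidean_space)"
  defines "c \<equiv> unit_ball_vol d * d / 2"
  shows "(\<integral>\<^sup>+ \<xi>. F (nsq (\<xi>::'a)) \<partial>lborel)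
    = (\<integral>\<^sup>+ z. indicator {0..} z * ennreal (c * z powr (d / 2 - 1)) * F z \<partial>lborel)"
proof -
  have d: "d > 0" by (simp add: d_def)
  have c: "c > 0" using d by (simp add: c_def)
  define g where "g z = (indicator {0..} z * ennreal (c * z powr (d / 2 - 1)) :: ennreal)" for z :: real
  have [measurable]: "g \<in> borel_measurable borel" unfolding g_def by measurable
  \<comment> \<open>The sign is reversed because the uniqueness theorem compares half lines
    \<open>{x<..}\<close> of finite measure; after negation these correspond to balls instead of
    their complements.\<close>
  define M where "M = distr lborel borel (\<lambda>\<xi>::'a. - nsq \<xi>)"
  define N where "N = distr (density lborel g) borel uminus"
  have N: "emeasure N {x<..} = ennreal (unit_ball_vol d * (if x < 0 then sqrt (- x) ^ DIM('a) else 0))" for x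
  proof -
    have vim: "(uminus -` {x<..}) = {..<-x}" by auto
    have "emeasure N {x<..} = emeasure (density lborel g) {..<-x}"
      unfolding N_def by (subst emeasure_distr) (auto simp: vim)
    also have "\<dots> = (\<integral>\<^sup>+ z. g z * indicator {..<-x} z \<partial>lborel)"
      by (subst emeasure_density) auto
    also have "\<dots> = ennreal (unit_ball_vol d * (if x < 0 then sqrt (- x) ^ DIM('a) else 0))"
    proof (cases "x < 0")
      case True
      have "(\<integral>\<^sup>+ z. g z * indicator {..<-x} z \<partial>lborel) = (\<integral>\<^sup>+ z. indicator {0..-x} z * ennreal (c * z powr (d / 2 - 1)) \<partial>lborel)"
        by (intro nn_integral_cong_AE eventually_mono[OF AE_lborel_singleton[of "-x"]])
           (auto simp: g_def indicator_def)
      also have "\<dots> = ennreal (c * ((- x) powr (d / 2 - 1 + 1) / (d / 2 - 1 + 1)))"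
      proof -
        have "((\<lambda>z. c * z powr (d / 2 - 1)) has_integral c * ((- x) powr (d / 2 - 1 + 1) / (d / 2 - 1 + 1))) {0..-x}"
          using True d by (intro has_integral_mult_right has_integral_powr_from_0) auto
        then show ?thesis
          using c nn_integral_has_integral_lebesgue[of "{0..-x}" "\<lambda>z. c * z powr (d / 2 - 1)"]
          by (simp add: nn_integral_completion ennreal_mult' ennreal_indicator)
      qed
      also have "(- x) powr (d / 2 - 1 + 1) = sqrt (- x) ^ DIM('a)"
      proof -
        have "sqrt (- x) ^ DIM('a) = ((- x) powr (1/2)) powr d"
          using True by (simp add: powr_half_sqrt d_def powr_realpow)
        then show ?thesis by (simp add: powr_powr)
      qed
      finally show ?thesis using True d by (simp add: c_def)
    next
      case False
      then have "(\<lambda>z. g z * indicator {..<-x} z) = (\<lambda>z. 0)"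
        by (auto simp: g_def indicator_def)
      then show ?thesis using False by (simp del: mult_eq_0_iff)
    qed
    finally show ?thesis .
  qed
  have "M = N"
  proof (rule measure_eqI_lessThan)
    fix x :: real
    have "emeasure M {x<..} = ennreal (unit_ball_vol d * (if x < 0 then sqrt (- x) ^ DIM('a) else 0))"
    proof -
      have "(\<lambda>\<xi>::'a. - nsq \<xi>) -` {x<..} = (if x < 0 then ball 0 (sqrt (-x)) else {})"
      proof -
        have "norm \<xi> < sqrt (- x) \<longleftrightarrow> nsq \<xi> < - x" for \<xi> :: 'a
          using real_sqrt_less_iff[of "nsq \<xi>" "- x"] by simp
        moreover have "\<not> x < 0 \<Longrightarrow> \<not> nsq \<xi> < - x" for \<xi> :: 'a
          using zero_le_power2[of "norm \<xi>"] by linarith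
        ultimately show ?thesis by (auto simp: less_minus_iff[of x])
      qed
      then show ?thesis
        unfolding M_def by (subst emeasure_distr) (auto simp: emeasure_ball d_def)
    qed
    then show "emeasure M {x<..} = emeasure N {x<..}" "emeasure M {x<..} < \<infinity>"
      by (auto simp: N)
  qed (auto simp: M_def N_def)
  then have "(\<integral>\<^sup>+ y. F (- y) \<partial>M) = (\<integral>\<^sup>+ y. F (- y) \<partial>N)" by simp
  then show ?thesis
    unfolding M_def N_def g_def[symmetric]
    by (simp add: nn_integral_distr nn_integral_density)
qed

text \<open>The weight |\<xi>|^-d is z^(-d/2) and cancels the radial density up to 1/z. This is how
  the scale invariant measure dz/z arises.\<close>

lemma nn_integral_radial_div:
  fixes F :: "real \<Rightarrow> ennreal"
  assumes [measurable]: "F \<in> borel_measurable borel"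
  defines "d \<equiv> real DIM('a::euclidean_space)"
  defines "c \<equiv> unit_ball_vol d * d / 2"
  shows "(\<integral>\<^sup>+ \<xi>. F (nsq (\<xi>::'a)) * ennreal (1 / norm \<xi> ^ DIM('a)) \<partial>lborel)
    = ennreal c * (\<integral>\<^sup>+ z. indicator {0<..} z * ennreal (1 / z) * F z \<partial>lborel)"
proof -
  have c: "c \<ge> 0" by (simp add: c_def d_def)
  have "(\<integral>\<^sup>+ \<xi>. F (nsq (\<xi>::'a)) * ennreal (1 / norm \<xi> ^ DIM('a)) \<partial>lborel)
      = (\<integral>\<^sup>+ \<xi>. (\<lambda>z. F z * ennreal (1 / z powr (d / 2))) (nsq (\<xi>::'a)) \<partial>lborel)"
  proof (intro nn_integral_cong)
    fix \<xi> :: 'a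
    have "norm \<xi> ^ DIM('a) = (nsq \<xi>) powr (d / 2)"
    proof (cases "\<xi> = 0")
      case False
      then have "(nsq \<xi>) powr (d / 2) = (norm \<xi> powr 2) powr (d / 2)"
        by simp
      also have "\<dots> = norm \<xi> ^ DIM('a)"
        using False unfolding powr_powr by (simp add: d_def powr_realpow)
      finally show ?thesis by simp
    qed simp
    then show "F (nsq \<xi>) * ennreal (1 / norm \<xi> ^ DIM('a)) = F (nsq \<xi>) * ennreal (1 / (nsq \<xi>) powr (d / 2))"
      by simp
  qed
  also have "\<dots> = (\<integral>\<^sup>+ z. indicator {0..} z * ennreal (c * z powr (d / 2 - 1)) * (F z * ennreal (1 / z powr (d / 2))) \<partial>lborel)"
    unfolding c_def d_def by (rule nn_integral_radial) measurable
  also have "\<dots> = (\<integral>\<^sup>+ z. ennreal c * (indicator {0<..} z * ennreal (1 / z) * F z) \<partial>lborel)"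
  proof (intro nn_integral_cong)
    fix z :: real
    consider "z < 0" | "z = 0" | "z > 0" by linarith
    then show "indicator {0..} z * ennreal (c * z powr (d / 2 - 1)) * (F z * ennreal (1 / z powr (d / 2)))
        = ennreal c * (indicator {0<..} z * ennreal (1 / z) * F z)"
    proof cases
      case 3
      have "c * z powr (d / 2 - 1) * (1 / z powr (d / 2)) = c * (1 / z)"
        using 3 by (simp add: powr_diff)
      then have "ennreal (c * z powr (d / 2 - 1)) * ennreal (1 / z powr (d / 2)) = ennreal c * ennreal (1 / z)"
        using 3 c by (simp add: ennreal_mult[symmetric] del: times_divide_eq_right)
      then show ?thesis using 3 by (simp add: mult_ac)
    qed auto
  qed
  also have "\<dots> = ennreal c * (\<integral>\<^sup>+ z. indicator {0<..} z * ennreal (1 / z) * F z \<partial>lborel)"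
    by (rule nn_integral_cmult) measurable
  finally show ?thesis .
qed

text \<open>In the radial variable the extra factor 1/|x| is z^(-1/2), so the integral is that of
  z^(-3/2) from a^2 to infinity, namely 2/a; the 2 cancels the one in the radial constant.\<close>

lemma nn_integral_norm_tail:
  fixes a :: real
  assumes a: "a > 0"
  defines "d \<equiv> real DIM('a::euclidean_space)"
  shows "(\<integral>\<^sup>+ x. indicator {x. a \<le> norm x} x * ennreal (1 / norm (x::'a) ^ (DIM('a) + 1)) \<partial>lborel)
    = ennreal (unit_ball_vol d * d / a)"
proof -
  define F where "F z = (indicator {a\<^sup>2..} z * ennreal (z powr (- (1/2))) :: ennreal)" for z :: real
  have [measurable]: "F \<in> borel_measurable borel" unfolding F_def by measurable
  have "(\<integral>\<^sup>+ x. indicator {x. a \<le> norm x} x * ennreal (1 / norm (x::'a) ^ (DIM('a) + 1)) \<partial>lborel)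
      = (\<integral>\<^sup>+ x. F (nsq (x::'a)) * ennreal (1 / norm x ^ DIM('a)) \<partial>lborel)"
  proof (intro nn_integral_cong)
    fix x :: 'a
    show "indicator {x. a \<le> norm x} x * ennreal (1 / norm x ^ (DIM('a) + 1)) = F (nsq x) * ennreal (1 / norm x ^ DIM('a))"
    proof (cases "a \<le> norm x")
      case True
      then have "(nsq x) powr (- (1/2)) = 1 / norm x"
        using a by (simp add: powr_minus powr_half_sqrt inverse_eq_divide)
      moreover have "a\<^sup>2 \<le> nsq x" using True a by (intro power_mono) auto
      ultimately show ?thesis
        using True a by (simp add: F_def ennreal_mult[symmetric])
    next
      case False
      then have "\<not> a\<^sup>2 \<le> nsq x" using a by (simp add: abs_le_square_iff[symmetric])
      then show ?thesis using False by (simp add: F_def)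
    qed
  qed
  also have "\<dots> = ennreal (unit_ball_vol d * d / 2) * (\<integral>\<^sup>+ z. indicator {0<..} z * ennreal (1 / z) * F z \<partial>lborel)"
    unfolding d_def by (rule nn_integral_radial_div) measurable
  also have "(\<integral>\<^sup>+ z. indicator {0<..} z * ennreal (1 / z) * F z \<partial>lborel)
      = (\<integral>\<^sup>+ z. ennreal (z powr (- (3/2))) * indicator {a\<^sup>2..} z \<partial>lborel)"
  proof (intro nn_integral_cong)
    fix z :: real
    have "z > 0 \<Longrightarrow> 1 / z * z powr (- (1/2)) = z powr (- (3/2))"
      using powr_add[of z "-1" "- (1/2)"] by (simp add: powr_minus inverse_eq_divide)
    then show "indicator {0<..} z * ennreal (1 / z) * F z = ennreal (z powr (- (3/2))) * indicator {a\<^sup>2..} z"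
      using a by (auto simp: F_def indicator_def ennreal_mult[symmetric] not_less)
        (meson not_le order_trans zero_le_power2 less_le_trans zero_less_power le_less_trans)+
  qed
  also have "\<dots> = ennreal (0 - (- 2 * (a\<^sup>2) powr (- (1/2))))"
  proof (rule nn_integral_FTC_atLeast)
    fix z :: real assume "a\<^sup>2 \<le> z"
    then have "z > 0" using a by (meson less_le_trans zero_less_power)
    then show "((\<lambda>z. - 2 * z powr (- (1/2))) has_real_derivative z powr (- (3/2))) (at z)"
      by (auto intro!: derivative_eq_intros simp: powr_add[symmetric] powr_minus[symmetric])
    show "0 \<le> z powr (- (3/2))" by simp
  next
    have "((\<lambda>z::real. - 2 * z powr (- (1/2))) \<longlongrightarrow> - 2 * 0) at_top"
      by (intro tendsto_mult tendsto_const tendsto_neg_powr filterlim_ident) auto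
    then show "((\<lambda>z::real. - 2 * z powr (- (1/2))) \<longlongrightarrow> 0) at_top" by simp
  qed measurable
  also have "(a\<^sup>2) powr (- (1/2)) = 1 / a"
    using a by (simp add: powr_minus powr_half_sqrt inverse_eq_divide)
  also have "ennreal (unit_ball_vol d * d / 2) * ennreal (0 - (- 2 * (1 / a))) = ennreal (unit_ball_vol d * d / a)"
    using a by (subst ennreal_mult[symmetric]) (auto simp: d_def)
  finally show ?thesis .
qed

text \<open>A piecewise substitute for (1 + |x|)^-(d+1), the common integrable majorant for
  transforms.\<close>

definition decay_weight :: "'a::euclidean_space \<Rightarrow> real" where
  "decay_weight x = (if norm x < 1 then 1 else 1 / norm x ^ (DIM('a) + 1))"

lemma decay_weight_nonneg: "decay_weight x \<ge> 0"
  by (simp add: decay_weight_def)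

lemma borel_measurable_decay_weight [measurable]: "decay_weight \<in> borel_measurable borel"
  unfolding decay_weight_def by measurable

lemma nn_integral_decay_weight:
  "(\<integral>\<^sup>+ x. ennreal (decay_weight (x::'a::euclidean_space)) \<partial>lborel) < \<infinity>"
proof -
  have "(\<integral>\<^sup>+ x. ennreal (decay_weight (x::'a)) \<partial>lborel) \<le>
     (\<integral>\<^sup>+ x. indicator (ball (0::'a) 1) x + indicator {x. 1 \<le> norm x} x * ennreal (1 / norm x ^ (DIM('a) + 1)) \<partial>lborel)"
    by (intro nn_integral_mono) (auto simp: decay_weight_def indicator_def)
  also have "\<dots> = emeasure lborel (ball (0::'a) 1) + ennreal (unit_ball_vol (real DIM('a)) * real DIM('a) / 1)"
    by (subst nn_integral_add) (measurable, auto simp: nn_integral_norm_tail[where 'a='a, of 1, simplified])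
  also have "\<dots> < \<infinity>"
    using emeasure_lborel_ball_finite[of "0::'a" 1] by (simp add: ennreal_add_eq_top less_top[symmetric])
  finally show ?thesis .
qed

lemma integrable_decay_weight: "integrable lborel (decay_weight :: 'a::euclidean_space \<Rightarrow> real)"
  by (rule integrableI_nonneg) (use nn_integral_decay_weight[where 'a='a] in \<open>auto simp: decay_weight_nonneg\<close>)

lemma integrable_decay_bound:
  fixes f :: "'a::euclidean_space \<Rightarrow> 'b::{banach, second_countable_topology}"
  assumes "f \<in> borel_measurable borel" "\<And>x. norm (f x) \<le> K * decay_weight x"
  shows "integrable lborel f"
proof (rule Bochner_Integration.integrable_bound)
  show "integrable lborel (\<lambda>x::'a. K * decay_weight x)"
    by (intro integrable_mult_right integrable_decay_weight)
qed (use assms in \<open>auto intro: order_trans[OF _ abs_ge_self]\<close>)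

section \<open>Schwartz functions and test functions\<close>

lemma dderiv_bounded_linear_compose:
  assumes "open S" "smooth_on S f" "bounded_linear L" "set vs \<subseteq> Basis" "x \<in> S"
  shows "dderiv vs (\<lambda>x. L (f x)) x = L (dderiv vs f x)"
  using assms(4,5)
proof (induction vs arbitrary: x)
  case (Cons v vs)
  have d: "dderiv vs f differentiable at x"
    using assms(2) Cons.prems by (auto simp: smooth_on_def)
  have "dderiv (v # vs) (\<lambda>x. L (f x)) x = dderiv [v] (\<lambda>x. L (dderiv vs f x)) x"
    using frechet_derivative_cong_open[OF assms(1) Cons.prems(2), of "dderiv vs (\<lambda>x. L (f x))"] Cons by simp
  also have "\<dots> = L (frechet_derivative (dderiv vs f) (at x) v)"
    by (rule dderiv1_eqI[where D="\<lambda>h. L (frechet_derivative (dderiv vs f) (at x) h)"])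
       (use d in \<open>auto intro!: bounded_linear.has_derivative[OF assms(3)] simp: frechet_derivative_works\<close>)
  finally show ?case by simp
qed auto

lemma smooth_on_bounded_linear_compose:
  assumes "open S" "smooth_on S f" "bounded_linear L"
  shows "smooth_on S (\<lambda>x. L (f x))"
  unfolding smooth_on_def
proof (intro allI impI ballI)
  fix vs :: "'a list" and x assume *: "set vs \<subseteq> Basis" "x \<in> S"
  show "dderiv vs (\<lambda>x. L (f x)) differentiable at x"
  proof (rule differentiable_cong_open[OF assms(1) *(2)])
    show "L (dderiv vs f y) = dderiv vs (\<lambda>x. L (f x)) y" if "y \<in> S" for y
      by (rule dderiv_bounded_linear_compose[OF assms *(1) that, symmetric])
    have "dderiv vs f differentiable at x"
      using * assms(2) by (auto simp: smooth_on_def)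
    then show "(\<lambda>y. L (dderiv vs f y)) differentiable at x"
      unfolding differentiable_def using bounded_linear.has_derivative[OF assms(3)] by blast
  qed
qed

lemma schwartz_smooth_on: "schwartz f \<Longrightarrow> smooth_on S f"
  unfolding schwartz_def smooth_iff_smooth_on by (auto intro: smooth_on_subset)

lemma schwartz_dderiv: "schwartz f \<Longrightarrow> set vs \<subseteq> Basis \<Longrightarrow> schwartz (dderiv vs f)"
  unfolding schwartz_def smooth_def dderiv_append[symmetric] by auto

lemma schwartz_bound:
  assumes "schwartz f" "set vs \<subseteq> Basis"
  obtains K where "K \<ge> 0" "\<And>x. norm x ^ k * norm (dderiv vs f x) \<le> K"
proof -
  have "bounded (range (\<lambda>x. norm x ^ k *\<^sub>R dderiv vs f x))"
    using assms unfolding schwartz_def by blast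
  then obtain K where "\<And>x. norm x ^ k * norm (dderiv vs f x) \<le> K"
    by (auto simp: bounded_iff)
  then show ?thesis
    by (intro that[of "max K 0"]) (auto intro: max.coboundedI1)
qed

lemma schwartzI:
  assumes "smooth_on UNIV f" "\<And>vs k. set vs \<subseteq> Basis \<Longrightarrow> \<exists>K. \<forall>x. norm x ^ k * norm (dderiv vs f x) \<le> K"
  shows "schwartz f"
  unfolding schwartz_def smooth_iff_smooth_on
proof (intro conjI allI impI assms(1))
  fix vs :: "'a list" and k assume "set vs \<subseteq> Basis"
  then obtain K where "\<forall>x. norm x ^ k * norm (dderiv vs f x) \<le> K" using assms(2) by blast
  then show "bounded (range (\<lambda>x. norm x ^ k *\<^sub>R dderiv vs f x))"
    unfolding bounded_iff by (intro exI[of _ K]) auto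
qed

lemma schwartz_add:
  assumes "schwartz f" "schwartz g" shows "schwartz (\<lambda>x. f x + g x)"
proof (rule schwartzI)
  fix vs :: "'a list" and k assume vs: "set vs \<subseteq> Basis"
  obtain K L where K: "\<And>x. norm x ^ k * norm (dderiv vs f x) \<le> K" and L: "\<And>x. norm x ^ k * norm (dderiv vs g x) \<le> L"
    using schwartz_bound[OF assms(1) vs] schwartz_bound[OF assms(2) vs] by metis
  have "norm x ^ k * norm (dderiv vs (\<lambda>x. f x + g x) x) \<le> K + L" for x
  proof -
    have "norm x ^ k * norm (dderiv vs (\<lambda>x. f x + g x) x)
        \<le> norm x ^ k * (norm (dderiv vs f x) + norm (dderiv vs g x))"
      by (subst dderiv_add[OF open_UNIV schwartz_smooth_on[OF assms(1)] schwartz_smooth_on[OF assms(2)] vs])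
         (auto intro!: mult_left_mono norm_triangle_ineq)
    also have "\<dots> \<le> K + L" using K[of x] L[of x] by (simp add: distrib_left)
    finally show ?thesis .
  qed
  then show "\<exists>K. \<forall>x. norm x ^ k * norm (dderiv vs (\<lambda>x. f x + g x) x) \<le> K" by blast
qed (intro smooth_on_add open_UNIV schwartz_smooth_on assms)

lemma schwartz_bounded_linear:
  assumes f: "schwartz f" and L: "bounded_linear L" shows "schwartz (\<lambda>x. L (f x))"
proof (rule schwartzI)
  fix vs :: "'a list" and k assume vs: "set vs \<subseteq> Basis"
  obtain K where K: "\<And>x. norm x ^ k * norm (dderiv vs f x) \<le> K"
    using schwartz_bound[OF f vs] by metis
  obtain B where B: "B > 0" "\<And>z. norm (L z) \<le> norm z * B"
    using bounded_linear.pos_bounded[OF L] by blast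
  have "norm x ^ k * norm (dderiv vs (\<lambda>x. L (f x)) x) \<le> K * B" for x
  proof -
    have "norm x ^ k * norm (dderiv vs (\<lambda>x. L (f x)) x) \<le> norm x ^ k * (norm (dderiv vs f x) * B)"
      by (subst dderiv_bounded_linear_compose[OF open_UNIV schwartz_smooth_on[OF f] L vs])
         (auto intro!: mult_left_mono B)
    also have "\<dots> \<le> K * B" using mult_right_mono[OF K[of x], of B] B by (simp add: mult_ac)
    finally show ?thesis .
  qed
  then show "\<exists>K. \<forall>x. norm x ^ k * norm (dderiv vs (\<lambda>x. L (f x)) x) \<le> K" by blast
qed (rule smooth_on_bounded_linear_compose[OF open_UNIV schwartz_smooth_on[OF f] L])

lemma schwartz_cmult: "schwartz f \<Longrightarrow> schwartz (\<lambda>x. c * f x)"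
  by (rule schwartz_bounded_linear[OF _ bounded_linear_mult_right])

lemma schwartz_uminus: "schwartz f \<Longrightarrow> schwartz (\<lambda>x. - f x)"
  using schwartz_cmult[of f "-1"] by simp

text \<open>Peeling off the innermost derivative produces \<open>x \<bullet> c\<close> times a
  derivative of \<open>f\<close>, which is again Schwartz and covered by induction over all
  \<open>f\<close>, plus a constant multiple of \<open>f\<close>.\<close>

lemma schwartz_inner_bound:
  assumes "set vs \<subseteq> Basis"
  shows "schwartz f \<Longrightarrow> \<exists>K. \<forall>x. norm x ^ k * norm (dderiv vs (\<lambda>x. (x \<bullet> c) *\<^sub>R f x) x) \<le> K"
  using assms
proof (induction vs arbitrary: f rule: rev_induct)
  case Nil
  obtain K where K: "\<And>x. norm x ^ Suc k * norm (f x) \<le> K"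
    using schwartz_bound[OF Nil(1), of "[]" "Suc k"] by auto
  have "norm x ^ k * norm ((x \<bullet> c) *\<^sub>R f x) \<le> K * norm c" for x
  proof -
    have "norm x ^ k * norm ((x \<bullet> c) *\<^sub>R f x) \<le> norm x ^ k * ((norm x * norm c) * norm (f x))"
      by (auto intro!: mult_left_mono mult_right_mono Cauchy_Schwarz_ineq2)
    also have "\<dots> \<le> K * norm c" using mult_right_mono[OF K[of x], of "norm c"] by (simp add: mult_ac)
    finally show ?thesis .
  qed
  then show ?case by auto
next
  case (snoc b vs)
  have b: "b \<in> Basis" and vs: "set vs \<subseteq> Basis" using snoc.prems by auto
  let ?m = "\<lambda>x. (x \<bullet> c) *\<^sub>R f x" and ?m' = "\<lambda>x. (x \<bullet> c) *\<^sub>R dderiv [b] f x" and ?n = "\<lambda>x. (b \<bullet> c) *\<^sub>R f x"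
  have f': "schwartz (dderiv [b] f)"
    by (rule schwartz_dderiv[OF snoc.prems(1)]) (use b in auto)
  have cf: "schwartz ?n"
    by (rule schwartz_bounded_linear[OF snoc.prems(1) bounded_linear_scaleR_right])
  obtain K where K: "\<And>x. norm x ^ k * norm (dderiv vs ?m' x) \<le> K"
    using snoc.IH[OF f' vs] by blast
  obtain L where L: "\<And>x. norm x ^ k * norm (dderiv vs ?n x) \<le> L"
    using schwartz_bound[OF cf vs] by metis
  have eq: "dderiv (vs @ [b]) ?m x
      = dderiv vs ?m' x + dderiv vs ?n x" for x
  proof -
    have "dderiv [b] ?m y = (y \<bullet> c) *\<^sub>R dderiv [b] f y + (b \<bullet> c) *\<^sub>R f y" for y
    proof -
      have "dderiv [b] ?m y
          = (y \<bullet> c) *\<^sub>R dderiv [b] f y + dderiv [b] (\<lambda>x. x \<bullet> c) y *\<^sub>R f y"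
        by (rule dderiv1_bilinear[OF bounded_bilinear_scaleR
              smooth_on_differentiable[OF smooth_on_inner_Basis UNIV_I]
              smooth_on_differentiable[OF schwartz_smooth_on[OF snoc.prems(1)] UNIV_I]])
      also have "dderiv [b] (\<lambda>x. x \<bullet> c) y = b \<bullet> c"
        by (simp only: dderiv1_bounded_linear[OF bounded_linear_inner_left])
      finally show ?thesis .
    qed
    then have "dderiv (vs @ [b]) ?m x
        = dderiv vs (\<lambda>y. (y \<bullet> c) *\<^sub>R dderiv [b] f y + (b \<bullet> c) *\<^sub>R f y) x"
      unfolding dderiv_append by presburger
    also have "\<dots> = dderiv vs ?m' x + dderiv vs ?n x"
      by (rule dderiv_add[OF open_UNIV _ _ vs UNIV_I])
         (intro smooth_on_scaleR open_UNIV smooth_on_inner_Basis schwartz_smooth_on f' cf)+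
    finally show ?thesis .
  qed
  have "norm x ^ k * norm (dderiv (vs @ [b]) ?m x) \<le> K + L" for x
  proof -
    have "norm x ^ k * norm (dderiv (vs @ [b]) ?m x)
       \<le> norm x ^ k * (norm (dderiv vs ?m' x) + norm (dderiv vs ?n x))"
      unfolding eq by (intro mult_left_mono norm_triangle_ineq) auto
    also have "\<dots> \<le> K + L" using K[of x] L[of x] by (simp only: distrib_left)
    finally show ?thesis .
  qed
  then show ?case by blast
qed

lemma schwartz_inner_scaleR:
  assumes "schwartz f" shows "schwartz (\<lambda>x. (x \<bullet> c) *\<^sub>R f x)"
  by (rule schwartzI)
     (intro smooth_on_scaleR open_UNIV smooth_on_inner_Basis schwartz_smooth_on assms
       schwartz_inner_bound | assumption)+

lemma schwartz_zero: "schwartz (\<lambda>x. 0)"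
  by (auto intro!: schwartzI smooth_on_const simp: dderiv_zero)

lemma schwartz_sum: "(\<And>i. i \<in> A \<Longrightarrow> schwartz (f i)) \<Longrightarrow> schwartz (\<lambda>x. \<Sum>i\<in>A. f i x)"
  by (induction A rule: infinite_finite_induct) (simp_all add: schwartz_add schwartz_zero)

lemma schwartz_norm_sq_scaleR:
  assumes "schwartz f" shows "schwartz (\<lambda>x. nsq x *\<^sub>R f x)"
proof -
  have "schwartz (\<lambda>x. \<Sum>b\<in>Basis. (x \<bullet> b) *\<^sub>R ((x \<bullet> b) *\<^sub>R f x))"
    by (intro schwartz_sum schwartz_inner_scaleR assms)
  moreover have "(\<Sum>b\<in>Basis. (x \<bullet> b) *\<^sub>R ((x \<bullet> b) *\<^sub>R f x)) = nsq x *\<^sub>R f x" for x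
    unfolding scaleR_scaleR scaleR_sum_left[symmetric] by (simp add: euclidean_inner[of x x] power2_norm_eq_inner)
  ultimately show ?thesis by simp
qed

lemma schwartz_continuous: "schwartz f \<Longrightarrow> continuous_on UNIV f"
  by (intro smooth_on_continuous_on schwartz_smooth_on)

lemma schwartz_measurable: "schwartz f \<Longrightarrow> f \<in> borel_measurable borel"
  by (intro borel_measurable_continuous_onI schwartz_continuous)

lemma le_decay_weightI:
  assumes "norm y \<le> K" "norm (x::'a::euclidean_space) ^ (DIM('a) + 1) * norm y \<le> L" "0 \<le> L"
  shows "norm y \<le> (K + L) * decay_weight x"
proof (cases "norm x < 1")
  case True
  then show ?thesis using assms by (simp add: decay_weight_def)
next
  case False
  then have x: "norm x ^ (DIM('a) + 1) > 0" by (intro zero_less_power) linarith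
  have K: "K \<ge> 0" using assms(1) norm_ge_zero order_trans by blast
  have "norm y \<le> L / norm x ^ (DIM('a) + 1)"
    using assms(2) x by (simp add: pos_le_divide_eq mult.commute del: power_Suc)
  also have "\<dots> \<le> (K + L) / norm x ^ (DIM('a) + 1)"
    using K x by (intro divide_right_mono) (auto simp del: power_Suc)
  finally show ?thesis using False by (simp add: decay_weight_def)
qed

lemma schwartz_integrable:
  fixes f :: "'a::euclidean_space \<Rightarrow> complex"
  assumes "schwartz f" shows "integrable lborel f" "integrable lborel (\<lambda>x. norm x ^ k *\<^sub>R f x)"
proof -
  have *: "integrable lborel (\<lambda>x. norm x ^ k *\<^sub>R f x)" for k
  proof -
    obtain K where K: "\<And>x. norm x ^ k * norm (f x) \<le> K"
      using schwartz_bound[OF assms, of "[]" k] by auto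
    obtain L where L: "L \<ge> 0" "\<And>x. norm x ^ (DIM('a) + 1 + k) * norm (f x) \<le> L"
      using schwartz_bound[OF assms, of "[]" "DIM('a) + 1 + k"] by auto
    show ?thesis
    proof (rule integrable_decay_bound)
      show "(\<lambda>x. norm x ^ k *\<^sub>R f x) \<in> borel_measurable borel"
        using schwartz_measurable[OF assms] by measurable
      show "norm (norm x ^ k *\<^sub>R f x) \<le> (K + L) * decay_weight x" for x
        by (rule le_decay_weightI) (use K L(2)[of x] L(1) in \<open>auto simp: power_add mult_ac\<close>)
    qed
  qed
  then show "integrable lborel (\<lambda>x. norm x ^ k *\<^sub>R f x)" .
  show "integrable lborel f" using *[of 0] by simp
qed

lemma dderiv_eq_0_off_support:
  assumes "x \<notin> closure {x. f x \<noteq> 0}" shows "dderiv vs f x = 0"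
proof -
  have "dderiv vs f x = dderiv vs (\<lambda>x. 0) x"
    by (rule dderiv_cong_open[of "- closure {x. f x \<noteq> 0}"])
       (use assms closure_subset[of "{x. f x \<noteq> 0}"] in auto)
  then show ?thesis by (simp add: dderiv_zero)
qed

lemma test_fun_smooth_on: "test_fun_on \<Omega> f \<Longrightarrow> smooth_on S f"
  unfolding test_fun_on_def smooth_iff_smooth_on by (auto intro: smooth_on_subset)

lemma test_fun_schwartz:
  assumes "test_fun_on \<Omega> f" shows "schwartz f"
proof (rule schwartzI)
  fix vs :: "'a list" and k assume vs: "set vs \<subseteq> Basis"
  let ?S = "closure {x. f x \<noteq> 0}"
  have "continuous_on ?S (\<lambda>x. norm x ^ k * norm (dderiv vs f x))"
    by (intro continuous_intros continuous_on_subset[OF smooth_on_continuous_on[OF smooth_on_dderiv[OF test_fun_smooth_on[OF assms] vs]]])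
       auto
  then have "bounded ((\<lambda>x. norm x ^ k * norm (dderiv vs f x)) ` ?S)"
    using assms by (intro compact_imp_bounded compact_continuous_image) (auto simp: test_fun_on_def)
  then obtain K where K: "\<And>x. x \<in> ?S \<Longrightarrow> norm x ^ k * norm (dderiv vs f x) \<le> K"
    by (force simp: bounded_iff)
  have "norm x ^ k * norm (dderiv vs f x) \<le> max K 0" for x
    using K[of x] dderiv_eq_0_off_support[of x f vs] by (cases "x \<in> ?S") auto
  then show "\<exists>K. \<forall>x. norm x ^ k * norm (dderiv vs f x) \<le> K" by blast
qed (rule test_fun_smooth_on[OF assms])

text \<open>The factor \<open>a\<close> is smooth on \<open>\<Omega>\<close> only. The product is
  smooth on \<open>\<Omega>\<close>, vanishes on the complement of the support of \<open>f\<close>,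
  and these two open sets cover the space. This is what makes division by a function with zeros
  outside \<open>\<Omega>\<close> legitimate.\<close>

lemma test_fun_scaleR:
  assumes f: "test_fun_on \<Omega> f" and "open \<Omega>" and a: "smooth_on \<Omega> a"
  shows "test_fun_on \<Omega> (\<lambda>x. a x *\<^sub>R f x)"
proof -
  let ?S = "closure {x. f x \<noteq> 0}"
  have sub: "closure {x. a x *\<^sub>R f x \<noteq> 0} \<subseteq> ?S"
    by (intro closure_mono) auto
  have cpt: "compact ?S" "?S \<subseteq> \<Omega>" using f by (auto simp: test_fun_on_def)
  have 1: "smooth_on \<Omega> (\<lambda>x. a x *\<^sub>R f x)"
    by (intro smooth_on_scaleR assms test_fun_smooth_on[OF f])
  have 2: "smooth_on (- ?S) (\<lambda>x. a x *\<^sub>R f x)"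
  proof (rule smooth_on_cong[OF _ _ smooth_on_const[of _ 0]])
    fix y assume "y \<in> - ?S"
    then show "0 = a y *\<^sub>R f y" using closure_subset[of "{x. f x \<noteq> 0}"] by auto
  qed auto
  have "smooth_on UNIV (\<lambda>x. a x *\<^sub>R f x)"
    using smooth_on_Un[OF 1 2] cpt(2) by (auto intro: smooth_on_subset)
  moreover have "compact (closure {x. a x *\<^sub>R f x \<noteq> 0})"
    using compact_Int_closed[OF cpt(1) closed_closure[of "{x. a x *\<^sub>R f x \<noteq> 0}"]] sub
    by (simp add: Int_absorb1)
  ultimately show ?thesis
    using sub cpt(2) unfolding test_fun_on_def smooth_iff_smooth_on by blast
qed

section \<open>Fourier integrals\<close>

text \<open>The common core of both transforms: \<open>iFT\<close> is a constant multiple of it, and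
  \<open>FT\<close> is its value at \<open>- \<xi>\<close>. For Borel integrands,
  \<open>lborel\<close> may replace the completed measure, which gives access to product measures
  and translations.\<close>

definition fourier :: "('a::euclidean_space \<Rightarrow> complex) \<Rightarrow> 'a \<Rightarrow> complex" where
  "fourier f x = (LINT \<xi>|lborel. f \<xi> * cis (\<xi> \<bullet> x))"

lemma borel_measurable_cis [measurable (raw)]:
  "f \<in> borel_measurable M \<Longrightarrow> (\<lambda>x. cis (f x)) \<in> borel_measurable M"
  by (rule borel_measurable_continuous_on) (intro continuous_intros)

lemma iFT_eq_fourier:
  fixes f :: "'a::euclidean_space \<Rightarrow> complex"
  assumes [measurable]: "f \<in> borel_measurable borel"
  shows "iFT f x = complex_of_real ((2 * pi) powr (- real DIM('a))) * fourier f x"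
  unfolding iFT_def fourier_def by (subst integral_completion) simp_all

lemma FT_eq_fourier:
  assumes [measurable]: "f \<in> borel_measurable borel"
  shows "FT f \<xi> = fourier f (- \<xi>)"
  unfolding FT_def fourier_def by (subst integral_completion) simp_all

lemma integrable_fourier:
  assumes "integrable lborel f" shows "integrable lborel (\<lambda>\<xi>. f \<xi> * cis (\<xi> \<bullet> x))"
  using assms by (rule Bochner_Integration.integrable_bound)
    (use assms in \<open>auto simp: norm_mult intro!: borel_measurable_times\<close>)

lemma norm_fourier_le: "norm (fourier f x) \<le> (LINT \<xi>|lborel. norm (f \<xi>))"
  unfolding fourier_def
  by (rule order_trans[OF integral_norm_bound]) (simp add: norm_mult)

lemma fourier_add:
  "integrable lborel f \<Longrightarrow> integrable lborel g \<Longrightarrow>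
    fourier (\<lambda>x. f x + g x) x = fourier f x + fourier g x"
  unfolding fourier_def distrib_right
  by (intro Bochner_Integration.integral_add integrable_fourier)

lemma fourier_cmult: "fourier (\<lambda>x. c * f x) x = c * fourier f x"
  unfolding fourier_def mult.assoc by (rule integral_mult_right_zero)

lemma lborel_integral_translate:
  fixes f :: "'a::euclidean_space \<Rightarrow> 'b::{banach, second_countable_topology}"
  assumes "f \<in> borel_measurable borel"
  shows "(LINT x|lborel. f (c + x)) = integral\<^sup>L lborel f"
    "integrable lborel (\<lambda>x. f (c + x)) \<longleftrightarrow> integrable lborel f"
proof -
  have "integral\<^sup>L (distr lborel borel ((+) c)) f = (LINT x|lborel. f (c + x))"
    by (rule integral_distr) (use assms in auto)
  then show "(LINT x|lborel. f (c + x)) = integral\<^sup>L lborel f"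
    by (simp add: lborel_distr_plus)
  have "integrable (distr lborel borel ((+) c)) f \<longleftrightarrow> integrable lborel (\<lambda>x. f (c + x))"
    by (rule integrable_distr_eq) (use assms in auto)
  then show "integrable lborel (\<lambda>x. f (c + x)) \<longleftrightarrow> integrable lborel f"
    by (simp add: lborel_distr_plus)
qed

text \<open>Averaging \<open>F (x + b) - F x = \<integral>\<^sub>0\<^sup>1 \<partial>\<^sub>b F (x + s b) ds\<close> over \<open>x\<close>, the left side vanishes by translation invariance.\<close>

lemma integral_partial_derivative_eq_0:
  fixes F :: "'a::euclidean_space \<Rightarrow> complex"
  assumes d: "\<And>x. F differentiable (at x)" and c: "continuous_on UNIV (dderiv [b] F)"
    and i: "integrable lborel F" "integrable lborel (dderiv [b] F)"
  shows "integral\<^sup>L lborel (dderiv [b] F) = 0"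
proof -
  define D where "D = dderiv [b] F"
  have [measurable]: "D \<in> borel_measurable borel" "F \<in> borel_measurable borel"
    using c i borel_measurable_continuous_onI by (auto simp: D_def)
  let ?f = "\<lambda>(s::real) x. indicator {0..1} s *\<^sub>R D (s *\<^sub>R b + x)"
  have ftc: "(LINT s|lborel. ?f s x) = F (b + x) - F x" for x
  proof -
    have "(LINT s|lborel. ?f s x) = F (1 *\<^sub>R b + x) - F (0 *\<^sub>R b + x)"
    proof (rule integral_FTC_Icc)
      fix s :: real
      have "((\<lambda>s. F (s *\<^sub>R b + x)) has_derivative (\<lambda>h. frechet_derivative F (at (s *\<^sub>R b + x)) (h *\<^sub>R b))) (at s)"
      proof (rule has_derivative_compose[of "\<lambda>s. s *\<^sub>R b + x" "\<lambda>h. h *\<^sub>R b" s UNIV F])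
        show "((\<lambda>s. s *\<^sub>R b + x) has_derivative (\<lambda>h. h *\<^sub>R b)) (at s)"
          by (auto intro!: derivative_eq_intros)
      qed (use d frechet_derivative_works in blast)
      then have "((\<lambda>s. F (s *\<^sub>R b + x)) has_derivative (\<lambda>h. h *\<^sub>R D (s *\<^sub>R b + x))) (at s)"
        using linear_scale[OF linear_frechet_derivative[OF d]] by (simp add: D_def)
      then show "((\<lambda>s. F (s *\<^sub>R b + x)) has_vector_derivative D (s *\<^sub>R b + x)) (at s within {0..1})"
        unfolding has_vector_derivative_def by (rule has_derivative_at_withinI)
    next
      show "continuous_on {0..1} (\<lambda>s. D (s *\<^sub>R b + x))"
        using c unfolding D_def by (rule continuous_on_compose2) (auto intro!: continuous_intros)
    qed auto
    then show ?thesis by simp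
  qed
  have int: "integrable (lborel \<Otimes>\<^sub>M lborel) (\<lambda>(s::real, x). ?f s x)"
  proof (rule lborel_pair.Fubini_integrable)
    show "(\<lambda>(s::real, x). ?f s x) \<in> borel_measurable (lborel \<Otimes>\<^sub>M lborel)"
      by measurable
    \<comment> \<open>By translation invariance the inner integral of the norm does not depend on
      \<open>s\<close> in [0, 1], so absolute integrability on the product is immediate.\<close>
    have "(LINT x|lborel. norm (?f s x))
        = indicator {0..1} s *\<^sub>R (LINT x|lborel. norm (D x))" for s :: real
      using lborel_integral_translate(1)[of "\<lambda>x. norm (D x)" "s *\<^sub>R b"] by simp
    then show "integrable lborel (\<lambda>s::real. LINT x|lborel. norm (case (s, x) of (s, x) \<Rightarrow> ?f s x))"
      by (simp only: prod.case) (intro integrable_scaleR_left integrable_real_indicator, auto)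
    show "AE s in lborel. integrable lborel (\<lambda>x. case (s, x) of (s::real, x) \<Rightarrow> ?f s x)"
      unfolding prod.case using i(2)
      by (intro AE_I2 integrable_scaleR_right) (simp add: lborel_integral_translate(2)[of D] D_def[symmetric] del: dderiv.simps)
  qed
  have "(LINT x|lborel. LINT s|lborel. ?f s x)
      = (LINT s::real|lborel. LINT x|lborel. ?f s x)"
    by (rule lborel_pair.Fubini_integral) (use int in simp)
  also have "\<dots> = (LINT s::real|lborel. indicator {0..1} s *\<^sub>R integral\<^sup>L lborel D)"
    by (simp add: lborel_integral_translate(1))
  also have "\<dots> = integral\<^sup>L lborel D"
    by simp
  also have "(LINT x|lborel. LINT s|lborel. ?f s x) = (LINT x|lborel. F (b + x) - F x)"
    by (simp add: ftc)
  also have "\<dots> = 0"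
    using i by (subst Bochner_Integration.integral_diff) (auto simp: lborel_integral_translate)
  finally show ?thesis by (simp add: D_def)
qed

lemma has_derivative_cis_inner:
  "((\<lambda>\<xi>. cis (\<xi> \<bullet> x)) has_derivative (\<lambda>h. (h \<bullet> x) *\<^sub>R (\<i> * cis (\<xi> \<bullet> x)))) (at \<xi>)"
  by (auto intro!: derivative_eq_intros)

text \<open>Integration by parts without boundary terms: the derivative of the whole integrand
  \<open>f \<xi> * cis (\<xi> \<bullet> x)\<close> integrates to 0, and the product rule splits it
  into the two sides.\<close>

lemma fourier_dderiv:
  fixes f :: "'a::euclidean_space \<Rightarrow> complex"
  assumes f: "smooth_on UNIV f" and b: "b \<in> Basis"
    and i: "integrable lborel f" "integrable lborel (dderiv [b] f)"
  shows "fourier (dderiv [b] f) x = - \<i> * (x \<bullet> b) * fourier f x"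
proof -
  let ?e = "\<lambda>\<xi>::'a. cis (\<xi> \<bullet> x)"
  have de: "?e differentiable (at \<xi>)" for \<xi>
    using has_derivative_cis_inner unfolding differentiable_def by blast
  have ce: "continuous_on UNIV ?e" by (intro continuous_intros)
  have df: "f differentiable (at \<xi>)" for \<xi>
    by (rule smooth_on_differentiable[OF f]) simp
  have eq: "dderiv [b] (\<lambda>\<xi>. f \<xi> * ?e \<xi>) = (\<lambda>\<xi>. (\<i> * (x \<bullet> b)) * (f \<xi> * ?e \<xi>) + dderiv [b] f \<xi> * ?e \<xi>)"
  proof
    fix \<xi>
    have "dderiv [b] (\<lambda>\<xi>. f \<xi> * ?e \<xi>) \<xi> = f \<xi> * dderiv [b] ?e \<xi> + dderiv [b] f \<xi> * ?e \<xi>"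
      by (rule dderiv1_bilinear[OF bounded_bilinear_mult df de])
    also have "dderiv [b] ?e \<xi> = (b \<bullet> x) *\<^sub>R (\<i> * cis (\<xi> \<bullet> x))"
      by (rule dderiv1_eqI[OF has_derivative_cis_inner])
    finally show "dderiv [b] (\<lambda>\<xi>. f \<xi> * ?e \<xi>) \<xi> = (\<i> * (x \<bullet> b)) * (f \<xi> * ?e \<xi>) + dderiv [b] f \<xi> * ?e \<xi>"
      by (simp add: scaleR_conv_of_real inner_commute mult_ac del: dderiv.simps)
  qed
  have int: "integrable lborel (\<lambda>\<xi>. (\<i> * (x \<bullet> b)) * (f \<xi> * ?e \<xi>))" "integrable lborel (\<lambda>\<xi>. dderiv [b] f \<xi> * ?e \<xi>)"
    by (intro integrable_mult_right integrable_fourier i)+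
  have "integral\<^sup>L lborel (dderiv [b] (\<lambda>\<xi>. f \<xi> * ?e \<xi>)) = 0"
  proof (rule integral_partial_derivative_eq_0)
    show "(\<lambda>\<xi>. f \<xi> * ?e \<xi>) differentiable (at \<xi>)" for \<xi>
      using df[of \<xi>] de[of \<xi>] by (rule differentiable_mult)
    have "continuous_on UNIV (dderiv [b] f)"
      by (rule smooth_on_continuous_on[OF smooth_on_dderiv[OF f]]) (use b in auto)
    then show "continuous_on UNIV (dderiv [b] (\<lambda>\<xi>. f \<xi> * ?e \<xi>))"
      unfolding eq by (intro continuous_intros smooth_on_continuous_on[OF f] ce)
    show "integrable lborel (\<lambda>\<xi>. f \<xi> * ?e \<xi>)" by (rule integrable_fourier[OF i(1)])
    show "integrable lborel (dderiv [b] (\<lambda>\<xi>. f \<xi> * ?e \<xi>))"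
      unfolding eq by (intro Bochner_Integration.integrable_add int)
  qed
  then have "\<i> * (x \<bullet> b) * fourier f x + fourier (dderiv [b] f) x = 0"
    unfolding eq fourier_def
    by (subst (asm) Bochner_Integration.integral_add[OF int]) (simp del: dderiv.simps)
  then show ?thesis by (simp add: eq_neg_iff_add_eq_0 add.commute del: dderiv.simps)
qed

lemma fourier_dderiv_replicate:
  fixes f :: "'a::euclidean_space \<Rightarrow> complex"
  assumes f: "smooth_on UNIV f" and b: "b \<in> Basis"
  shows "(\<And>j. j \<le> n \<Longrightarrow> integrable lborel (dn j b f)) \<Longrightarrow>
    fourier (dn n b f) x = (- \<i> * (x \<bullet> b)) ^ n * fourier f x"
proof (induction n)
  case (Suc n)
  have "fourier (dderiv [b] (dn n b f)) x
     = - \<i> * (x \<bullet> b) * fourier (dn n b f) x"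
    by (intro fourier_dderiv smooth_on_dderiv[OF f] b)
       (use Suc.prems[of n] Suc.prems[of "Suc n"] b in auto)
  then show ?case using Suc by simp
qed simp

section \<open>Decay and smoothness of Fourier integrals\<close>

lemma fourier_decay:
  fixes f :: "'a::euclidean_space \<Rightarrow> complex"
  assumes f: "smooth_on UNIV f" and b: "b \<in> Basis"
    and i: "\<And>j. j \<le> n \<Longrightarrow> integrable lborel (dn j b f)"
  shows "\<bar>x \<bullet> b\<bar> ^ n * norm (fourier f x) \<le> (LINT \<xi>|lborel. norm (dn n b f \<xi>))"
proof -
  have "\<bar>x \<bullet> b\<bar> ^ n * norm (fourier f x) = norm (fourier (dn n b f) x)"
    by (simp add: fourier_dderiv_replicate[OF assms] norm_mult norm_power)
  also have "\<dots> \<le> (LINT \<xi>|lborel. norm (dn n b f \<xi>))"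
    by (rule norm_fourier_le)
  finally show ?thesis .
qed

text \<open>The coordinate of largest modulus works, since the norm is at most the sum of the
  moduli. It reduces decay in \<open>norm x\<close> to decay in one coordinate.\<close>

lemma ex_large_coordinate:
  fixes x :: "'a::euclidean_space"
  obtains b where "b \<in> Basis" "norm x \<le> real DIM('a) * \<bar>x \<bullet> b\<bar>"
proof -
  obtain b where b: "b \<in> Basis" "\<And>c. c \<in> Basis \<Longrightarrow> \<bar>x \<bullet> c\<bar> \<le> \<bar>x \<bullet> b\<bar>"
  proof -
    have "\<exists>b\<in>Basis. \<forall>c\<in>Basis. \<bar>x \<bullet> c\<bar> \<le> \<bar>x \<bullet> b\<bar>"
    proof -
      have "Max ((\<lambda>c. \<bar>x \<bullet> c\<bar>) ` Basis) \<in> (\<lambda>c. \<bar>x \<bullet> c\<bar>) ` Basis"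
        by (intro Max_in) auto
      then obtain b where b: "b \<in> Basis" "Max ((\<lambda>c. \<bar>x \<bullet> c\<bar>) ` Basis) = \<bar>x \<bullet> b\<bar>"
        by (metis (no_types, lifting) imageE)
      have "\<bar>x \<bullet> c\<bar> \<le> \<bar>x \<bullet> b\<bar>" if "c \<in> Basis" for c
        unfolding b(2)[symmetric] using that by (intro Max_ge) auto
      then show ?thesis using b(1) by blast
    qed
    then show ?thesis using that by blast
  qed
  have "norm x \<le> (\<Sum>c\<in>Basis. \<bar>x \<bullet> c\<bar>)" by (rule norm_le_l1)
  also have "\<dots> \<le> (\<Sum>c\<in>(Basis::'a set). \<bar>x \<bullet> b\<bar>)" by (intro sum_mono b)
  also have "\<dots> = real DIM('a) * \<bar>x \<bullet> b\<bar>" by simp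
  finally show ?thesis using that b by blast
qed

text \<open>The large coordinate depends on \<open>x\<close>; summing over the whole basis makes the
  right-hand side independent of \<open>x\<close>.\<close>

lemma fourier_decay_norm:
  fixes f :: "'a::euclidean_space \<Rightarrow> complex"
  assumes f: "smooth_on UNIV f"
    and i: "\<And>j b. j \<le> n \<Longrightarrow> b \<in> Basis \<Longrightarrow> integrable lborel (dn j b f)"
  shows "norm x ^ n * norm (fourier f x)
    \<le> real DIM('a) ^ n * (\<Sum>b\<in>Basis. LINT \<xi>|lborel. norm (dn n b f \<xi>))"
proof -
  obtain b where b: "b \<in> Basis" "norm x \<le> real DIM('a) * \<bar>x \<bullet> b\<bar>"
    by (rule ex_large_coordinate)
  have "norm x ^ n * norm (fourier f x) \<le> (real DIM('a) * \<bar>x \<bullet> b\<bar>) ^ n * norm (fourier f x)"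
    by (intro mult_right_mono power_mono b) auto
  also have "\<dots> = real DIM('a) ^ n * (\<bar>x \<bullet> b\<bar> ^ n * norm (fourier f x))"
    by (simp add: power_mult_distrib)
  also have "\<dots> \<le> real DIM('a) ^ n * (LINT \<xi>|lborel. norm (dn n b f \<xi>))"
    by (intro mult_left_mono fourier_decay f b i) auto
  also have "\<dots> \<le> real DIM('a) ^ n * (\<Sum>b\<in>Basis. LINT \<xi>|lborel. norm (dn n b f \<xi>))"
    by (intro mult_left_mono member_le_sum b) auto
  finally show ?thesis .
qed

lemma norm_fourier_le_decay_weight:
  fixes f :: "'a::euclidean_space \<Rightarrow> complex"
  assumes f: "smooth_on UNIV f"
    and i: "\<And>j b. j \<le> DIM('a) + 1 \<Longrightarrow> b \<in> Basis \<Longrightarrow> integrable lborel (dn j b f)"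
  shows "norm (fourier f x) \<le> ((LINT \<xi>|lborel. norm (f \<xi>)) + real DIM('a) ^ (DIM('a) + 1) *
     (\<Sum>b\<in>Basis. LINT \<xi>|lborel. norm (dderiv (replicate (DIM('a) + 1) b) f \<xi>))) * decay_weight x"
  by (rule le_decay_weightI[OF norm_fourier_le fourier_decay_norm[OF f i]])
     (auto intro!: mult_nonneg_nonneg sum_nonneg simp del: power_Suc dderiv.simps replicate_Suc)

lemma norm_cis_Taylor: "norm (cis t - 1 - \<i> * t) \<le> t\<^sup>2 / 2"
  using iexp_approx1[of t 1] by (simp add: cis_conv_exp numeral_2_eq_2 algebra_simps)

text \<open>The second-order Taylor remainder of \<open>cis (\<xi> \<bullet> h)\<close> is at most
  |\<xi>|^2 |h|^2, and |\<xi>|^2 f is integrable for Schwartz \<open>f\<close>. The error is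
  therefore quadratic in \<open>h\<close>.\<close>

lemma has_derivative_fourier:
  fixes f :: "'a::euclidean_space \<Rightarrow> complex"
  assumes f: "schwartz f"
  shows "(fourier f has_derivative
    (\<lambda>h. \<Sum>b\<in>Basis. (h \<bullet> b) *\<^sub>R fourier (\<lambda>\<xi>. \<i> * ((\<xi> \<bullet> b) *\<^sub>R f \<xi>)) x)) (at x)"
proof -
  let ?t = "\<lambda>h b \<xi>. (h \<bullet> b) *\<^sub>R (\<i> * ((\<xi> \<bullet> b) *\<^sub>R f \<xi>) * cis (\<xi> \<bullet> x))"
  let ?s = "\<lambda>h \<xi>. \<i> * (\<xi> \<bullet> h) * f \<xi> * cis (\<xi> \<bullet> x)"
  define D where "D h = (\<Sum>b\<in>Basis. (h \<bullet> b) *\<^sub>R fourier (\<lambda>\<xi>. \<i> * ((\<xi> \<bullet> b) *\<^sub>R f \<xi>)) x)" for h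
  have ib: "integrable lborel (\<lambda>\<xi>. \<i> * ((\<xi> \<bullet> b) *\<^sub>R f \<xi>) * cis (\<xi> \<bullet> x))" for b
    by (intro integrable_fourier schwartz_integrable(1) schwartz_cmult schwartz_inner_scaleR f)
  have fi: "integrable lborel f" by (rule schwartz_integrable[OF f])
  have [measurable]: "f \<in> borel_measurable borel" by (rule schwartz_measurable[OF f])
  define K where "K = (LINT \<xi>|lborel. norm (nsq \<xi> *\<^sub>R f \<xi>))"
  have D_eq: "D h = (LINT \<xi>|lborel. ?s h \<xi>)"
    and D_int: "integrable lborel (\<lambda>\<xi>. ?s h \<xi>)" for h
  proof -
    have eq: "(\<Sum>b\<in>Basis. ?t h b \<xi>) = ?s h \<xi>" for \<xi>
      by (simp add: euclidean_inner[of \<xi> h] sum_distrib_right sum_distrib_left scaleR_conv_of_real mult_ac)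
    have int: "integrable lborel (\<lambda>\<xi>. ?t h b \<xi>)" for b
      by (intro integrable_scaleR_right ib)
    have "integrable lborel (\<lambda>\<xi>. \<Sum>b\<in>Basis. ?t h b \<xi>)"
      by (intro Bochner_Integration.integrable_sum int)
    then show "integrable lborel (\<lambda>\<xi>. ?s h \<xi>)"
      by (simp only: eq)
    have "D h = (\<Sum>b\<in>Basis. (LINT \<xi>|lborel. ?t h b \<xi>))"
      unfolding D_def fourier_def using ib by (simp only: integral_scaleR_right)
    also have "\<dots> = (LINT \<xi>|lborel. (\<Sum>b\<in>Basis. ?t h b \<xi>))"
      by (rule Bochner_Integration.integral_sum[symmetric]) (rule int)
    finally show "D h = (LINT \<xi>|lborel. ?s h \<xi>)"
      by (simp only: eq)
  qed
  have bound: "norm (fourier f (x + h) - fourier f x - D h) \<le> K * (norm h)\<^sup>2" for h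
  proof -
    have "fourier f (x + h) - fourier f x - D h
        = (LINT \<xi>|lborel. f \<xi> * cis (\<xi> \<bullet> (x + h)) - f \<xi> * cis (\<xi> \<bullet> x) - ?s h \<xi>)"
      unfolding fourier_def D_eq using integrable_fourier[OF fi] D_int by simp
    also have "norm \<dots> \<le> (LINT \<xi>|lborel. (norm h)\<^sup>2 * norm (nsq \<xi> *\<^sub>R f \<xi>))"
    proof (rule Bochner_Integration.integral_norm_bound_integral)
      fix \<xi>
      have "f \<xi> * cis (\<xi> \<bullet> (x + h)) - f \<xi> * cis (\<xi> \<bullet> x) - ?s h \<xi>
          = f \<xi> * cis (\<xi> \<bullet> x) * (cis (\<xi> \<bullet> h) - 1 - \<i> * (\<xi> \<bullet> h))"
        by (simp add: inner_add_right cis_mult[symmetric] algebra_simps)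
      also have "norm \<dots> \<le> norm (f \<xi>) * ((\<xi> \<bullet> h)\<^sup>2 / 2)"
        unfolding norm_mult norm_cis mult_1_right by (intro mult_left_mono norm_cis_Taylor) auto
      also have "\<dots> \<le> norm (f \<xi>) * (norm \<xi> * norm h)\<^sup>2"
      proof (intro mult_left_mono)
        have "(\<xi> \<bullet> h)\<^sup>2 \<le> (norm \<xi> * norm h)\<^sup>2"
          using Cauchy_Schwarz_ineq2[of \<xi> h] by (simp add: abs_le_square_iff[symmetric] abs_mult)
        then show "(\<xi> \<bullet> h)\<^sup>2 / 2 \<le> (norm \<xi> * norm h)\<^sup>2"
          using zero_le_power2[of "\<xi> \<bullet> h"] by linarith
      qed auto
      finally show "norm (f \<xi> * cis (\<xi> \<bullet> (x + h)) - f \<xi> * cis (\<xi> \<bullet> x) - ?s h \<xi>)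
          \<le> (norm h)\<^sup>2 * norm (nsq \<xi> *\<^sub>R f \<xi>)"
        by (simp add: power_mult_distrib mult_ac)
    next
      show "integrable lborel (\<lambda>\<xi>. (norm h)\<^sup>2 * norm (nsq \<xi> *\<^sub>R f \<xi>))"
        by (intro integrable_mult_right integrable_norm schwartz_integrable(2) f)
    qed (intro Bochner_Integration.integrable_diff integrable_fourier fi D_int)
    also have "\<dots> = K * (norm h)\<^sup>2" unfolding K_def integral_mult_right_zero by (rule mult.commute)
    finally show ?thesis .
  qed
  have "bounded_linear D"
    unfolding D_def by (intro bounded_linear_sum bounded_linear_scaleR_const bounded_linear_inner_left)
  moreover have "((\<lambda>h. norm (fourier f (x + h) - fourier f x - D h) / norm h) \<longlongrightarrow> 0) (at 0)"
  proof (rule tendsto_0_le[where K=1])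
    have "((\<lambda>h::'a. K * norm h) \<longlongrightarrow> K * norm (0::'a)) (at 0)"
      by (intro tendsto_intros)
    then show "((\<lambda>h::'a. K * norm h) \<longlongrightarrow> 0) (at 0)" by simp
    have "norm (fourier f (x + h) - fourier f x - D h) / norm h \<le> \<bar>K * norm h\<bar>" if "h \<noteq> 0" for h
      using bound[of h] that abs_ge_self[of "K * norm h"] by (auto simp: divide_le_eq power2_eq_square mult.assoc[symmetric]
          intro: order_trans[OF _ mult_right_mono])
    then show "\<forall>\<^sub>F h in at 0. norm (norm (fourier f (x + h) - fourier f x - D h) / norm h) \<le> norm (K * norm h) * 1"
      by (auto simp: eventually_at_filter)
  qed
  ultimately show ?thesis
    unfolding has_derivative_at D_def by simp
qed

lemma dderiv_fourier:
  assumes "schwartz f" "b \<in> Basis"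
  shows "dderiv [b] (fourier f) = fourier (\<lambda>\<xi>. \<i> * ((\<xi> \<bullet> b) *\<^sub>R f \<xi>))"
proof
  fix x
  have "dderiv [b] (fourier f) x
      = (\<Sum>c\<in>Basis. (b \<bullet> c) *\<^sub>R fourier (\<lambda>\<xi>. \<i> * ((\<xi> \<bullet> c) *\<^sub>R f \<xi>)) x)"
    by (rule dderiv1_eqI[OF has_derivative_fourier[OF assms(1)]])
  also have "\<dots> = (\<Sum>c\<in>Basis. if c = b then fourier (\<lambda>\<xi>. \<i> * ((\<xi> \<bullet> c) *\<^sub>R f \<xi>)) x else 0)"
    using assms(2) by (intro sum.cong) (auto simp: inner_Basis)
  finally show "dderiv [b] (fourier f) x = fourier (\<lambda>\<xi>. \<i> * ((\<xi> \<bullet> b) *\<^sub>R f \<xi>)) x"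
    using assms(2) by simp
qed

text \<open>Transforms of Schwartz functions are closed under differentiation, so decay of all
  derivatives reduces to decay of a single transform.\<close>

lemma dderiv_fourier_ex:
  "set vs \<subseteq> Basis \<Longrightarrow> schwartz f \<Longrightarrow> \<exists>g. schwartz g \<and> dderiv vs (fourier f) = fourier g"
proof (induction vs)
  case (Cons b vs)
  then obtain g where g: "schwartz g" "dderiv vs (fourier f) = fourier g" by auto
  have "dderiv (b # vs) (fourier f) = dderiv [b] (fourier g)"
    using g by simp
  also have "\<dots> = fourier (\<lambda>\<xi>. \<i> * ((\<xi> \<bullet> b) *\<^sub>R g \<xi>))"
    by (rule dderiv_fourier) (use g Cons in auto)
  finally show ?case
    using schwartz_cmult[OF schwartz_inner_scaleR[OF g(1)]] by blast
qed auto

lemma schwartz_fourier: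
  assumes f: "schwartz f" shows "schwartz (fourier f)"
proof (rule schwartzI)
  show "smooth_on UNIV (fourier f)"
    unfolding smooth_on_def
  proof (intro allI impI ballI)
    fix vs :: "'a list" and x assume "set vs \<subseteq> Basis"
    then obtain g where g: "schwartz g" "dderiv vs (fourier f) = fourier g"
      using dderiv_fourier_ex[OF _ f] by blast
    show "dderiv vs (fourier f) differentiable at x"
      unfolding g(2) by (rule differentiableI[OF has_derivative_fourier[OF g(1)]])
  qed
  fix vs :: "'a list" and k assume "set vs \<subseteq> Basis"
  then obtain g where g: "schwartz g" "dderiv vs (fourier f) = fourier g"
    using dderiv_fourier_ex[OF _ f] by blast
  have "integrable lborel (dn j b g)" if "b \<in> Basis" for j b
    by (rule schwartz_integrable(1)[OF schwartz_dderiv[OF g(1)]]) (use that in auto)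
  then have "norm x ^ k * norm (fourier g x)
    \<le> real DIM('a) ^ k * (\<Sum>b\<in>Basis. LINT \<xi>|lborel. norm (dn k b g \<xi>))" for x
    by (intro fourier_decay_norm schwartz_smooth_on g)
  then show "\<exists>K. \<forall>x. norm x ^ k * norm (dderiv vs (fourier f) x) \<le> K"
    unfolding g(2) by blast
qed

lemma schwartz_iFT:
  assumes f: "schwartz f" shows "schwartz (iFT f)"
proof -
  have "iFT f = (\<lambda>x. complex_of_real ((2 * pi) powr (- real DIM('a))) * fourier f x)"
    by (rule ext) (rule iFT_eq_fourier[OF schwartz_measurable[OF f]])
  then show ?thesis using schwartz_cmult[OF schwartz_fourier[OF f]] by simp
qed

section \<open>Fourier inversion\<close>

definition gaussian :: "'a::euclidean_space \<Rightarrow> real" where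
  "gaussian x = exp (- nsq x / 2)"

lemma borel_measurable_gaussian [measurable]: "gaussian \<in> borel_measurable borel"
  unfolding gaussian_def by measurable

text \<open>This is the characteristic function of the standard normal distribution, with its
  normalising factor moved to the other side.\<close>

lemma gaussian_cis_real:
  "integrable lborel (\<lambda>x::real. complex_of_real (exp (- x\<^sup>2 / 2)) * cis (x * t))"
  "(LINT x::real|lborel. complex_of_real (exp (- x\<^sup>2 / 2)) * cis (x * t)) = complex_of_real (sqrt (2 * pi) * exp (- t\<^sup>2 / 2))"
proof -
  let ?g = "\<lambda>x. complex_of_real (exp (- x\<^sup>2 / 2)) * cis (x * t)"
  have int: "integrable lborel (\<lambda>x::real. exp (- x\<^sup>2 / 2))"
  proof -
    have "integrable lborel (\<lambda>x. sqrt (2 * pi) * std_normal_density x)"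
      by (intro integrable_mult_right) simp
    then show ?thesis by (simp add: std_normal_density_def)
  qed
  show "integrable lborel (\<lambda>x::real. ?g x)"
    by (rule Bochner_Integration.integrable_bound[OF int]) (auto simp: norm_mult)
  have "complex_of_real (exp (- t\<^sup>2 / 2)) = char std_normal_distribution t"
    by (simp add: char_std_normal_distribution)
  also have "\<dots> = (LINT x|lborel. std_normal_density x *\<^sub>R cis (t * x))"
    unfolding char_def cis_conv_exp by (subst integral_density) (auto simp: mult_ac)
  also have "\<dots> = (LINT x|lborel. complex_of_real (1 / sqrt (2 * pi)) * (?g x))"
    by (intro Bochner_Integration.integral_cong refl) (simp add: std_normal_density_def scaleR_conv_of_real mult_ac)
  also have "\<dots> = complex_of_real (1 / sqrt (2 * pi)) * (LINT x|lborel. ?g x)"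
    by (rule integral_mult_right_zero)
  finally show "(LINT x::real|lborel. ?g x) = complex_of_real (sqrt (2 * pi) * exp (- t\<^sup>2 / 2))"
    by (simp add: field_simps)
qed

text \<open>Lebesgue measure is the image of a product of one-dimensional measures and the integrand
  factorises over the coordinates, so the one-dimensional formula suffices.\<close>

lemma fourier_gaussian:
  fixes \<xi> :: "'a::euclidean_space"
  shows "integrable lborel (\<lambda>y::'a. complex_of_real (gaussian y) * cis (y \<bullet> \<xi>))"
    "fourier (\<lambda>y. complex_of_real (gaussian y)) \<xi> = complex_of_real (sqrt (2 * pi) ^ DIM('a) * gaussian \<xi>)"
proof -
  interpret product_sigma_finite "\<lambda>b::'a. lborel :: real measure"
    by standard
  let ?P = "\<Pi>\<^sub>M b\<in>(Basis::'a set). (lborel :: real measure)"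
  let ?m = "\<lambda>f. \<Sum>b\<in>(Basis::'a set). f b *\<^sub>R b"
  let ?g = "\<lambda>f b. complex_of_real (exp (- (f b)\<^sup>2 / 2)) * cis (f b * (\<xi> \<bullet> b))"
  have m: "?m \<in> ?P \<rightarrow>\<^sub>M borel" by measurable
  have eq: "complex_of_real (gaussian (?m f)) * cis (?m f \<bullet> \<xi>)
      = (\<Prod>b\<in>Basis. ?g f b)" for f
  proof -
    have n: "(norm (?m f))\<^sup>2 = (\<Sum>b\<in>Basis. (f b)\<^sup>2)"
      unfolding power2_norm_eq_inner euclidean_inner[of "?m f" "?m f"]
      by (intro sum.cong refl) (simp add: inner_sum_left_Basis power2_eq_square)
    have i: "?m f \<bullet> \<xi> = (\<Sum>b\<in>Basis. f b * (\<xi> \<bullet> b))"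
      by (simp add: inner_sum_left inner_commute[of \<xi>])
    have "gaussian (?m f) = (\<Prod>b\<in>Basis. exp (- (f b)\<^sup>2 / 2))"
      unfolding gaussian_def n by (subst exp_sum[symmetric]) (auto simp: sum_negf sum_divide_distrib)
    moreover have "cis (?m f \<bullet> \<xi>) = (\<Prod>b\<in>Basis. cis (f b * (\<xi> \<bullet> b)))"
      unfolding i cis_conv_exp by (subst exp_sum[symmetric]) (auto simp: sum_distrib_left)
    ultimately show ?thesis by (simp add: prod.distrib)
  qed
  have int: "integrable ?P (\<lambda>f. \<Prod>b\<in>Basis. ?g f b)"
    by (rule product_integrable_prod[OF finite_Basis gaussian_cis_real(1)])
  show "integrable lborel (\<lambda>y::'a. complex_of_real (gaussian y) * cis (y \<bullet> \<xi>))"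
    unfolding lborel_eq[where 'a='a]
    by (subst integrable_distr_eq[OF m]) (use int eq in \<open>simp_all\<close>)
  have "fourier (\<lambda>y. complex_of_real (gaussian y)) \<xi>
      = (LINT f|?P. (\<Prod>b\<in>Basis. ?g f b))"
    unfolding fourier_def
    by (subst lborel_eq[where 'a='a], subst integral_distr[OF m]) (simp_all add: eq)
  also have "\<dots> = (\<Prod>b\<in>(Basis::'a set). complex_of_real (sqrt (2 * pi) * exp (- (\<xi> \<bullet> b)\<^sup>2 / 2)))"
    by (subst product_integral_prod[OF finite_Basis gaussian_cis_real(1)]) (simp only: gaussian_cis_real(2))
  also have "\<dots> = complex_of_real (sqrt (2 * pi) ^ DIM('a) * gaussian \<xi>)"
  proof -
    have "gaussian \<xi> = (\<Prod>b\<in>Basis. exp (- (\<xi> \<bullet> b)\<^sup>2 / 2))"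
      unfolding gaussian_def power2_norm_eq_inner euclidean_inner[of \<xi> \<xi>]
      by (subst exp_sum[symmetric]) (auto simp: sum_negf sum_divide_distrib power2_eq_square)
    then show ?thesis by (simp add: prod.distrib)
  qed
  finally show "fourier (\<lambda>y. complex_of_real (gaussian y)) \<xi> = complex_of_real (sqrt (2 * pi) ^ DIM('a) * gaussian \<xi>)" .
qed

lemma integrable_gaussian: "integrable lborel (gaussian :: 'a::euclidean_space \<Rightarrow> real)"
  using integrable_norm[OF fourier_gaussian(1)[of "0::'a"]] by (simp add: gaussian_def[abs_def])

lemma lborel_integral_affine:
  fixes f :: "'a::euclidean_space \<Rightarrow> 'b::{banach, second_countable_topology}"
  assumes [measurable]: "f \<in> borel_measurable borel" and c: "c > 0"
  shows "integral\<^sup>L lborel f = c ^ DIM('a) *\<^sub>R (LINT x|lborel. f (t + c *\<^sub>R x))"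
    "integrable lborel f \<longleftrightarrow> integrable lborel (\<lambda>x. f (t + c *\<^sub>R x))"
proof -
  have eq: "lborel = density (distr lborel borel (\<lambda>x::'a. t + c *\<^sub>R x)) (\<lambda>_. ennreal (c ^ DIM('a)))"
    using lborel_affine[of c t] c by (simp add: ennreal_power)
  have m: "(\<lambda>x::'a. t + c *\<^sub>R x) \<in> lborel \<rightarrow>\<^sub>M borel" by measurable
  have "integral\<^sup>L lborel f = integral\<^sup>L (density (distr lborel borel (\<lambda>x::'a. t + c *\<^sub>R x)) (\<lambda>_. ennreal (c ^ DIM('a)))) f"
    by (subst eq) simp
  also have "\<dots> = c ^ DIM('a) *\<^sub>R (LINT x|lborel. f (t + c *\<^sub>R x))"
    using c by (subst integral_density) (auto simp: integral_distr[OF m])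
  finally show "integral\<^sup>L lborel f = c ^ DIM('a) *\<^sub>R (LINT x|lborel. f (t + c *\<^sub>R x))" .
  have "integrable lborel f \<longleftrightarrow> integrable (density (distr lborel borel (\<lambda>x::'a. t + c *\<^sub>R x)) (\<lambda>_. ennreal (c ^ DIM('a)))) f"
    by (subst eq) simp
  also have "\<dots> \<longleftrightarrow> integrable lborel (\<lambda>x. f (t + c *\<^sub>R x))"
  proof -
    have "integrable lborel (\<lambda>x. f (t + c *\<^sub>R x))" if "integrable lborel (\<lambda>x. c ^ DIM('a) *\<^sub>R f (t + c *\<^sub>R x))"
      using integrable_scaleR_right[of "inverse (c ^ DIM('a))", OF that] c by simp
    then show ?thesis
      using c by (subst integrable_density) (auto simp: integrable_distr_eq[OF m])
  qed
  finally show "integrable lborel f \<longleftrightarrow> integrable lborel (\<lambda>x. f (t + c *\<^sub>R x))" .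
qed

text \<open>The Gaussian window makes the double integral absolutely convergent, so that the order
  of integration can be exchanged. The substitution \<xi> = \<eta> + e y then replaces the window by
  the transform of the Gaussian.\<close>

lemma gaussian_regularized_inversion:
  fixes g :: "'a::euclidean_space \<Rightarrow> complex"
  assumes g: "integrable lborel g" and [measurable]: "g \<in> borel_measurable borel" and e: "e > 0"
  shows "(LINT x|lborel. fourier g x * (gaussian (e *\<^sub>R x) * cis (- (x \<bullet> \<eta>))))
    = (LINT y|lborel. g (\<eta> + e *\<^sub>R y) * complex_of_real (sqrt (2 * pi) ^ DIM('a) * gaussian y))"
proof -
  define k where "k x \<xi> = g \<xi> * cis (\<xi> \<bullet> x) * (gaussian (e *\<^sub>R x) * cis (- (x \<bullet> \<eta>)))" for x \<xi>
  have ge: "integrable lborel (\<lambda>x::'a. gaussian (e *\<^sub>R x))"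
    using lborel_integral_affine(2)[of "gaussian :: 'a \<Rightarrow> real" e 0] e integrable_gaussian[where 'a='a] by simp
  have int: "integrable (lborel \<Otimes>\<^sub>M lborel) (\<lambda>(x, \<xi>). k x \<xi>)"
  proof (rule lborel_pair.Fubini_integrable)
    show "(\<lambda>(x, \<xi>). k x \<xi>) \<in> borel_measurable (lborel \<Otimes>\<^sub>M lborel)"
      unfolding k_def by measurable
    have "(LINT \<xi>|lborel. norm (k x \<xi>)) = (LINT \<xi>|lborel. norm (g \<xi>)) * gaussian (e *\<^sub>R x)" for x
      by (simp add: k_def norm_mult gaussian_def)
    then show "integrable lborel (\<lambda>x. LINT \<xi>|lborel. norm (case (x, \<xi>) of (x, \<xi>) \<Rightarrow> k x \<xi>))"
      using ge by simp
    show "AE x in lborel. integrable lborel (\<lambda>\<xi>. case (x, \<xi>) of (x, \<xi>) \<Rightarrow> k x \<xi>)"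
      unfolding k_def prod.case by (intro AE_I2 integrable_mult_left integrable_fourier g)
  qed
  have "(LINT x|lborel. fourier g x * (gaussian (e *\<^sub>R x) * cis (- (x \<bullet> \<eta>)))) = (LINT x|lborel. LINT \<xi>|lborel. k x \<xi>)"
    unfolding k_def fourier_def by simp
  also have "\<dots> = (LINT \<xi>|lborel. LINT x|lborel. k x \<xi>)"
    by (rule lborel_pair.Fubini_integral[symmetric]) (use int in simp)
  also have "\<dots> = e ^ DIM('a) *\<^sub>R (LINT y|lborel. LINT x|lborel. k x (\<eta> + e *\<^sub>R y))"
    by (rule lborel_integral_affine(1)[OF _ e]) (unfold k_def, measurable)
  also have "\<dots> = (LINT y|lborel. e ^ DIM('a) *\<^sub>R (LINT x|lborel. k x (\<eta> + e *\<^sub>R y)))"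
    by simp
  also have "\<dots> = (LINT y|lborel. g (\<eta> + e *\<^sub>R y) * fourier (\<lambda>x. complex_of_real (gaussian x)) y)"
  proof (intro Bochner_Integration.integral_cong refl)
    fix y :: 'a
    have "(LINT x|lborel. k x (\<eta> + e *\<^sub>R y))
        = (LINT x|lborel. g (\<eta> + e *\<^sub>R y) * (complex_of_real (gaussian (0 + e *\<^sub>R x)) * cis ((0 + e *\<^sub>R x) \<bullet> y)))"
    proof (intro Bochner_Integration.integral_cong refl)
      fix x :: 'a
      have "cis ((\<eta> + e *\<^sub>R y) \<bullet> x) * cis (- (x \<bullet> \<eta>)) = cis ((0 + e *\<^sub>R x) \<bullet> y)"
        by (simp add: cis_mult inner_add_left inner_commute[of x])
      then show "k x (\<eta> + e *\<^sub>R y) = g (\<eta> + e *\<^sub>R y) * (complex_of_real (gaussian (0 + e *\<^sub>R x)) * cis ((0 + e *\<^sub>R x) \<bullet> y))"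
        unfolding k_def by (simp only: add_0_left) (metis mult.assoc mult.left_commute)
    qed
    also have "\<dots> = g (\<eta> + e *\<^sub>R y) * (LINT x|lborel. complex_of_real (gaussian (0 + e *\<^sub>R x)) * cis ((0 + e *\<^sub>R x) \<bullet> y))"
      by (rule integral_mult_right_zero)
    \<comment> \<open>The Jacobian of the substitution in \<xi> is absorbed by rescaling
      \<open>x\<close> with the same factor \<open>e\<close>.\<close>
    also have "e ^ DIM('a) *\<^sub>R \<dots> = g (\<eta> + e *\<^sub>R y) * fourier (\<lambda>x. complex_of_real (gaussian x)) y"
      unfolding fourier_def
      by (subst lborel_integral_affine(1)[OF _ e, of _ 0]) (auto simp: scaleR_conv_of_real mult_ac)
    finally show "e ^ DIM('a) *\<^sub>R (LINT x|lborel. k x (\<eta> + e *\<^sub>R y)) = g (\<eta> + e *\<^sub>R y) * fourier (\<lambda>x. complex_of_real (gaussian x)) y" .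
  qed
  finally show ?thesis by (simp only: fourier_gaussian)
qed

text \<open>Let the window parameter tend to 0 in the regularised identity. The left side is
  dominated by \<open>norm (fourier g x)\<close>, the right side by a multiple of the Gaussian;
  total Gaussian mass and transform constant each contribute
  \<open>sqrt (2 * pi) ^ DIM('a)\<close>.\<close>

lemma fourier_inversion:
  fixes g :: "'a::euclidean_space \<Rightarrow> complex"
  assumes g: "schwartz g"
  shows "fourier (fourier g) (- \<eta>) = complex_of_real ((2 * pi) ^ DIM('a)) * g \<eta>"
proof -
  have gi: "integrable lborel g" and [measurable]: "g \<in> borel_measurable borel"
    by (rule schwartz_integrable schwartz_measurable g)+
  have Hi: "integrable lborel (fourier g)" and [measurable]: "fourier g \<in> borel_measurable borel"
    by (rule schwartz_integrable schwartz_measurable schwartz_fourier g)+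
  obtain K where K: "\<And>x. norm (g x) \<le> K"
    using schwartz_bound[OF g, of "[]" 0] by auto
  define e where "e n = inverse (real (Suc n))" for n
  have e: "e n > 0" for n by (simp add: e_def)
  have e0: "e \<longlonglongrightarrow> 0" unfolding e_def by (rule LIMSEQ_inverse_real_of_nat)
  let ?L = "\<lambda>n. LINT x|lborel. fourier g x * (gaussian (e n *\<^sub>R x) * cis (- (x \<bullet> \<eta>)))"
  let ?c = "complex_of_real (sqrt (2 * pi) ^ DIM('a))"
  let ?h = "\<lambda>y::'a. complex_of_real (sqrt (2 * pi) ^ DIM('a) * gaussian y)"
  have "?L \<longlonglongrightarrow> (LINT x|lborel. fourier g x * (complex_of_real 1 * cis (- (x \<bullet> \<eta>))))"
  proof (rule integral_dominated_convergence[where w="\<lambda>x. norm (fourier g x)"])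
    show "AE x in lborel. (\<lambda>n. fourier g x * (gaussian (e n *\<^sub>R x) * cis (- (x \<bullet> \<eta>))))
        \<longlonglongrightarrow> fourier g x * (complex_of_real 1 * cis (- (x \<bullet> \<eta>)))"
    proof (intro AE_I2 tendsto_intros)
      fix x :: 'a
      have "(\<lambda>n. exp (- (e n * norm x)\<^sup>2 / 2)) \<longlonglongrightarrow> exp (- (0 * norm x)\<^sup>2 / 2)"
        by (intro tendsto_intros e0) auto
      then show "(\<lambda>n. gaussian (e n *\<^sub>R x)) \<longlonglongrightarrow> 1"
        using e by (simp add: gaussian_def abs_of_pos)
    qed
    show "AE x in lborel. norm (fourier g x * (gaussian (e n *\<^sub>R x) * cis (- (x \<bullet> \<eta>)))) \<le> norm (fourier g x)" for n
      by (intro AE_I2) (auto simp: norm_mult gaussian_def mult_left_le)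
  qed (use Hi in auto)
  also have "(LINT x|lborel. fourier g x * (complex_of_real 1 * cis (- (x \<bullet> \<eta>)))) = fourier (fourier g) (- \<eta>)"
    by (simp add: fourier_def[of "fourier g"])
  finally have lim1: "?L \<longlonglongrightarrow> fourier (fourier g) (- \<eta>)" .
  have "(\<lambda>n. LINT y|lborel. g (\<eta> + e n *\<^sub>R y) * ?h y)
      \<longlonglongrightarrow> (LINT y|lborel. g \<eta> * ?h y)"
  proof (rule integral_dominated_convergence[where w="\<lambda>y. K * (sqrt (2 * pi) ^ DIM('a) * gaussian y)"])
    show "integrable lborel (\<lambda>y::'a. K * (sqrt (2 * pi) ^ DIM('a) * gaussian y))"
      by (intro integrable_mult_right integrable_gaussian)
    show "AE y in lborel. (\<lambda>n. g (\<eta> + e n *\<^sub>R y) * ?h y)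
        \<longlonglongrightarrow> g \<eta> * ?h y"
    proof (intro AE_I2 tendsto_mult tendsto_const)
      fix y :: 'a
      have "(\<lambda>n. \<eta> + e n *\<^sub>R y) \<longlonglongrightarrow> \<eta> + 0 *\<^sub>R y"
        by (intro tendsto_intros e0)
      then show "(\<lambda>n. g (\<eta> + e n *\<^sub>R y)) \<longlonglongrightarrow> g \<eta>"
        using continuous_on_tendsto_compose[OF schwartz_continuous[OF g]] by simp
    qed
    show "AE y in lborel. norm (g (\<eta> + e n *\<^sub>R y) * ?h y)
        \<le> K * (sqrt (2 * pi) ^ DIM('a) * gaussian y)" for n
      by (intro AE_I2, unfold norm_mult norm_of_real) (intro mult_mono K, auto simp: gaussian_def abs_mult intro: order_trans[OF norm_ge_zero K])
  qed measurable
  also have "(LINT y|lborel. g \<eta> * ?h y)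
      = g \<eta> * (?c * fourier (\<lambda>y::'a. complex_of_real (gaussian y)) 0)"
    by (simp add: fourier_def)
  also have "\<dots> = complex_of_real ((2 * pi) ^ DIM('a)) * g \<eta>"
  proof -
    have "sqrt (2 * pi) ^ DIM('a) * sqrt (2 * pi) ^ DIM('a) = (2 * pi) ^ DIM('a)"
      unfolding power_mult_distrib[symmetric, of "sqrt (2 * pi)"] using real_sqrt_mult_self[of "2 * pi"] by simp
    then have "?c * ?c = complex_of_real ((2 * pi) ^ DIM('a))"
      unfolding of_real_mult[symmetric] by (simp only:)
    moreover have "fourier (\<lambda>y::'a. complex_of_real (gaussian y)) 0 = ?c"
      unfolding fourier_gaussian by (simp add: gaussian_def)
    ultimately show ?thesis
      by (simp only: mult.commute)
  qed
  finally have "?L \<longlonglongrightarrow> complex_of_real ((2 * pi) ^ DIM('a)) * g \<eta>"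
    by (simp only: gaussian_regularized_inversion[OF gi \<open>g \<in> borel_measurable borel\<close> e])
  then show ?thesis using LIMSEQ_unique[OF lim1] by blast
qed

text \<open>This lets the equation for \<open>u\<close> be tested with \<psi> =
  \<open>iFT g\<close>, whose transform is any prescribed Schwartz function.\<close>

lemma FT_iFT:
  fixes g :: "'a::euclidean_space \<Rightarrow> complex"
  assumes g: "schwartz g" shows "FT (iFT g) = g"
proof
  fix \<eta>
  let ?k = "complex_of_real ((2 * pi) powr (- real DIM('a)))"
  have eq: "iFT g = (\<lambda>x. ?k * fourier g x)"
    by (rule ext) (rule iFT_eq_fourier[OF schwartz_measurable[OF g]])
  have "FT (iFT g) \<eta> = fourier (iFT g) (- \<eta>)"
    by (rule FT_eq_fourier[OF schwartz_measurable[OF schwartz_iFT[OF g]]])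
  also have "\<dots> = ?k * (complex_of_real ((2 * pi) ^ DIM('a)) * g \<eta>)"
    unfolding eq fourier_cmult fourier_inversion[OF g] ..
  also have "\<dots> = g \<eta>"
  proof -
    have "(2 * pi) powr (- real DIM('a)) * (2 * pi) ^ DIM('a) = 1"
      by (simp only: powr_minus powr_realpow[of "2 * pi", OF mult_pos_pos[OF zero_less_numeral pi_gt_zero]]) (rule left_inverse, simp)
    then show ?thesis by (metis mult.assoc mult_1 of_real_1 of_real_mult)
  qed
  finally show "FT (iFT g) \<eta> = g \<eta>" .
qed

section \<open>Truncated multipliers\<close>

text \<open>With \<open>2 ^ n\<close> in place of \<open>2 ^ j\<close> the conclusion has the form
  of the assumption on \<open>f\<close>, so the estimate can be nested for products of several
  factors.\<close>

lemma dderiv_scaleR_bound_le: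
  fixes a :: "'a::euclidean_space \<Rightarrow> real" and f :: "'a \<Rightarrow> 'b::real_normed_vector"
  assumes "open S" "x \<in> S" "b \<in> Basis" "0 \<le> \<rho>" "smooth_on S a" "smooth_on S f"
    and A: "\<And>j. j \<le> n \<Longrightarrow> \<bar>dn j b a x\<bar> \<le> A * \<rho> ^ j"
    and B: "\<And>j. j \<le> n \<Longrightarrow> norm (dn j b f x) \<le> B * \<rho> ^ j"
    and j: "j \<le> n"
  shows "norm (dn j b (\<lambda>x. a x *\<^sub>R f x) x) \<le> 2 ^ n * A * B * \<rho> ^ j"
proof -
  have AB: "0 \<le> A" "0 \<le> B" using A[of 0] B[of 0] by (auto intro: order_trans[OF abs_ge_zero] order_trans[OF norm_ge_zero])
  have "norm (dn j b (\<lambda>x. a x *\<^sub>R f x) x) \<le> A * B * (2 * \<rho>) ^ j"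
    by (rule dderiv_scaleR_bound[OF assms(1-6)]) (use A B j in auto)
  also have "\<dots> = 2 ^ j * (A * B * \<rho> ^ j)" by (simp add: power_mult_distrib)
  also have "\<dots> \<le> 2 ^ n * (A * B * \<rho> ^ j)"
    using AB assms(4) j by (intro mult_right_mono power_increasing mult_nonneg_nonneg) auto
  finally show ?thesis by (simp add: mult_ac)
qed

lemma schwartz_uniform_bound:
  fixes f :: "'a::euclidean_space \<Rightarrow> complex"
  assumes f: "schwartz f"
  obtains B where "B \<ge> 0" "\<And>b j x. b \<in> Basis \<Longrightarrow> j \<le> n \<Longrightarrow> norm (dn j b f x) \<le> B"
proof -
  have "\<exists>K\<ge>0. \<forall>x. norm (dn j b f x) \<le> K" if "b \<in> Basis" for b j
  proof -
    have "set (replicate j b) \<subseteq> Basis" using that by auto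
    from schwartz_bound[OF f this, of 0] obtain K where "K \<ge> 0" "\<And>x. norm (dn j b f x) \<le> K"
      by (metis mult_1 power_0)
    then show ?thesis by blast
  qed
  then obtain K where K: "\<And>b j. b \<in> Basis \<Longrightarrow> K b j \<ge> 0" "\<And>b j x. b \<in> Basis \<Longrightarrow> norm (dn j b f x) \<le> K b j"
    by metis
  show ?thesis
  proof (rule that[of "\<Sum>b\<in>Basis. \<Sum>j\<le>n. K b j"])
    show "0 \<le> (\<Sum>b\<in>Basis. \<Sum>j\<le>n. K b j)" by (intro sum_nonneg K)
    fix b j x assume b: "b \<in> (Basis::'a set)" "j \<le> n"
    have "norm (dn j b f x) \<le> K b j" by (rule K(2)[OF b(1)])
    also have "\<dots> \<le> (\<Sum>j\<le>n. K b j)" using b K by (intro member_le_sum) auto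
    also have "\<dots> \<le> (\<Sum>b\<in>Basis. \<Sum>j\<le>n. K b j)" using b K by (intro member_le_sum sum_nonneg) auto
    finally show "norm (dn j b f x) \<le> (\<Sum>b\<in>Basis. \<Sum>j\<le>n. K b j)" .
  qed
qed

lemma one_minus_cutoff_derivative_bound:
  "\<exists>C\<ge>1. \<forall>b\<in>(Basis::'a::euclidean_space set). \<forall>l x j. j \<le> n \<longrightarrow> l > 0 \<longrightarrow> x \<noteq> 0 \<longrightarrow>
     \<bar>dn j b (\<lambda>x. 1 - cutoff (l * nsq x)) x\<bar> \<le> C * (1 / norm x) ^ j"
proof -
  obtain C where C: "C \<ge> 1" "\<And>b::'a. \<And>l x j. b \<in> Basis \<Longrightarrow> j \<le> n \<Longrightarrow> l > 0 \<Longrightarrow> x \<noteq> 0 \<Longrightarrow>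
     \<bar>dn j b (\<lambda>x. cutoff (l * nsq x)) x\<bar> \<le> C * (1 / norm x) ^ j"
    using cutoff_norm_derivative_bound[where 'a='a, of n] by blast
  show ?thesis
  proof (intro exI[of _ "1 + C"] conjI ballI allI impI)
    fix b x :: 'a and l :: real and j assume *: "b \<in> Basis" "j \<le> n" "l > 0" "x \<noteq> 0"
    have vs: "set (replicate j b) \<subseteq> Basis" using * by auto
    let ?c = "\<lambda>x::'a. cutoff (l * nsq x)" and ?n = "\<lambda>x::'a. - cutoff (l * nsq x)"
    have c1: "\<bar>dn j b (\<lambda>x::'a. 1) x\<bar> \<le> 1 * (1 / norm x) ^ j"
    proof (cases j)
      case (Suc i)
      show ?thesis unfolding Suc dderiv_replicate_const by simp
    qed simp
    have sm: "smooth_on UNIV ?c" by (rule smooth_on_cutoff_norm)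
    have smn: "smooth_on UNIV ?n"
      by (rule smooth_on_bounded_linear_compose[OF open_UNIV sm bounded_linear_minus[OF bounded_linear_ident]])
    have "dn j b (\<lambda>x::'a. 1 - cutoff (l * nsq x)) x
       = dn j b (\<lambda>x::'a. 1 + - cutoff (l * nsq x)) x" by simp
    also have "\<dots> = dn j b (\<lambda>x::'a. 1) x + dn j b ?n x"
      by (rule dderiv_add[OF open_UNIV smooth_on_const smn vs UNIV_I])
    also have "dn j b ?n x = - dn j b ?c x"
      by (rule dderiv_bounded_linear_compose[OF open_UNIV sm bounded_linear_minus[OF bounded_linear_ident] vs UNIV_I])
    also have "\<bar>dn j b (\<lambda>x::'a. 1) x + \<dots>\<bar> \<le> 1 * (1 / norm x) ^ j + C * (1 / norm x) ^ j"
      using c1 C(2)[OF *] by linarith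
    finally show "\<bar>dn j b (\<lambda>x. 1 - cutoff (l * nsq x)) x\<bar> \<le> (1 + C) * (1 / norm x) ^ j"
      by (simp only: distrib_right)
  qed (use C in auto)
qed

text \<open>\<open>radial_size \<Phi> n z\<close> controls the first \<open>n\<close> derivatives of \<open>\<Phi> (|\<xi>|\<^sup>2)\<close> at \<open>z = |\<xi>|\<^sup>2\<close>, rescaled by \<open>|\<xi>|\<close>.\<close>

definition radial_size :: "(real \<Rightarrow> real) \<Rightarrow> nat \<Rightarrow> real \<Rightarrow> real" where
  "radial_size \<Phi> n z = (\<Sum>k\<le>n. z ^ k * \<bar>dn k 1 \<Phi> z\<bar>)"

lemma radial_size_nonneg: "z \<ge> 0 \<Longrightarrow> radial_size \<Phi> n z \<ge> 0"
  unfolding radial_size_def by (intro sum_nonneg) auto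

lemma radial_size_ge: "z \<ge> 0 \<Longrightarrow> k \<le> n \<Longrightarrow> z ^ k * \<bar>dn k 1 \<Phi> z\<bar> \<le> radial_size \<Phi> n z"
  unfolding radial_size_def by (rule member_le_sum[of k "{..n}" "\<lambda>k. z ^ k * \<bar>dn k 1 \<Phi> z\<bar>"]) auto

lemma borel_measurable_radial_size:
  assumes "smooth_on {0<..} \<Phi>"
  shows "(\<lambda>z. indicator {0<..r} z * radial_size \<Phi> n z) \<in> borel_measurable borel"
proof -
  have "continuous_on {0<..} (dn k 1 \<Phi>)" for k
    by (rule smooth_on_continuous_on[OF smooth_on_dderiv[OF assms]]) auto
  then have "continuous_on {0<..} (radial_size \<Phi> n)"
    unfolding radial_size_def[abs_def] by (intro continuous_intros)
  then have "(\<lambda>z. indicator {0<..} z *\<^sub>R radial_size \<Phi> n z) \<in> borel_measurable borel"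
    by (intro borel_measurable_continuous_on_indicator) auto
  then have "(\<lambda>z. indicator {0<..r} z * (indicator {0<..} z *\<^sub>R radial_size \<Phi> n z)) \<in> borel_measurable borel"
    by measurable
  also have "(\<lambda>z. indicator {0<..r} z * (indicator {0<..} z *\<^sub>R radial_size \<Phi> n z)) = (\<lambda>z. indicator {0<..r} z * radial_size \<Phi> n z)"
    by (auto simp: indicator_def)
  finally show ?thesis .
qed

text \<open>For non-integrable \<open>f\<close> the Bochner integral is 0 by convention and the
  bound is trivial.\<close>

lemma norm_integral_le:
  fixes f :: "'a \<Rightarrow> 'b::{banach, second_countable_topology}"
  shows "ennreal (norm (integral\<^sup>L M f)) \<le> (\<integral>\<^sup>+ x. ennreal (norm (f x)) \<partial>M)"
  by (cases "integrable M f") (auto simp: integral_norm_bound_ennreal not_integrable_integral_eq)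

section \<open>The L1 estimate at low frequencies\<close>

abbreviation (input) low_pass :: "(real \<Rightarrow> real) \<Rightarrow> ('a::euclidean_space \<Rightarrow> complex) \<Rightarrow> real \<Rightarrow> 'a \<Rightarrow> complex" where
  "low_pass \<Phi> \<phi> r \<equiv> fourier (\<lambda>\<xi>. \<Phi> (nsq \<xi>) *\<^sub>R (cutoff (inverse r * nsq \<xi>) *\<^sub>R \<phi> \<xi>))"

text \<open>The regions of \<open>inner_mass\<close> and \<open>outer_mass\<close> overlap because
  the frequencies are split smoothly, by a cutoff in |x|^2 |\<xi>|^2 that changes between 1 and 2.
  The division by \<open>norm \<xi> ^ n\<close> in the outer one is the price of \<open>n\<close>
  derivatives.\<close>

abbreviation (input) inner_mass :: "(real \<Rightarrow> real) \<Rightarrow> nat \<Rightarrow> real \<Rightarrow> 'a::euclidean_space \<Rightarrow> ennreal" where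
  "inner_mass \<Phi> n r x \<equiv> (\<integral>\<^sup>+ \<xi>. ennreal (indicator {0<..2*r} (nsq \<xi>) * radial_size \<Phi> n (nsq \<xi>))
    * indicator {\<xi>::'a. norm x * norm \<xi> \<le> 2} \<xi> \<partial>lborel)"

abbreviation (input) outer_mass :: "(real \<Rightarrow> real) \<Rightarrow> nat \<Rightarrow> real \<Rightarrow> 'a::euclidean_space \<Rightarrow> ennreal" where
  "outer_mass \<Phi> n r x \<equiv> (\<integral>\<^sup>+ \<xi>. ennreal (indicator {0<..2*r} (nsq \<xi>) * radial_size \<Phi> n (nsq \<xi>)
    / norm \<xi> ^ n) * indicator {\<xi>::'a. 1 \<le> norm x * norm \<xi>} \<xi> \<partial>lborel)"

abbreviation (input) radial_mass :: "(real \<Rightarrow> real) \<Rightarrow> nat \<Rightarrow> real \<Rightarrow> ennreal" where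
  "radial_mass \<Phi> n s \<equiv> (\<integral>\<^sup>+ z. indicator {0<..s} z * ennreal (radial_size \<Phi> n z / z) \<partial>lborel)"

text \<open>At a point \<open>x\<close> the frequencies below \<open>1 / |x|\<close> are estimated trivially, and those above it by
  \<open>d + 1\<close> integrations by parts.\<close>

lemma low_frequency_pointwise:
  fixes \<phi> :: "'a::euclidean_space \<Rightarrow> complex"
  assumes \<Phi>: "smooth_on {0<..} \<Phi>" and cont: "continuous_on {0..} \<Phi>" and \<phi>: "schwartz \<phi>"
  defines "N \<equiv> DIM('a) + 1"
  obtains C where "C \<ge> 0" "\<And>r x. 0 < r \<Longrightarrow> r \<le> 1/2 \<Longrightarrow> x \<noteq> 0 \<Longrightarrow>
    ennreal (norm (low_pass \<Phi> \<phi> r x))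
     \<le> ennreal C * inner_mass \<Phi> N r x
      + ennreal (C / norm x ^ N) * outer_mass \<Phi> N r x"
proof -
  obtain C1 where C1: "C1 \<ge> 1" "\<And>b::'a. \<And>h x M j. b \<in> Basis \<Longrightarrow> j \<le> N \<Longrightarrow> smooth_on {0<..} h \<Longrightarrow> x \<noteq> 0 \<Longrightarrow>
     (\<And>k. k\<le>N \<Longrightarrow> norm x ^ (2 * k) * \<bar>dn k 1 h (nsq x)\<bar> \<le> M) \<Longrightarrow>
     \<bar>dn j b (\<lambda>x. h (nsq x)) x\<bar> \<le> C1 * M * (1 / norm x) ^ j"
    using dderiv_radial_bound[where 'a='a, of N] by blast
  obtain C2 where C2: "C2 \<ge> 1" "\<And>b::'a. \<And>l x j. b \<in> Basis \<Longrightarrow> j \<le> N \<Longrightarrow> l > 0 \<Longrightarrow> x \<noteq> 0 \<Longrightarrow>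
     \<bar>dn j b (\<lambda>x. cutoff (l * nsq x)) x\<bar> \<le> C2 * (1 / norm x) ^ j"
    using cutoff_norm_derivative_bound[where 'a='a, of N] by blast
  obtain C3 where C3: "C3 \<ge> 1" "\<And>b::'a. \<And>l x j. b \<in> Basis \<Longrightarrow> j \<le> N \<Longrightarrow> l > 0 \<Longrightarrow> x \<noteq> 0 \<Longrightarrow>
     \<bar>dn j b (\<lambda>x. 1 - cutoff (l * nsq x)) x\<bar> \<le> C3 * (1 / norm x) ^ j"
    using one_minus_cutoff_derivative_bound[where 'a='a, of N] by blast
  obtain B where B: "B \<ge> 0" "\<And>b j x. b \<in> Basis \<Longrightarrow> j \<le> N \<Longrightarrow> norm (dn j b \<phi> x) \<le> B"
    using schwartz_uniform_bound[OF \<phi>, of N] by blast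
  have \<phi>B: "norm (\<phi> x) \<le> B" for x
    using B(2)[OF SOME_Basis, of 0 x] by simp
  \<comment> \<open>Three nested applications of the Leibniz bound, for the factors \<Phi>, low-pass
    cutoff and high-pass cutoff acting on \<phi>; each costs \<open>2 ^ N\<close>.\<close>
  define C4 where "C4 = 2 ^ N * C1 * (2 ^ N * C2 * (2 ^ N * C3 * B))"
  have C4: "C4 \<ge> 0" using B C1 C2 C3 by (simp add: C4_def)
  define C where "C = B + real DIM('a) ^ N * (real DIM('a) * C4)"
  have C: "C \<ge> 0" "C \<ge> B" using C4 B by (auto simp: C_def)
  show ?thesis
  proof (rule that[OF C(1)])
    fix r :: real and x :: 'a assume r: "0 < r" "r \<le> 1/2" and x: "x \<noteq> 0"
    let ?O = "{\<xi>::'a. 1 \<le> norm x * norm \<xi>}" and ?L = "{\<xi>::'a. norm x * norm \<xi> \<le> 2}"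
    define w where "w \<xi> = indicator {0<..2*r} (nsq \<xi>) * radial_size \<Phi> N (nsq \<xi>)" for \<xi> :: 'a
    have w_meas [measurable]: "w \<in> borel_measurable borel"
      unfolding w_def by (rule measurable_compose[OF _ borel_measurable_radial_size[OF \<Phi>]]) measurable
    have w0: "w \<xi> \<ge> 0" for \<xi> unfolding w_def by (simp add: radial_size_nonneg)
    \<comment> \<open>With this dilation \<open>cutoff (l * nsq \<xi>)\<close> separates frequencies
      at |\<xi>| about 1/|x|.\<close>
    define l where "l = nsq x"
    have l: "l > 0" using x by (simp add: l_def)
    define f where "f \<xi> = \<Phi> (nsq \<xi>) *\<^sub>R (cutoff (inverse r * nsq \<xi>) *\<^sub>R \<phi> \<xi>)" for \<xi>
    define lo where "lo \<xi> = cutoff (l * nsq \<xi>) *\<^sub>R f \<xi>" for \<xi>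
    define hi where "hi \<xi> = \<Phi> (nsq \<xi>) *\<^sub>R (cutoff (inverse r * nsq \<xi>) *\<^sub>R ((1 - cutoff (l * nsq \<xi>)) *\<^sub>R \<phi> \<xi>))" for \<xi>
    have f_eq: "f \<xi> = lo \<xi> + hi \<xi>" for \<xi>
      by (simp add: f_def lo_def hi_def scaleR_conv_of_real algebra_simps)
    have cut_r: "cutoff (inverse r * nsq \<xi>) = 0" if "nsq \<xi> \<ge> 2 * r" for \<xi> :: 'a
      using that r by (intro cutoff_eq_0) (simp add: field_simps)
    have f_supp: "f \<xi> = 0" if "nsq \<xi> \<ge> 2 * r" for \<xi>
      using cut_r[OF that] by (simp add: f_def)
    have cut_cont: "continuous_on UNIV (\<lambda>\<xi>::'a. cutoff (m * nsq \<xi>))" for m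
      by (rule smooth_on_continuous_on[OF smooth_on_cutoff_norm])
    have f_cont: "continuous_on UNIV f"
      unfolding f_def by (intro continuous_on_scaleR cut_cont schwartz_continuous[OF \<phi>] continuous_on_compose2[OF cont] continuous_intros) auto
    have lo_cont: "continuous_on UNIV lo"
      unfolding lo_def by (intro continuous_on_scaleR cut_cont f_cont)
    \<comment> \<open>As \<open>2 * r\<close> is at most 1, such an \<open>h\<close> lives in the
      closed unit ball, where continuity gives integrability.\<close>
    have int_supp: "integrable lborel h" if h: "continuous_on UNIV h" "\<And>\<xi>. 2 * r < nsq \<xi> \<Longrightarrow> h \<xi> = 0" for h :: "'a \<Rightarrow> complex"
    proof -
      have "integrable lborel (\<lambda>\<xi>. indicator (cball 0 1) \<xi> *\<^sub>R h \<xi>)"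
        by (rule borel_integrable_compact) (auto intro: continuous_on_subset[OF h(1)])
      moreover have "h \<xi> = 0" if "norm \<xi> > 1" for \<xi>
      proof (rule h(2))
        have "1 < nsq \<xi>" using that by (intro one_less_power) auto
        then show "2 * r < nsq \<xi>" using r by linarith
      qed
      then have "indicator (cball 0 1) \<xi> *\<^sub>R h \<xi> = h \<xi>" for \<xi>
        by (cases "norm \<xi> > 1") (auto simp: indicator_def)
      ultimately show ?thesis by simp
    qed
    have lo_int: "integrable lborel lo"
      using f_supp by (intro int_supp lo_cont) (simp add: lo_def)
    have hi_near: "hi \<xi> = 0" if "l * nsq \<xi> \<le> 1" for \<xi>
      using that by (simp add: hi_def cutoff_eq_1)
    have hi_far: "hi \<xi> = 0" if "nsq \<xi> \<ge> 2 * r" for \<xi>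
      using cut_r[OF that] by (simp add: hi_def)
    let ?i = "\<lambda>\<xi>. (1 - cutoff (l * nsq \<xi>)) *\<^sub>R \<phi> \<xi>" and ?m = "\<lambda>\<xi>. cutoff (inverse r * nsq \<xi>) *\<^sub>R ((1 - cutoff (l * nsq \<xi>)) *\<^sub>R \<phi> \<xi>)"
    have sm_in: "smooth_on (- {0}) ?i"
      by (intro smooth_on_scaleR smooth_on_diff smooth_on_const smooth_on_cutoff_norm schwartz_smooth_on \<phi>) auto
    have sm_mid: "smooth_on (- {0}) ?m"
      by (intro smooth_on_scaleR sm_in smooth_on_cutoff_norm) auto
    have sm_\<Phi>: "smooth_on (- {0}) (\<lambda>\<xi>::'a. \<Phi> (nsq \<xi>))"
      by (rule smooth_on_compose_real[OF _ \<Phi> smooth_on_norm_sq]) auto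
    have op_near: "open {\<xi>::'a. l * nsq \<xi> < 1}" and op_far: "open {\<xi>::'a. 2 * r < nsq \<xi>}"
      by (intro open_Collect_less continuous_intros)+
    \<comment> \<open>The high part vanishes in a neighbourhood of the origin, the only point where
      smoothness of \<Phi>(|\<xi>|^2) could fail. Only this part is integrated by parts.\<close>
    have hi_smooth: "smooth_on UNIV hi"
    proof -
      have "smooth_on (- {0}) hi"
        unfolding hi_def by (intro smooth_on_scaleR sm_\<Phi> sm_mid) auto
      moreover have "smooth_on {\<xi>. l * nsq \<xi> < 1} hi"
        by (rule smooth_on_cong[OF op_near _ smooth_on_const[of _ 0]]) (simp add: hi_near)
      ultimately have "smooth_on (- {0} \<union> {\<xi>. l * nsq \<xi> < 1}) hi"
        by (rule smooth_on_Un)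
      then show ?thesis by (rule smooth_on_subset) auto
    qed
    have hi_vanish: "dderiv vs hi \<xi> = 0" if "l * nsq \<xi> < 1 \<or> 2 * r < nsq \<xi>" for vs \<xi>
    proof -
      have "dderiv vs hi \<xi> = dderiv vs (\<lambda>\<xi>. 0) \<xi>"
        by (rule dderiv_cong_open[OF open_Un[OF op_near op_far]]) (use that hi_near hi_far in auto)
      then show ?thesis by (simp add: dderiv_zero)
    qed
    have hi_int: "integrable lborel (dn j b hi)" if b: "b \<in> Basis" for j b
    proof (rule int_supp)
      show "continuous_on UNIV (dn j b hi)"
        by (rule smooth_on_continuous_on[OF smooth_on_dderiv[OF hi_smooth]]) (use b in auto)
      show "dn j b hi \<xi> = 0" if "2 * r < nsq \<xi>" for \<xi>
        by (rule hi_vanish) (use that in simp)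
    qed
    have hi_bound: "norm (dn N b hi \<xi>) \<le> C4 * (w \<xi> / norm \<xi> ^ N) * indicator ?O \<xi>"
      if b: "b \<in> Basis" for b \<xi>
    proof (cases "l * nsq \<xi> < 1 \<or> 2 * r < nsq \<xi>")
      case True
      have "0 \<le> C4 * (w \<xi> / norm \<xi> ^ N) * indicator ?O \<xi>"
        using w0[of \<xi>] C4 by (intro mult_nonneg_nonneg divide_nonneg_nonneg) auto
      then show ?thesis unfolding hi_vanish[OF True] by simp
    next
      case False
      have \<xi>: "\<xi> \<noteq> 0" using False by auto
      have ind: "1 \<le> norm x * norm \<xi>"
        using False power2_le_imp_le[of 1 "norm x * norm \<xi>"] by (simp add: l_def power_mult_distrib)
      have n1: "norm \<xi> \<le> 1"
        using False r power2_le_imp_le[of "norm \<xi>" 1] by simp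
      have w: "w \<xi> = radial_size \<Phi> N (nsq \<xi>)"
        using False \<xi> by (simp add: w_def)
      have op: "open (- {0::'a})" "\<xi> \<in> - {0}" "0 \<le> 1 / norm \<xi>" using \<xi> by auto
      \<comment> \<open>On the support |\<xi>| is at most 1, so a plain bound on the derivatives of
        \<phi> also has the scale invariant form required for nesting.\<close>
      have b1: "norm (dn j b \<phi> \<xi>) \<le> B * (1 / norm \<xi>) ^ j" if "j \<le> N" for j
      proof -
        have "B * 1 \<le> B * (1 / norm \<xi>) ^ j"
          using n1 \<xi> B(1) by (intro mult_left_mono one_le_power) auto
        then show ?thesis using B(2)[OF b that, of \<xi>] by simp
      qed
      have b2: "norm (dn j b ?i \<xi>)
          \<le> 2 ^ N * C3 * B * (1 / norm \<xi>) ^ j" if "j \<le> N" for j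
        by (rule dderiv_scaleR_bound_le[OF op(1,2) b op(3) _ _ C3(2)[OF b _ l \<xi>] b1 that])
           (intro smooth_on_diff smooth_on_const smooth_on_cutoff_norm op schwartz_smooth_on \<phi> | assumption)+
      have b3: "norm (dn j b ?m \<xi>)
          \<le> 2 ^ N * C2 * (2 ^ N * C3 * B) * (1 / norm \<xi>) ^ j" if "j \<le> N" for j
        by (rule dderiv_scaleR_bound_le[OF op(1,2) b op(3) smooth_on_cutoff_norm sm_in C2(2)[OF b _ _ \<xi>] b2 that])
           (use r in auto)
      have b4: "\<bar>dn j b (\<lambda>\<xi>. \<Phi> (nsq \<xi>)) \<xi>\<bar> \<le> C1 * w \<xi> * (1 / norm \<xi>) ^ j" if "j \<le> N" for j
      proof (rule C1(2)[OF b that \<Phi> \<xi>])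
        fix k assume "k \<le> N"
        from radial_size_ge[OF _ this, of "nsq \<xi>" \<Phi>]
        show "norm \<xi> ^ (2 * k) * \<bar>dn k 1 \<Phi> (nsq \<xi>)\<bar> \<le> w \<xi>"
          by (simp add: w power_mult)
      qed
      have "norm (dn N b hi \<xi>) \<le> 2 ^ N * (C1 * w \<xi>) * (2 ^ N * C2 * (2 ^ N * C3 * B)) * (1 / norm \<xi>) ^ N"
        unfolding hi_def
        by (rule dderiv_scaleR_bound_le[OF op(1,2) b op(3) sm_\<Phi> sm_mid b4 b3 order_refl])
      also have "\<dots> = C4 * (w \<xi> / norm \<xi> ^ N)"
        by (simp add: C4_def power_one_over inverse_eq_divide)
      finally show ?thesis using ind by simp
    qed
    have "ennreal (norm (fourier f x)) \<le> ennreal (norm (fourier lo x)) + ennreal (norm (fourier hi x))"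
    proof -
      have "fourier f x = fourier lo x + fourier hi x"
        unfolding f_eq using hi_int[OF SOME_Basis, of 0] by (intro fourier_add lo_int) simp
      then show ?thesis by (simp add: ennreal_plus[symmetric] norm_triangle_ineq del: ennreal_plus)
    qed
    also have "ennreal (norm (fourier lo x)) \<le> ennreal C * (\<integral>\<^sup>+ \<xi>. ennreal (w \<xi>) * indicator ?L \<xi> \<partial>lborel)"
    proof -
      have "ennreal (norm (fourier lo x)) \<le> (\<integral>\<^sup>+ \<xi>. ennreal (norm (lo \<xi> * cis (\<xi> \<bullet> x))) \<partial>lborel)"
        unfolding fourier_def by (rule norm_integral_le)
      also have "\<dots> \<le> (\<integral>\<^sup>+ \<xi>. ennreal C * (ennreal (w \<xi>) * indicator ?L \<xi>) \<partial>lborel)"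
      proof (rule nn_integral_mono_AE, rule eventually_mono[OF AE_lborel_singleton[of "0::'a"]])
        fix \<xi> :: 'a assume \<xi>: "\<xi> \<noteq> 0"
        show "ennreal (norm (lo \<xi> * cis (\<xi> \<bullet> x))) \<le> ennreal C * (ennreal (w \<xi>) * indicator ?L \<xi>)"
        proof (cases "l * nsq \<xi> \<ge> 2 \<or> nsq \<xi> \<ge> 2 * r")
          case True
          then have "lo \<xi> = 0" using f_supp[of \<xi>] by (auto simp: lo_def cutoff_eq_0)
          then show ?thesis by simp
        next
          case False
          have "norm x * norm \<xi> \<le> 2"
            using False power2_le_imp_le[of "norm x * norm \<xi>" 2] by (simp add: l_def power_mult_distrib)
          moreover have "norm (lo \<xi>) \<le> C * w \<xi>"
          proof -
            have "norm (lo \<xi>) \<le> 1 * (\<bar>\<Phi> (nsq \<xi>)\<bar> * (1 * B))"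
              unfolding lo_def f_def norm_scaleR
              by (intro mult_mono cutoff_abs_le_1 \<phi>B order_refl mult_nonneg_nonneg) auto
            also have "\<dots> \<le> w \<xi> * B"
              using radial_size_ge[of "nsq \<xi>" 0 N \<Phi>] False \<xi> B(1) by (auto simp: w_def intro!: mult_right_mono)
            also have "\<dots> \<le> w \<xi> * C" using w0 C by (intro mult_left_mono) auto
            finally show ?thesis by (simp add: mult.commute)
          qed
          ultimately show ?thesis
            using C w0[of \<xi>] by (simp add: norm_mult ennreal_mult[symmetric] ennreal_leI)
        qed
      qed
      also have "\<dots> = ennreal C * (\<integral>\<^sup>+ \<xi>. ennreal (w \<xi>) * indicator ?L \<xi> \<partial>lborel)"
        by (rule nn_integral_cmult) measurable
      finally show ?thesis .
    qed
    also have "ennreal (norm (fourier hi x)) \<le> ennreal (C / norm x ^ N) *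
        (\<integral>\<^sup>+ \<xi>. ennreal (w \<xi> / norm \<xi> ^ N) * indicator ?O \<xi> \<partial>lborel)" (is "_ \<le> _ * ?J")
    proof -
      have xN: "norm x ^ N > 0" using x by simp
      have "norm x ^ N * norm (fourier hi x)
        \<le> real DIM('a) ^ N * (\<Sum>b\<in>Basis. LINT \<xi>|lborel. norm (dn N b hi \<xi>))"
        by (rule fourier_decay_norm[OF hi_smooth hi_int])
      then have "ennreal (norm x ^ N * norm (fourier hi x))
         \<le> ennreal (real DIM('a) ^ N * (\<Sum>b\<in>Basis. LINT \<xi>|lborel. norm (dn N b hi \<xi>)))"
        by (rule ennreal_leI)
      also have "\<dots> = ennreal (real DIM('a) ^ N) * (\<Sum>b\<in>Basis. ennreal (LINT \<xi>|lborel. norm (dn N b hi \<xi>)))"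
        by (subst ennreal_mult) (auto intro!: sum_nonneg simp: sum_ennreal)
      also have "\<dots> \<le> ennreal (real DIM('a) ^ N) * (\<Sum>b\<in>(Basis::'a set). ennreal C4 * ?J)"
      proof (intro mult_left_mono sum_mono)
        fix b :: 'a assume b: "b \<in> Basis"
        have "ennreal (LINT \<xi>|lborel. norm (dn N b hi \<xi>)) = (\<integral>\<^sup>+ \<xi>. ennreal (norm (dn N b hi \<xi>)) \<partial>lborel)"
          by (rule nn_integral_eq_integral[symmetric]) (use hi_int[OF b] in auto)
        also have "\<dots> \<le> (\<integral>\<^sup>+ \<xi>. ennreal C4 * (ennreal (w \<xi> / norm \<xi> ^ N) * indicator ?O \<xi>) \<partial>lborel)"
        proof (intro nn_integral_mono)
          fix \<xi> :: 'a
          have "ennreal (norm (dn N b hi \<xi>)) \<le> ennreal (C4 * (w \<xi> / norm \<xi> ^ N) * indicator ?O \<xi>)"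
            by (rule ennreal_leI[OF hi_bound[OF b]])
          also have "\<dots> = ennreal C4 * (ennreal (w \<xi> / norm \<xi> ^ N) * indicator ?O \<xi>)"
            using C4 w0[of \<xi>] by (auto simp: indicator_def ennreal_mult[symmetric] simp del: times_divide_eq_right)
          finally show "ennreal (norm (dn N b hi \<xi>)) \<le> ennreal C4 * (ennreal (w \<xi> / norm \<xi> ^ N) * indicator ?O \<xi>)" .
        qed
        also have "\<dots> = ennreal C4 * ?J"
          by (rule nn_integral_cmult) measurable
        finally show "ennreal (LINT \<xi>|lborel. norm (dn N b hi \<xi>)) \<le> ennreal C4 * ?J" .
      qed auto
      also have "\<dots> = ennreal (real DIM('a) ^ N * (real DIM('a) * C4)) * ?J"
        using C4 by (simp add: ennreal_mult mult.assoc ennreal_of_nat_eq_real_of_nat)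
      also have "\<dots> \<le> ennreal C * ?J"
        using B by (intro mult_right_mono ennreal_leI) (auto simp: C_def)
      finally have *: "ennreal (norm x ^ N * norm (fourier hi x)) \<le> ennreal C * ?J" .
      have "ennreal (norm (fourier hi x)) = ennreal (1 / norm x ^ N) * ennreal (norm x ^ N * norm (fourier hi x))"
        using xN x by (subst ennreal_mult[symmetric]) auto
      also have "\<dots> \<le> ennreal (1 / norm x ^ N) * (ennreal C * ?J)"
        by (intro mult_left_mono *) auto
      also have "\<dots> = ennreal (C / norm x ^ N) * ?J"
        using C by (simp add: mult.assoc[symmetric] ennreal_mult[symmetric])
      finally show ?thesis .
    qed
    finally show "ennreal (norm (low_pass \<Phi> \<phi> r x))
     \<le> ennreal C * inner_mass \<Phi> N r x
      + ennreal (C / norm x ^ N) * outer_mass \<Phi> N r x"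
      unfolding w_def f_def by (simp add: add_mono)
  qed
qed

text \<open>Integrate the pointwise bound over \<open>x\<close> and exchange the integrals by
  Tonelli. For fixed \<xi> both \<open>x\<close>-integrals are multiples of |\<xi>|^-d, and
  \<open>nn_integral_radial_div\<close> converts what is left into the dz/z integral.\<close>

lemma low_frequency_L1_bound:
  fixes \<phi> :: "'a::euclidean_space \<Rightarrow> complex"
  assumes \<Phi>: "smooth_on {0<..} \<Phi>" and cont: "continuous_on {0..} \<Phi>" and \<phi>: "schwartz \<phi>"
  obtains C where "C \<ge> 0" "\<And>r. 0 < r \<Longrightarrow> r \<le> 1/2 \<Longrightarrow>
    (\<integral>\<^sup>+ x. ennreal (norm (low_pass \<Phi> \<phi> r x)) \<partial>lborel)
     \<le> ennreal C * radial_mass \<Phi> (DIM('a) + 1) (2*r)"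
proof -
  define N where "N = DIM('a) + 1"
  obtain C where C: "C \<ge> 0" and pw: "\<And>r x. 0 < r \<Longrightarrow> r \<le> 1/2 \<Longrightarrow> x \<noteq> 0 \<Longrightarrow>
    ennreal (norm (low_pass \<Phi> \<phi> r x))
     \<le> ennreal C * inner_mass \<Phi> N r x
      + ennreal (C / norm x ^ N) * outer_mass \<Phi> N r x"
    using low_frequency_pointwise[OF \<Phi> cont \<phi>] unfolding N_def by blast
  define v where "v = unit_ball_vol (real DIM('a))"
  have v: "v \<ge> 0" by (simp add: v_def)
  define c where "c = v * real DIM('a) / 2"
  have c: "c \<ge> 0" using v by (simp add: c_def)
  \<comment> \<open>First term: the volume of the ball of radius 2/|\<xi>|. Second term: the tail
    outside radius 1/|\<xi>|, which contributes one factor |\<xi>| against |\<xi>|^-(d+1).\<close>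
  define K where "K = v * 2 ^ DIM('a) + v * real DIM('a)"
  have K: "K \<ge> 0" using v by (simp add: K_def)
  show ?thesis
  proof (rule that[of "C * K * c"])
    show "0 \<le> C * K * c" using C K c by simp
    fix r :: real assume r: "0 < r" "r \<le> 1/2"
    define a where "a z = indicator {0<..2*r} z * radial_size \<Phi> N z" for z
    have [measurable]: "a \<in> borel_measurable borel"
      unfolding a_def by (rule borel_measurable_radial_size[OF \<Phi>])
    have a0: "a z \<ge> 0" for z by (auto simp: a_def indicator_def radial_size_nonneg)
    have az: "a 0 = 0" by (simp add: a_def)
    let ?F = "\<lambda>x. ennreal (norm (low_pass \<Phi> \<phi> r x))"
    let ?G = "\<lambda>(x::'a) (\<xi>::'a). ennreal (a (nsq \<xi>)) * indicator {..2} (norm x * norm \<xi>)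
       + ennreal (a (nsq \<xi>) / norm \<xi> ^ N) * (indicator {1..} (norm x * norm \<xi>) * ennreal (1 / norm x ^ N))"
    have G_meas: "(\<lambda>(x, \<xi>). ?G x \<xi>) \<in> borel_measurable (lborel \<Otimes>\<^sub>M lborel)"
      by measurable
    have "(\<integral>\<^sup>+ x. ?F x \<partial>lborel) \<le> (\<integral>\<^sup>+ x. ennreal C * (\<integral>\<^sup>+ \<xi>. ?G x \<xi> \<partial>lborel) \<partial>lborel)"
    proof (rule nn_integral_mono_AE, rule eventually_mono[OF AE_lborel_singleton[of "0::'a"]])
      fix x :: 'a assume x: "x \<noteq> 0"
      let ?p = "\<lambda>\<xi>. ennreal (a (nsq \<xi>)) * indicator {\<xi>::'a. norm x * norm \<xi> \<le> 2} \<xi>"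
      let ?q = "\<lambda>\<xi>. ennreal (a (nsq \<xi>) / norm \<xi> ^ N) * indicator {\<xi>::'a. 1 \<le> norm x * norm \<xi>} \<xi>"
      have [measurable]: "?p \<in> borel_measurable borel" "?q \<in> borel_measurable borel"
        by measurable
      have "?F x \<le> ennreal C * (\<integral>\<^sup>+ \<xi>. ?p \<xi> \<partial>lborel) + ennreal (C / norm x ^ N) * (\<integral>\<^sup>+ \<xi>. ?q \<xi> \<partial>lborel)"
        unfolding a_def by (rule pw[OF r x])
      also have "ennreal (C / norm x ^ N) = ennreal C * ennreal (1 / norm x ^ N)"
        using C by (simp add: ennreal_mult[symmetric])
      also have "ennreal C * (\<integral>\<^sup>+ \<xi>. ?p \<xi> \<partial>lborel) + ennreal C * ennreal (1 / norm x ^ N) * (\<integral>\<^sup>+ \<xi>. ?q \<xi> \<partial>lborel)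
        = ennreal C * ((\<integral>\<^sup>+ \<xi>. ?p \<xi> \<partial>lborel) + ennreal (1 / norm x ^ N) * (\<integral>\<^sup>+ \<xi>. ?q \<xi> \<partial>lborel))"
        by (simp only: distrib_left mult.assoc)
      also have "ennreal (1 / norm x ^ N) * (\<integral>\<^sup>+ \<xi>. ?q \<xi> \<partial>lborel) = (\<integral>\<^sup>+ \<xi>. ennreal (1 / norm x ^ N) * ?q \<xi> \<partial>lborel)"
        by (rule nn_integral_cmult[symmetric]) measurable
      also have "(\<integral>\<^sup>+ \<xi>. ?p \<xi> \<partial>lborel) + (\<integral>\<^sup>+ \<xi>. ennreal (1 / norm x ^ N) * ?q \<xi> \<partial>lborel)
        = (\<integral>\<^sup>+ \<xi>. ?p \<xi> + ennreal (1 / norm x ^ N) * ?q \<xi> \<partial>lborel)"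
        by (rule nn_integral_add[symmetric]) measurable
      also have "\<dots> = (\<integral>\<^sup>+ \<xi>. ?G x \<xi> \<partial>lborel)"
        by (rule nn_integral_cong) (simp add: indicator_def mult_ac)
      finally show "?F x \<le> ennreal C * (\<integral>\<^sup>+ \<xi>. ?G x \<xi> \<partial>lborel)" .
    qed
    also have "\<dots> = ennreal C * (\<integral>\<^sup>+ x. \<integral>\<^sup>+ \<xi>. ?G x \<xi> \<partial>lborel \<partial>lborel)"
      by (rule nn_integral_cmult) (use lborel.borel_measurable_nn_integral[OF G_meas] in simp)
    also have "(\<integral>\<^sup>+ x. \<integral>\<^sup>+ \<xi>. ?G x \<xi> \<partial>lborel \<partial>lborel) = (\<integral>\<^sup>+ \<xi>. \<integral>\<^sup>+ x. ?G x \<xi> \<partial>lborel \<partial>lborel)"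
      by (rule lborel_pair.Fubini'[symmetric]) (rule G_meas)
    also have "\<dots> \<le> (\<integral>\<^sup>+ \<xi>. ennreal K * (ennreal (a (nsq (\<xi>::'a))) * ennreal (1 / norm \<xi> ^ DIM('a))) \<partial>lborel)"
    proof (rule nn_integral_mono)
      fix \<xi> :: 'a
      show "(\<integral>\<^sup>+ x. ?G x \<xi> \<partial>lborel) \<le> ennreal K * (ennreal (a (nsq \<xi>)) * ennreal (1 / norm \<xi> ^ DIM('a)))"
      proof (cases "\<xi> = 0")
        case True
        then show ?thesis using az by simp
      next
        case False
        define n where "n = norm \<xi>"
        have n: "n > 0" using False by (simp add: n_def)
        have "(\<integral>\<^sup>+ x. ?G x \<xi> \<partial>lborel) = (\<integral>\<^sup>+ x. ennreal (a (n\<^sup>2)) * indicator (cball 0 (2 / n)) x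
            + ennreal (a (n\<^sup>2) / n ^ N) * (indicator {x. 1 / n \<le> norm x} x * ennreal (1 / norm (x::'a) ^ (DIM('a) + 1))) \<partial>lborel)"
          using n unfolding N_def[symmetric]
          by (intro nn_integral_cong) (auto simp: indicator_def field_simps n_def[symmetric])
        also have "\<dots> = ennreal (a (n\<^sup>2)) * emeasure lborel (cball (0::'a) (2 / n))
            + ennreal (a (n\<^sup>2) / n ^ N) * (\<integral>\<^sup>+ x. indicator {x. 1 / n \<le> norm x} x * ennreal (1 / norm (x::'a) ^ (DIM('a) + 1)) \<partial>lborel)"
        proof -
          have [measurable]: "cball (0::'a) (2 / n) \<in> sets lborel" by simp
          let ?q = "\<lambda>x::'a. indicator {x. 1 / n \<le> norm x} x * ennreal (1 / norm x ^ (DIM('a) + 1))"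
          have "(\<integral>\<^sup>+ x. ennreal (a (n\<^sup>2)) * indicator (cball 0 (2 / n)) x + ennreal (a (n\<^sup>2) / n ^ N) * ?q x \<partial>lborel)
            = (\<integral>\<^sup>+ x. ennreal (a (n\<^sup>2)) * indicator (cball (0::'a) (2 / n)) x \<partial>lborel) + (\<integral>\<^sup>+ x. ennreal (a (n\<^sup>2) / n ^ N) * ?q x \<partial>lborel)"
            by (rule nn_integral_add) measurable
          also have "(\<integral>\<^sup>+ x. ennreal (a (n\<^sup>2)) * indicator (cball (0::'a) (2 / n)) x \<partial>lborel) = ennreal (a (n\<^sup>2)) * emeasure lborel (cball (0::'a) (2 / n))"
            by (rule nn_integral_cmult_indicator) simp
          also have "(\<integral>\<^sup>+ x. ennreal (a (n\<^sup>2) / n ^ N) * ?q x \<partial>lborel) = ennreal (a (n\<^sup>2) / n ^ N) * (\<integral>\<^sup>+ x. ?q x \<partial>lborel)"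
            by (rule nn_integral_cmult) measurable
          finally show ?thesis .
        qed
        also have "\<dots> = ennreal (a (n\<^sup>2)) * ennreal (v * (2 / n) ^ DIM('a)) + ennreal (a (n\<^sup>2) / n ^ N) * ennreal (v * real DIM('a) / (1 / n))"
          using n by (subst nn_integral_norm_tail) (auto simp: emeasure_cball v_def)
        also have "\<dots> = ennreal (a (n\<^sup>2) * (v * (2 / n) ^ DIM('a)) + a (n\<^sup>2) / n ^ N * (v * real DIM('a) / (1 / n)))"
          using a0[of "n\<^sup>2"] v n by (simp add: ennreal_mult[symmetric] ennreal_plus[symmetric] del: ennreal_plus)
        also have "a (n\<^sup>2) * (v * (2 / n) ^ DIM('a)) + a (n\<^sup>2) / n ^ N * (v * real DIM('a) / (1 / n)) = K * (a (n\<^sup>2) * (1 / n ^ DIM('a)))"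
          using n by (simp add: K_def N_def power_divide field_simps)
        also have "ennreal \<dots> = ennreal K * (ennreal (a (n\<^sup>2)) * ennreal (1 / n ^ DIM('a)))"
          using a0[of "n\<^sup>2"] K n by (simp only: ennreal_mult mult_nonneg_nonneg divide_nonneg_pos zero_less_power zero_le_one)
        finally show ?thesis by (simp add: n_def)
      qed
    qed
    also have "\<dots> = ennreal K * (\<integral>\<^sup>+ \<xi>. ennreal (a (nsq (\<xi>::'a))) * ennreal (1 / norm \<xi> ^ DIM('a)) \<partial>lborel)"
      by (rule nn_integral_cmult) measurable
    also have "(\<integral>\<^sup>+ \<xi>. ennreal (a (nsq (\<xi>::'a))) * ennreal (1 / norm \<xi> ^ DIM('a)) \<partial>lborel)
        = ennreal c * (\<integral>\<^sup>+ z. indicator {0<..} z * ennreal (1 / z) * ennreal (a z) \<partial>lborel)"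
      unfolding c_def v_def by (rule nn_integral_radial_div) measurable
    also have "(\<integral>\<^sup>+ z. indicator {0<..} z * ennreal (1 / z) * ennreal (a z) \<partial>lborel)
        = radial_mass \<Phi> (DIM('a) + 1) (2*r)"
      by (intro nn_integral_cong) (auto simp: a_def N_def indicator_def ennreal_mult[symmetric] radial_size_nonneg)
    finally have main: "(\<integral>\<^sup>+ x. ?F x \<partial>lborel) \<le> ennreal C * (ennreal K * (ennreal c *
        radial_mass \<Phi> (DIM('a) + 1) (2*r)))"
      by (simp add: mult_left_mono)
    also have "\<dots> = ennreal (C * K * c) * radial_mass \<Phi> (DIM('a) + 1) (2*r)"
      using C K c by (simp only: ennreal_mult mult_nonneg_nonneg mult.assoc)
    finally show "(\<integral>\<^sup>+ x. ?F x \<partial>lborel) \<le> ennreal (C * K * c) * radial_mass \<Phi> (DIM('a) + 1) (2*r)" .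
  qed
qed

text \<open>The radii satisfy \<open>2 * r n \<le> e\<close>, so the bounding integrals run over
  shrinking intervals inside one on which the integral is finite, and dominated convergence
  applies.\<close>

lemma low_frequency_L1_tendsto_0:
  fixes \<phi> :: "'a::euclidean_space \<Rightarrow> complex"
  assumes \<Phi>: "smooth_on {0<..} \<Phi>" and cont: "continuous_on {0..} \<Phi>" and \<phi>: "schwartz \<phi>"
    and e: "0 < e" "e \<le> 1/2"
    and fin: "radial_mass \<Phi> (DIM('a) + 1) e < \<infinity>"
  defines "r \<equiv> \<lambda>n. e / 2 * inverse (real (Suc n))"
  shows "(\<lambda>n. \<integral>\<^sup>+ x. ennreal (norm (low_pass \<Phi> \<phi> (r n) x)) \<partial>lborel)
    \<longlonglongrightarrow> 0"
proof -
  obtain C where C: "C \<ge> 0" "\<And>r. 0 < r \<Longrightarrow> r \<le> 1/2 \<Longrightarrow>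
    (\<integral>\<^sup>+ x. ennreal (norm (low_pass \<Phi> \<phi> r x)) \<partial>lborel)
     \<le> ennreal C * radial_mass \<Phi> (DIM('a) + 1) (2*r)"
    using low_frequency_L1_bound[OF \<Phi> cont \<phi>] by blast
  have r: "0 < r n" "r n \<le> e / 2" for n
    using e by (auto simp: r_def divide_simps)
  have r0: "r \<longlonglongrightarrow> 0"
    unfolding r_def using tendsto_mult_right_zero[OF LIMSEQ_inverse_real_of_nat, of "e / 2"] by simp
  let ?a = "\<lambda>n z. indicator {0<..2*r n} z * ennreal (radial_size \<Phi> (DIM('a) + 1) z / z)"
  have eq: "indicator {0<..s} z * ennreal (radial_size \<Phi> (DIM('a) + 1) z / z)
      = ennreal (indicator {0<..s} z * radial_size \<Phi> (DIM('a) + 1) z / z)" for s z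
    by (auto simp: indicator_def)
  have meas [measurable]: "(\<lambda>z. indicator {0<..s} z * ennreal (radial_size \<Phi> (DIM('a) + 1) z / z)) \<in> borel_measurable borel" for s
    unfolding eq using borel_measurable_radial_size[OF \<Phi>, of s "DIM('a) + 1"] by measurable
  have "(\<lambda>n. \<integral>\<^sup>+ z. ?a n z \<partial>lborel) \<longlonglongrightarrow> (\<integral>\<^sup>+ z. 0 \<partial>(lborel :: real measure))"
  proof (rule nn_integral_dominated_convergence[where w="\<lambda>z. indicator {0<..e} z * ennreal (radial_size \<Phi> (DIM('a) + 1) z / z)"])
    show "AE z in lborel. (\<lambda>n. ?a n z) \<longlonglongrightarrow> 0"
    proof (rule AE_I2)
      fix z :: real
      have "\<forall>\<^sub>F n in sequentially. ?a n z = 0"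
      proof (cases "z > 0")
        case True
        then have "\<forall>\<^sub>F n in sequentially. r n < z / 2" using r0 by (intro order_tendstoD) auto
        then show ?thesis by eventually_elim (auto simp: indicator_def)
      qed auto
      then show "(\<lambda>n. ?a n z) \<longlonglongrightarrow> 0" by (rule tendsto_eventually)
    qed
    show "AE z in lborel. ?a n z \<le> indicator {0<..e} z * ennreal (radial_size \<Phi> (DIM('a) + 1) z / z)" for n
      using r(2)[of n] by (intro AE_I2) (auto simp: indicator_def)
  qed (use meas fin in auto)
  then have "(\<lambda>n. ennreal C * (\<integral>\<^sup>+ z. ?a n z \<partial>lborel)) \<longlonglongrightarrow> ennreal C * 0"
    by (intro ennreal_tendsto_cmult) auto
  then have lim: "(\<lambda>n. ennreal C * (\<integral>\<^sup>+ z. ?a n z \<partial>lborel)) \<longlonglongrightarrow> 0" by simp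
  show ?thesis
  proof (rule tendsto_sandwich[OF _ _ tendsto_const lim])
    show "\<forall>\<^sub>F n in sequentially. (\<integral>\<^sup>+ x. ennreal (norm (low_pass \<Phi> \<phi> (r n) x)) \<partial>lborel)
       \<le> ennreal C * (\<integral>\<^sup>+ z. ?a n z \<partial>lborel)"
      by (intro always_eventually allI C(2) r order_trans[OF r(2)]) (use e in auto)
  qed auto
qed

text \<open>Uniformity in \<open>R\<close> allows passing to the limit \<open>R \<rightarrow> \<infinity>\<close> under integrals against bounded functions.\<close>

lemma truncation_decay_bound:
  fixes G :: "'a::euclidean_space \<Rightarrow> complex"
  assumes G: "schwartz G"
  obtains K where "\<And>R x. R \<ge> 1 \<Longrightarrow> norm (fourier (\<lambda>\<xi>. cutoff (inverse R * nsq \<xi>) *\<^sub>R G \<xi>) x) \<le> K * decay_weight x"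
proof -
  define N where "N = DIM('a) + 1"
  obtain C where C: "C \<ge> 1" "\<And>b::'a. \<And>l x j. b \<in> Basis \<Longrightarrow> j \<le> N \<Longrightarrow> l > 0 \<Longrightarrow> x \<noteq> 0 \<Longrightarrow>
     \<bar>dn j b (\<lambda>x. cutoff (l * nsq x)) x\<bar> \<le> C * (1 / norm x) ^ j"
    using cutoff_norm_derivative_bound[where 'a='a, of N] by blast
  define M where "M b \<xi> = (\<Sum>j\<le>N. norm (dn j b G \<xi>))" for b \<xi>
  have Gj: "schwartz (dn j b G)" if "b \<in> Basis" for j b
    by (rule schwartz_dderiv[OF G]) (use that in auto)
  have M_int: "integrable lborel (M b)" if "b \<in> Basis" for b
    unfolding M_def by (intro Bochner_Integration.integrable_sum integrable_norm schwartz_integrable(1) Gj that)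
  have M_ge: "norm (dn j b G \<xi>) \<le> M b \<xi>" if "j \<le> N" for b j \<xi>
    unfolding M_def using that by (intro member_le_sum[of j "{..N}" "\<lambda>j. norm (dn j b G \<xi>)"]) auto
  have M0: "M b \<xi> \<ge> 0" for b \<xi> unfolding M_def by (intro sum_nonneg) auto
  define D where "D = 2 ^ N * C"
  have D: "D \<ge> 1" using mult_mono[of 1 "2 ^ N" 1 C] C by (simp add: D_def)
  show ?thesis
  proof (rule that)
    fix R :: real and x :: 'a assume R: "R \<ge> 1"
    define g where "g \<xi> = cutoff (inverse R * nsq \<xi>) *\<^sub>R G \<xi>" for \<xi>
    have sm: "smooth_on UNIV g"
      unfolding g_def by (intro smooth_on_scaleR open_UNIV smooth_on_cutoff_norm schwartz_smooth_on G)
    \<comment> \<open>Uniformity in \<open>R\<close>: where |\<xi>|^2 < R the truncation is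
      inactive, and elsewhere |\<xi>| is at least 1, so the bound C |\<xi>|^-i on the cutoff
      derivatives is at most C.\<close>
    have bd: "norm (dn j b g \<xi>) \<le> D * M b \<xi>" if j: "j \<le> N" and b: "b \<in> Basis" for j b \<xi>
    proof (cases "nsq \<xi> < R")
      case True
      have "dn j b g \<xi> = dn j b G \<xi>"
      proof (rule dderiv_cong_open[of "{\<xi>. nsq \<xi> < R}"])
        show "open {\<xi>::'a. nsq \<xi> < R}" by (intro open_Collect_less continuous_intros)
        fix y :: 'a assume "y \<in> {\<xi>. nsq \<xi> < R}"
        then have "inverse R * nsq y \<le> 1" using R by (simp add: field_simps)
        then show "g y = G y" by (simp add: g_def cutoff_eq_1)
      qed (use True in auto)
      then show ?thesis
        using M_ge[OF j, of b \<xi>] mult_right_mono[OF D M0[of b \<xi>]] by simp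
    next
      case False
      then have n1: "norm \<xi> \<ge> 1" using R power2_le_imp_le[of 1 "norm \<xi>"] by simp
      have \<xi>: "\<xi> \<noteq> 0" using n1 by auto
      have "norm (dn j b g \<xi>) \<le> 2 ^ N * C * M b \<xi> * 1 ^ j"
        unfolding g_def
      proof (rule dderiv_scaleR_bound_le[OF open_UNIV UNIV_I b])
        fix i assume i: "i \<le> N"
        have "C * (1 / norm \<xi>) ^ i \<le> C * 1 ^ i"
          using n1 \<xi> C(1) by (intro mult_left_mono power_mono) auto
        then show "\<bar>dn i b (\<lambda>\<xi>. cutoff (inverse R * nsq \<xi>)) \<xi>\<bar> \<le> C * 1 ^ i"
          using C(2)[OF b i _ \<xi>, of "inverse R"] R by simp
        show "norm (dn i b G \<xi>) \<le> M b \<xi> * 1 ^ i" using M_ge[OF i] by simp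
      qed (use j in \<open>auto intro!: smooth_on_cutoff_norm schwartz_smooth_on G\<close>)
      then show ?thesis by (simp add: D_def)
    qed
    have int: "integrable lborel (dn j b g)" if j: "j \<le> N" and b: "b \<in> Basis" for j b
    proof (rule Bochner_Integration.integrable_bound[OF integrable_mult_right[OF M_int[OF b], of D]])
      have "continuous_on UNIV (dn j b g)"
        by (rule smooth_on_continuous_on[OF smooth_on_dderiv[OF sm]]) (use b in auto)
      then show "dn j b g \<in> borel_measurable lborel"
        by (simp add: borel_measurable_continuous_onI)
      show "AE \<xi> in lborel. norm (dn j b g \<xi>) \<le> norm (D * M b \<xi>)"
        by (intro AE_I2 order_trans[OF bd[OF j b]]) auto
    qed
    have le: "(LINT \<xi>|lborel. norm (dn j b g \<xi>)) \<le> (LINT \<xi>|lborel. D * M b \<xi>)" if j: "j \<le> N" and b: "b \<in> Basis" for j b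
      by (intro integral_mono integrable_norm int integrable_mult_right M_int bd j b)
    \<comment> \<open>The derivative of order 0 does not depend on a direction; some basis vector is
      fixed only to express its bound through \<open>M\<close>.\<close>
    define b0 :: 'a where "b0 = (SOME b. b \<in> Basis)"
    have b0: "b0 \<in> Basis" unfolding b0_def by (rule SOME_Basis)
    have "norm (fourier g x) \<le> ((LINT \<xi>|lborel. norm (g \<xi>)) + real DIM('a) ^ (DIM('a) + 1) *
     (\<Sum>b\<in>Basis. LINT \<xi>|lborel. norm (dderiv (replicate (DIM('a) + 1) b) g \<xi>))) * decay_weight x"
      by (rule norm_fourier_le_decay_weight[OF sm]) (use int in \<open>auto simp: N_def\<close>)
    also have "\<dots> \<le> ((LINT \<xi>|lborel. D * M (SOME b. b \<in> Basis) \<xi>) + real DIM('a) ^ (DIM('a) + 1) *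
       (\<Sum>b\<in>Basis. LINT \<xi>|lborel. D * M b \<xi>)) * decay_weight x"
      unfolding b0_def[symmetric] N_def[symmetric] using le[of 0 b0] b0
      by (intro mult_right_mono add_mono mult_left_mono sum_mono le decay_weight_nonneg) auto
    finally show "norm (fourier (\<lambda>\<xi>. cutoff (inverse R * nsq \<xi>) *\<^sub>R G \<xi>) x) \<le> \<dots>"
      unfolding g_def .
  qed
qed

section \<open>Pairings with bounded functions\<close>

lemma Linfty_bound:
  assumes "Linfty u"
  obtains C where "C \<ge> 0" "AE x in lebesgue. norm (u x) \<le> C"
proof -
  obtain C where "AE x in lebesgue. norm (u x) \<le> C" using assms unfolding Linfty_def by blast
  then show ?thesis by (intro that[of "max C 0"]) (auto elim: eventually_mono)
qed

lemma borel_measurable_cnj [measurable (raw)]: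
  "f \<in> borel_measurable M \<Longrightarrow> (\<lambda>x. cnj (f x)) \<in> borel_measurable M"
  by (rule borel_measurable_continuous_on) (intro continuous_intros)

lemma pairing_integrable:
  assumes u: "Linfty u" and f: "integrable lborel f"
  shows "integrable lebesgue (\<lambda>x. u x * cnj (f x))"
proof -
  obtain C where C: "C \<ge> 0" "AE x in lebesgue. norm (u x) \<le> C" by (rule Linfty_bound[OF u])
  have fm: "f \<in> borel_measurable lborel" using f by auto
  have fl: "integrable lebesgue f" using f by (simp only: integrable_completion[OF fm])
  show ?thesis
  proof (rule Bochner_Integration.integrable_bound[OF integrable_mult_right[OF integrable_norm[OF fl], of C]])
    have [measurable]: "u \<in> borel_measurable lebesgue" using u by (simp add: Linfty_def)
    have [measurable]: "f \<in> borel_measurable lebesgue" using fl by auto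
    show "(\<lambda>x. u x * cnj (f x)) \<in> borel_measurable lebesgue" by measurable
    show "AE x in lebesgue. norm (u x * cnj (f x)) \<le> norm (C * norm (f x))"
      using C(2) by eventually_elim (auto simp: norm_mult abs_mult C(1) intro!: mult_right_mono)
  qed
qed

lemma pairing_add:
  assumes "Linfty u" "integrable lborel f" "integrable lborel g"
  shows "pairing u (\<lambda>x. f x + g x) = pairing u f + pairing u g"
  unfolding pairing_def complex_cnj_add distrib_left
  by (intro Bochner_Integration.integral_add pairing_integrable assms)

lemma pairing_cmult: "pairing u (\<lambda>x. c * f x) = cnj c * pairing u f"
proof -
  have "(\<lambda>x. u x * cnj (c * f x)) = (\<lambda>x. cnj c * (u x * cnj (f x)))" by (simp add: mult_ac)
  then show ?thesis unfolding pairing_def by (simp only: integral_mult_right_zero)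
qed

text \<open>Stated in \<open>ennreal\<close> for Borel \<open>f\<close>, so that it applies directly
  to the low-pass functions, whose L1 norms are estimated as extended nonnegative integrals.\<close>

lemma pairing_bound:
  assumes u: "Linfty u"
  obtains C where "C \<ge> 0" "\<And>f. f \<in> borel_measurable borel \<Longrightarrow>
    ennreal (norm (pairing u f)) \<le> ennreal C * (\<integral>\<^sup>+ x. ennreal (norm (f x)) \<partial>lborel)"
proof -
  obtain C where C: "C \<ge> 0" "AE x in lebesgue. norm (u x) \<le> C" by (rule Linfty_bound[OF u])
  show ?thesis
  proof (rule that[OF C(1)])
    fix f :: "'a \<Rightarrow> complex" assume [measurable]: "f \<in> borel_measurable borel"
    have "ennreal (norm (pairing u f)) \<le> (\<integral>\<^sup>+ x. ennreal (norm (u x * cnj (f x))) \<partial>lebesgue)"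
      unfolding pairing_def by (rule norm_integral_le)
    also have "\<dots> \<le> (\<integral>\<^sup>+ x. ennreal C * ennreal (norm (f x)) \<partial>lebesgue)"
    proof (rule nn_integral_mono_AE)
      show "AE x in lebesgue. ennreal (norm (u x * cnj (f x))) \<le> ennreal C * ennreal (norm (f x))"
        using C(2) by eventually_elim (auto simp: norm_mult ennreal_mult[symmetric] C(1) intro!: ennreal_leI mult_right_mono)
    qed
    also have "\<dots> = (\<integral>\<^sup>+ x. ennreal C * ennreal (norm (f x)) \<partial>lborel)"
      by (rule nn_integral_completion)
    also have "\<dots> = ennreal C * (\<integral>\<^sup>+ x. ennreal (norm (f x)) \<partial>lborel)"
      by (rule nn_integral_cmult) measurable
    finally show "ennreal (norm (pairing u f)) \<le> ennreal C * (\<integral>\<^sup>+ x. ennreal (norm (f x)) \<partial>lborel)" .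
  qed
qed

lemma pairing_iFT:
  fixes f :: "'a::euclidean_space \<Rightarrow> complex"
  assumes "f \<in> borel_measurable borel"
  shows "pairing u (iFT f) = complex_of_real ((2 * pi) powr (- real DIM('a))) * pairing u (fourier f)"
proof -
  have "iFT f = (\<lambda>x. complex_of_real ((2 * pi) powr (- real DIM('a))) * fourier f x)"
    by (rule ext) (rule iFT_eq_fourier[OF assms])
  then show ?thesis by (simp only: pairing_cmult complex_cnj_complex_of_real)
qed

lemma pairing_iFT_add:
  assumes u: "Linfty u" and f: "schwartz f" and g: "schwartz g"
  shows "pairing u (iFT (\<lambda>\<xi>. f \<xi> + g \<xi>)) = pairing u (iFT f) + pairing u (iFT g)"
proof -
  have "fourier (\<lambda>\<xi>. f \<xi> + g \<xi>) = (\<lambda>x. fourier f x + fourier g x)"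
    by (intro ext fourier_add schwartz_integrable(1) f g)
  then show ?thesis
    unfolding pairing_iFT[OF schwartz_measurable[OF schwartz_add[OF f g]]]
      pairing_iFT[OF schwartz_measurable[OF f]] pairing_iFT[OF schwartz_measurable[OF g]]
    by (simp add: pairing_add[OF u schwartz_integrable(1)[OF schwartz_fourier[OF f]]
          schwartz_integrable(1)[OF schwartz_fourier[OF g]]] distrib_left)
qed

lemma fmult_iFT:
  assumes "schwartz g"
  shows "fmult \<Phi> (iFT g) = iFT (\<lambda>\<xi>. \<Phi> (nsq \<xi>) *\<^sub>R g \<xi>)"
  unfolding fmult_def FT_iFT[OF assms] scaleR_conv_of_real ..

section \<open>Localising test functions\<close>

lemma test_fun_cutoff:
  fixes f :: "'a::euclidean_space \<Rightarrow> complex"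
  assumes f: "schwartz f" and m: "m > 0"
  shows "test_fun_on UNIV (\<lambda>\<xi>. cutoff (m * nsq \<xi>) *\<^sub>R f \<xi>)"
proof -
  have "{\<xi>. cutoff (m * nsq \<xi>) *\<^sub>R f \<xi> \<noteq> 0} \<subseteq> cball 0 (sqrt (2 / m))"
  proof (safe, rule ccontr)
    fix \<xi> :: 'a assume *: "cutoff (m * nsq \<xi>) *\<^sub>R f \<xi> \<noteq> 0" "\<xi> \<notin> cball 0 (sqrt (2 / m))"
    then have "sqrt (2 / m) < sqrt (nsq \<xi>)" by simp
    then have "m * nsq \<xi> \<ge> 2" using m unfolding real_sqrt_less_iff by (simp add: field_simps)
    then show False using * by (simp add: cutoff_eq_0)
  qed
  then have "compact (closure {\<xi>. cutoff (m * nsq \<xi>) *\<^sub>R f \<xi> \<noteq> 0})"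
    unfolding compact_closure by (rule bounded_subset[OF bounded_cball])
  moreover have "smooth_on UNIV (\<lambda>\<xi>. cutoff (m * nsq \<xi>) *\<^sub>R f \<xi>)"
    by (intro smooth_on_scaleR open_UNIV smooth_on_cutoff_norm schwartz_smooth_on f)
  ultimately show ?thesis by (simp add: test_fun_on_def smooth_iff_smooth_on)
qed

lemma test_fun_one_minus_cutoff:
  fixes f :: "'a::euclidean_space \<Rightarrow> complex"
  assumes f: "test_fun_on \<Omega> f" and \<Omega>: "open \<Omega>" and m: "m > 0"
  shows "test_fun_on (\<Omega> - {0}) (\<lambda>\<xi>. (1 - cutoff (m * nsq \<xi>)) *\<^sub>R f \<xi>)"
proof -
  have *: "test_fun_on \<Omega> (\<lambda>\<xi>. (1 - cutoff (m * nsq \<xi>)) *\<^sub>R f \<xi>)"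
    by (intro test_fun_scaleR f \<Omega> smooth_on_diff smooth_on_const smooth_on_cutoff_norm)
  have "closure {\<xi>. (1 - cutoff (m * nsq \<xi>)) *\<^sub>R f \<xi> \<noteq> 0} \<subseteq> {\<xi>. 1 \<le> m * nsq \<xi>}"
  proof (rule closure_minimal)
    show "closed {\<xi>::'a. 1 \<le> m * nsq \<xi>}" by (intro closed_Collect_le continuous_intros)
    show "{\<xi>. (1 - cutoff (m * nsq \<xi>)) *\<^sub>R f \<xi> \<noteq> 0} \<subseteq> {\<xi>. 1 \<le> m * nsq \<xi>}"
    proof (rule subsetI, rule ccontr)
      fix \<xi> assume *: "\<xi> \<in> {\<xi>. (1 - cutoff (m * nsq \<xi>)) *\<^sub>R f \<xi> \<noteq> 0}" "\<xi> \<notin> {\<xi>. 1 \<le> m * nsq \<xi>}"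
      then have "cutoff (m * nsq \<xi>) = 1" by (intro cutoff_eq_1) simp
      then show False using * by simp
    qed
  qed
  then have "0 \<notin> closure {\<xi>. (1 - cutoff (m * nsq \<xi>)) *\<^sub>R f \<xi> \<noteq> 0}" by auto
  with * show ?thesis unfolding test_fun_on_def by blast
qed

lemma test_fun_on_mono: "test_fun_on \<Omega> f \<Longrightarrow> \<Omega> \<subseteq> \<Omega>' \<Longrightarrow> test_fun_on \<Omega>' f"
  unfolding test_fun_on_def by blast

section \<open>The spectrum of a solution\<close>

abbreviation (input) weak_solution :: "('a::euclidean_space \<Rightarrow> complex) \<Rightarrow> (real \<Rightarrow> real) \<Rightarrow> real \<Rightarrow> bool" where
  "weak_solution u \<Phi> c \<equiv>
    \<forall>\<psi>. schwartz \<psi> \<longrightarrow> pairing u (fmult \<Phi> \<psi>) = pairing u (\<lambda>x. complex_of_real c * \<psi> x)"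

lemma test_fun_radial_scaleR:
  fixes g :: "'a::euclidean_space \<Rightarrow> complex"
  assumes g: "test_fun_on (- {0}) g" and h: "smooth_on {0<..} h"
  shows "test_fun_on (- {0}) (\<lambda>\<xi>. h (nsq \<xi>) *\<^sub>R g \<xi>)"
  by (rule test_fun_scaleR[OF g _ smooth_on_compose_real[OF _ h smooth_on_norm_sq]]) auto

text \<open>Test the equation with \<psi> = \<open>iFT g\<close>. Support away from the origin makes
  \<Phi>(|\<xi>|^2) g Schwartz, which justifies splitting the pairing into two terms; these cancel
  by the equation.\<close>

lemma multiplier_annihilates:
  fixes g :: "'a::euclidean_space \<Rightarrow> complex"
  assumes u: "Linfty u" and \<Phi>: "smooth_on {0<..} \<Phi>"
    and eq: "weak_solution u \<Phi> c"
    and g: "test_fun_on (- {0}) g"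
  shows "pairing u (iFT (\<lambda>\<xi>. (\<Phi> (nsq \<xi>) - c) *\<^sub>R g \<xi>)) = 0"
proof -
  have gs: "schwartz g" by (rule test_fun_schwartz[OF g])
  have hs: "schwartz (\<lambda>\<xi>. (- complex_of_real c) * g \<xi>)" by (rule schwartz_cmult[OF gs])
  have \<Phi>g: "schwartz (\<lambda>\<xi>. \<Phi> (nsq \<xi>) *\<^sub>R g \<xi>)"
    by (rule test_fun_schwartz[OF test_fun_radial_scaleR[OF g \<Phi>]])
  have "pairing u (iFT (\<lambda>\<xi>. (\<Phi> (nsq \<xi>) - c) *\<^sub>R g \<xi>))
      = pairing u (iFT (\<lambda>\<xi>. \<Phi> (nsq \<xi>) *\<^sub>R g \<xi> + (- complex_of_real c) * g \<xi>))"
    by (simp add: scaleR_conv_of_real left_diff_distrib)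
  also have "\<dots> = pairing u (iFT (\<lambda>\<xi>. \<Phi> (nsq \<xi>) *\<^sub>R g \<xi>)) + pairing u (iFT (\<lambda>\<xi>. (- complex_of_real c) * g \<xi>))"
    by (rule pairing_iFT_add[OF u \<Phi>g hs])
  also have "pairing u (iFT (\<lambda>\<xi>. \<Phi> (nsq \<xi>) *\<^sub>R g \<xi>)) = complex_of_real c * pairing u (iFT g)"
    unfolding fmult_iFT[OF gs, symmetric] eq[rule_format, OF schwartz_iFT[OF gs]] pairing_cmult by simp
  also have "iFT (\<lambda>\<xi>. (- complex_of_real c) * g \<xi>) = (\<lambda>x. (- complex_of_real c) * iFT g x)"
    by (rule ext) (simp only: iFT_eq_fourier[OF schwartz_measurable[OF hs]]
      iFT_eq_fourier[OF schwartz_measurable[OF gs]] fourier_cmult mult.left_commute)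
  also have "pairing u \<dots> = - complex_of_real c * pairing u (iFT g)"
    unfolding pairing_cmult by simp
  finally show ?thesis by simp
qed

lemma spectrum_off_level_set:
  fixes \<phi> :: "'a::euclidean_space \<Rightarrow> complex"
  assumes u: "Linfty u" and \<Phi>: "smooth_on {0<..} \<Phi>"
    and eq: "weak_solution u \<Phi> (\<Phi> 1)"
    and inj: "\<And>t. t > 0 \<Longrightarrow> t \<noteq> 1 \<Longrightarrow> \<Phi> t \<noteq> \<Phi> 1"
    and \<phi>: "test_fun_on (- {\<xi>. \<xi> = 0 \<or> norm \<xi> = 1}) \<phi>"
  shows "pairing u (iFT \<phi>) = 0"
proof -
  let ?K = "{\<xi>::'a. \<xi> = 0 \<or> norm \<xi> = 1}"
  have K: "closed ?K"
    by (intro closed_Collect_disj closed_Collect_eq continuous_intros)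
  have ne: "\<Phi> (nsq \<xi>) - \<Phi> 1 \<noteq> 0" if "\<xi> \<in> - ?K" for \<xi>
    using inj[of "nsq \<xi>"] that norm_ge_zero[of \<xi>] by (auto simp: power2_eq_1_iff simp del: norm_ge_zero)
  have 1: "smooth_on (- ?K) (\<lambda>\<xi>. \<Phi> (nsq \<xi>) - \<Phi> 1)"
    using K by (intro smooth_on_diff smooth_on_const smooth_on_compose_real[OF _ \<Phi> smooth_on_norm_sq]) auto
  have 2: "smooth_on (- ?K) (\<lambda>\<xi>. inverse (\<Phi> (nsq \<xi>) - \<Phi> 1))"
    by (rule smooth_on_compose_real[OF open_Compl[OF K] smooth_on_inverse 1])
       (rule image_subsetI, rule ComplI, use ne in simp)
  have g: "test_fun_on (- ?K) (\<lambda>\<xi>. inverse (\<Phi> (nsq \<xi>) - \<Phi> 1) *\<^sub>R \<phi> \<xi>)"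
    by (rule test_fun_scaleR[OF \<phi> _ 2]) (use K in auto)
  have "pairing u (iFT (\<lambda>\<xi>. (\<Phi> (nsq \<xi>) - \<Phi> 1) *\<^sub>R (inverse (\<Phi> (nsq \<xi>) - \<Phi> 1) *\<^sub>R \<phi> \<xi>))) = 0"
    by (rule multiplier_annihilates[OF u \<Phi> eq test_fun_on_mono[OF g]]) auto
  \<comment> \<open>The two factors cancel wherever \<phi> is nonzero, as such points lie off the
    exceptional set; elsewhere both sides are 0.\<close>
  moreover have "(\<Phi> (nsq \<xi>) - \<Phi> 1) *\<^sub>R (inverse (\<Phi> (nsq \<xi>) - \<Phi> 1) *\<^sub>R \<phi> \<xi>) = \<phi> \<xi>" for \<xi>
  proof (cases "\<phi> \<xi> = 0")
    case False
    then have "\<xi> \<in> - ?K"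
      using \<phi> closure_subset[of "{\<xi>. \<phi> \<xi> \<noteq> 0}"] unfolding test_fun_on_def by blast
    then show ?thesis using ne by simp
  qed simp
  ultimately show ?thesis by simp
qed

text \<open>By the previous lemma \<open>\<phi>\<close> may be cut off to an arbitrarily small neighbourhood of the origin,
  where the multiplier \<open>\<Phi>\<close> has small operator norm on \<open>L\<^sup>1\<close>.\<close>

lemma spectrum_off_sphere:
  fixes \<phi> :: "'a::euclidean_space \<Rightarrow> complex"
  assumes u: "Linfty u" and \<Phi>: "smooth_on {0<..} \<Phi>" and cont: "continuous_on {0..} \<Phi>"
    and eq: "weak_solution u \<Phi> (\<Phi> 1)"
    and inj: "\<And>t. t > 0 \<Longrightarrow> t \<noteq> 1 \<Longrightarrow> \<Phi> t \<noteq> \<Phi> 1"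
    and e: "0 < e" "e \<le> 1/2"
    and fin: "radial_mass \<Phi> (DIM('a) + 1) e < \<infinity>"
    and nz: "\<Phi> 1 \<noteq> 0"
    and \<phi>: "test_fun_on (- {\<xi>. norm \<xi> = 1}) \<phi>"
  shows "pairing u (iFT \<phi>) = 0"
proof -
  define r where "r n = e / 2 * inverse (real (Suc n))" for n
  have r: "r n > 0" for n using e by (simp add: r_def)
  let ?k = "(2 * pi) powr (- real DIM('a))"
  define c where "c = pairing u (iFT \<phi>)"
  define f where "f n \<xi> = cutoff (inverse (r n) * nsq \<xi>) *\<^sub>R \<phi> \<xi>" for n \<xi>
  have op: "open (- {\<xi>::'a. norm \<xi> = 1})"
    by (intro open_Compl closed_Collect_eq continuous_intros)
  have \<phi>s: "schwartz \<phi>" by (rule test_fun_schwartz[OF \<phi>])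
  have fs: "schwartz (f n)" for n
    unfolding f_def using r[of n] by (intro test_fun_schwartz[OF test_fun_cutoff[OF \<phi>s]]) simp
  have [measurable]: "f n \<in> borel_measurable borel" for n by (rule schwartz_measurable[OF fs])
  have "continuous_on UNIV (\<lambda>\<xi>::'a. \<Phi> (nsq \<xi>))"
    by (rule continuous_on_compose2[OF cont]) (auto intro!: continuous_intros)
  then have [measurable]: "(\<lambda>\<xi>::'a. \<Phi> (nsq \<xi>)) \<in> borel_measurable borel"
    by (rule borel_measurable_continuous_onI)
  \<comment> \<open>The discarded piece is supported away from both the origin and the sphere, so
    \<open>spectrum_off_level_set\<close> annihilates it and \<open>c\<close> is the same for every
    \<open>n\<close>.\<close>
  have c_eq: "c = pairing u (iFT (f n))" for n
  proof -
    let ?g = "\<lambda>\<xi>. (1 - cutoff (inverse (r n) * nsq \<xi>)) *\<^sub>R \<phi> \<xi>"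
    have g: "test_fun_on (- {\<xi>. norm \<xi> = 1} - {0}) ?g"
      using r[of n] by (intro test_fun_one_minus_cutoff \<phi> op) simp
    have "pairing u (iFT ?g) = 0"
      by (rule spectrum_off_level_set[OF u \<Phi> eq inj test_fun_on_mono[OF g]]) auto
    moreover have "pairing u (iFT (\<lambda>\<xi>. f n \<xi> + ?g \<xi>)) = pairing u (iFT (f n)) + pairing u (iFT ?g)"
      by (rule pairing_iFT_add[OF u fs test_fun_schwartz[OF g]])
    moreover have "(\<lambda>\<xi>. f n \<xi> + ?g \<xi>) = \<phi>"
      by (auto simp: f_def scaleR_left_diff_distrib)
    ultimately show ?thesis by (simp add: c_def)
  qed
  \<comment> \<open>Here \<Phi>(|\<xi>|^2) f may fail to be smooth at the origin, so it is kept
    whole instead of being treated as a Schwartz function. Only its L1 bound is used below.\<close>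
  have key: "complex_of_real (\<Phi> 1) * c = complex_of_real ?k *
      pairing u (fourier (\<lambda>\<xi>. \<Phi> (nsq \<xi>) *\<^sub>R f n \<xi>))" for n
  proof -
    have "complex_of_real (\<Phi> 1) * c = pairing u (\<lambda>x. complex_of_real (\<Phi> 1) * iFT (f n) x)"
      unfolding pairing_cmult c_eq[of n] by simp
    also have "\<dots> = pairing u (fmult \<Phi> (iFT (f n)))"
      by (rule eq[rule_format, OF schwartz_iFT[OF fs], symmetric])
    also have "\<dots> = pairing u (iFT (\<lambda>\<xi>. \<Phi> (nsq \<xi>) *\<^sub>R f n \<xi>))"
      by (simp only: fmult_iFT[OF fs])
    also have "\<dots> = complex_of_real ?k *
      pairing u (fourier (\<lambda>\<xi>. \<Phi> (nsq \<xi>) *\<^sub>R f n \<xi>))"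
      by (rule pairing_iFT) measurable
    finally show ?thesis .
  qed
  obtain C where C: "C \<ge> 0" "\<And>f. f \<in> borel_measurable borel \<Longrightarrow>
    ennreal (norm (pairing u f)) \<le> ennreal C * (\<integral>\<^sup>+ x. ennreal (norm (f x)) \<partial>lborel)"
    using pairing_bound[OF u] by blast
  let ?I = "\<lambda>n. \<integral>\<^sup>+ x. ennreal (norm (fourier (\<lambda>\<xi>. \<Phi> (nsq \<xi>) *\<^sub>R f n \<xi>) x)) \<partial>lborel"
  have I: "?I \<longlonglongrightarrow> 0"
    using low_frequency_L1_tendsto_0[OF \<Phi> cont \<phi>s e fin] unfolding f_def r_def .
  have "(\<lambda>n. ennreal ?k * (ennreal C * ?I n)) \<longlonglongrightarrow> ennreal ?k * (ennreal C * 0)"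
    by (intro ennreal_tendsto_cmult I) auto
  moreover have "ennreal (norm (complex_of_real (\<Phi> 1) * c)) \<le> ennreal ?k * (ennreal C * ?I n)" for n
  proof -
    have "fourier (\<lambda>\<xi>. \<Phi> (nsq \<xi>) *\<^sub>R f n \<xi>) \<in> borel_measurable borel"
      unfolding fourier_def by measurable
    from C(2)[OF this] show ?thesis
      unfolding key[of n] norm_mult by (subst ennreal_mult) (auto intro!: mult_left_mono)
  qed
  ultimately have "ennreal (norm (complex_of_real (\<Phi> 1) * c)) \<le> ennreal ?k * (ennreal C * 0)"
    by (intro LIMSEQ_le_const[of "\<lambda>n. ennreal ?k * (ennreal C * ?I n)"]) auto
  then show ?thesis using nz by (simp add: c_def)
qed

text \<open>Two dominated convergences: in \<xi>, with majorant |G|, for pointwise convergence of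
  the transforms; in \<open>x\<close>, with a multiple of \<open>decay_weight\<close>, for the
  pairing with the bounded \<open>u\<close>.\<close>

lemma pairing_truncation_limit:
  fixes G :: "'a::euclidean_space \<Rightarrow> complex"
  assumes u: "Linfty u" and G: "schwartz G"
    and z: "\<And>R. R \<ge> 1 \<Longrightarrow> pairing u (iFT (\<lambda>\<xi>. cutoff (inverse R * nsq \<xi>) *\<^sub>R G \<xi>)) = 0"
  shows "pairing u (iFT G) = 0"
proof -
  obtain C where C: "C \<ge> 0" "AE x in lebesgue. norm (u x) \<le> C" by (rule Linfty_bound[OF u])
  obtain K where K: "\<And>R x. R \<ge> 1 \<Longrightarrow> norm (fourier (\<lambda>\<xi>. cutoff (inverse R * nsq \<xi>) *\<^sub>R G \<xi>) x) \<le> K * decay_weight x"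
    using truncation_decay_bound[OF G] by blast
  define g where "g n \<xi> = cutoff (inverse (real (Suc n)) * nsq \<xi>) *\<^sub>R G \<xi>" for n \<xi>
  have gs: "schwartz (g n)" for n
    unfolding g_def by (intro test_fun_schwartz[OF test_fun_cutoff[OF G]]) simp
  have um [measurable]: "u \<in> borel_measurable lebesgue" using u by (simp add: Linfty_def)
  have fm [measurable]: "fourier h \<in> borel_measurable lebesgue" if "schwartz h" for h :: "'a \<Rightarrow> complex"
    using measurable_completion[of "fourier h" lborel borel] schwartz_measurable[OF schwartz_fourier[OF that]] by simp
  have dw: "integrable lebesgue (\<lambda>x::'a. C * (K * decay_weight x))"
    by (subst integrable_completion) (auto intro!: integrable_mult_right integrable_decay_weight)
  have gz: "pairing u (fourier (g n)) = 0" for n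
    using z[of "real (Suc n)"] pairing_iFT[OF schwartz_measurable[OF gs[of n]], of u] unfolding g_def by simp
  have "(\<lambda>n. pairing u (fourier (g n))) \<longlonglongrightarrow> pairing u (fourier G)"
    unfolding pairing_def
  proof (rule integral_dominated_convergence[OF _ _ dw])
    show "(\<lambda>x. u x * cnj (fourier G x)) \<in> borel_measurable lebesgue"
      using fm[OF G] by measurable
    show "(\<lambda>x. u x * cnj (fourier (g n) x)) \<in> borel_measurable lebesgue" for n
      using fm[OF gs[of n]] by measurable
    show "AE x in lebesgue. norm (u x * cnj (fourier (g n) x)) \<le> C * (K * decay_weight x)" for n
      using C(2)
    proof eventually_elim
      case (elim x)
      show ?case unfolding norm_mult complex_mod_cnj
        using K[of "real (Suc n)" x] elim C(1) unfolding g_def by (intro mult_mono) auto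
    qed
    show "AE x in lebesgue. (\<lambda>n. u x * cnj (fourier (g n) x)) \<longlonglongrightarrow> u x * cnj (fourier G x)"
    proof (intro AE_I2 tendsto_mult tendsto_const tendsto_cnj)
      fix x :: 'a
      have gm: "g n \<in> borel_measurable borel" for n by (rule schwartz_measurable[OF gs])
      show "(\<lambda>n. fourier (g n) x) \<longlonglongrightarrow> fourier G x"
        unfolding fourier_def
      proof (rule integral_dominated_convergence[where w="\<lambda>\<xi>. norm (G \<xi>)"])
        show "integrable lborel (\<lambda>\<xi>. norm (G \<xi>))" by (intro integrable_norm schwartz_integrable(1) G)
        show "(\<lambda>\<xi>. G \<xi> * cis (\<xi> \<bullet> x)) \<in> borel_measurable lborel"
          using schwartz_measurable[OF G] by measurable
        show "(\<lambda>\<xi>. g n \<xi> * cis (\<xi> \<bullet> x)) \<in> borel_measurable lborel" for n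
          using gm[of n] by measurable
        show "AE \<xi> in lborel. norm (g n \<xi> * cis (\<xi> \<bullet> x)) \<le> norm (G \<xi>)" for n
          using mult_right_mono[OF cutoff_abs_le_1 norm_ge_zero] by (intro AE_I2) (simp add: norm_mult g_def)
        show "AE \<xi> in lborel. (\<lambda>n. g n \<xi> * cis (\<xi> \<bullet> x)) \<longlonglongrightarrow> G \<xi> * cis (\<xi> \<bullet> x)"
        proof (intro AE_I2 tendsto_mult tendsto_const)
          fix \<xi> :: 'a
          have "(\<lambda>n. inverse (real (Suc n)) * nsq \<xi>) \<longlonglongrightarrow> 0 * nsq \<xi>"
            by (intro tendsto_mult tendsto_const LIMSEQ_inverse_real_of_nat)
          then have "\<forall>\<^sub>F n in sequentially. inverse (real (Suc n)) * nsq \<xi> < 1"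
            by (intro order_tendstoD) auto
          then have "\<forall>\<^sub>F n in sequentially. g n \<xi> = G \<xi>"
            by eventually_elim (simp add: g_def cutoff_eq_1)
          then show "(\<lambda>n. g n \<xi>) \<longlonglongrightarrow> G \<xi>" by (rule tendsto_eventually)
        qed
      qed
    qed
  qed
  then have "pairing u (fourier G) = 0"
    unfolding gz using LIMSEQ_unique[OF tendsto_const] by metis
  then show ?thesis
    unfolding pairing_iFT[OF schwartz_measurable[OF G]] by simp
qed

text \<open>After truncation the symbol is split near the origin. The low part is supported off the
  sphere and is killed by \<open>off\<close>; on the rest |\<xi>|^2 - 1 equals (\<Phi>(|\<xi>|^2) -
  \<Phi>(1)) / k(|\<xi>|^2), so \<open>multiplier_annihilates\<close> applies.\<close>

lemma helmholtz_annihilates: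
  fixes \<psi> :: "'a::euclidean_space \<Rightarrow> complex"
  assumes u: "Linfty u" and \<Phi>: "smooth_on {0<..} \<Phi>"
    and eq: "weak_solution u \<Phi> (\<Phi> 1)"
    and inj: "\<And>t. t > 0 \<Longrightarrow> t \<noteq> 1 \<Longrightarrow> \<Phi> t \<noteq> \<Phi> 1"
    and d1: "dderiv [1] \<Phi> 1 \<noteq> 0"
    and off: "\<And>\<phi>. test_fun_on (- {\<xi>. norm \<xi> = 1}) \<phi> \<Longrightarrow> pairing u (iFT \<phi>) = 0"
    and \<psi>: "schwartz \<psi>"
  shows "pairing u (iFT (\<lambda>\<xi>. (nsq \<xi> - 1) *\<^sub>R \<psi> \<xi>)) = 0"
proof -
  obtain k where k: "smooth_on {0<..} k" "\<And>t. t > 0 \<Longrightarrow> \<Phi> t - \<Phi> 1 = (t - 1) * k t" "k 1 = dderiv [1] \<Phi> 1"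
    using smooth_on_divided_difference[OF \<Phi>] by blast
  \<comment> \<open>At \<open>t = 1\<close> the value is the derivative of \<Phi> there; elsewhere a
    zero of \<open>k\<close> would make \<Phi> take the value \<Phi>(1) again.\<close>
  have k0: "k t \<noteq> 0" if "t > 0" for t
    using k(2)[OF that] k(3) d1 inj[OF that] by (cases "t = 1") auto
  have q: "smooth_on {0<..} (\<lambda>t. inverse (k t))"
    by (rule smooth_on_compose_real[OF _ smooth_on_inverse k(1)]) (use k0 in auto)
  have "schwartz (\<lambda>\<xi>. nsq \<xi> *\<^sub>R \<psi> \<xi> + - \<psi> \<xi>)"
    by (intro schwartz_add schwartz_norm_sq_scaleR schwartz_uminus \<psi>)
  then have G: "schwartz (\<lambda>\<xi>. (nsq \<xi> - 1) *\<^sub>R \<psi> \<xi>)"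
    by (simp add: scaleR_left_diff_distrib)
  show ?thesis
  proof (rule pairing_truncation_limit[OF u G])
    fix R :: real assume R: "R \<ge> 1"
    let ?T = "\<lambda>\<xi>. cutoff (inverse R * nsq \<xi>) *\<^sub>R \<psi> \<xi>"
    have T: "test_fun_on UNIV ?T" using R by (intro test_fun_cutoff \<psi>) simp
    let ?GR = "\<lambda>\<xi>. cutoff (inverse R * nsq \<xi>) *\<^sub>R ((nsq \<xi> - 1) *\<^sub>R \<psi> \<xi>)"
    have GR: "schwartz ?GR" using R by (intro test_fun_schwartz[OF test_fun_cutoff[OF G]]) simp
    \<comment> \<open>The factor 4 makes this cutoff vanish for |\<xi>|^2 at least 1/2, strictly
      inside the unit sphere, while it equals 1 near the origin.\<close>
    let ?P = "\<lambda>\<xi>. cutoff (4 * nsq \<xi>) *\<^sub>R ?GR \<xi>"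
    let ?S = "\<lambda>\<xi>. (1 - cutoff (4 * nsq \<xi>)) *\<^sub>R ?T \<xi>"
    let ?Q = "\<lambda>\<xi>. (\<Phi> (nsq \<xi>) - \<Phi> 1) *\<^sub>R (inverse (k (nsq \<xi>)) *\<^sub>R ?S \<xi>)"
    have S: "test_fun_on (- {0}) ?S"
      using test_fun_one_minus_cutoff[OF T open_UNIV, of 4] by (simp add: Compl_eq_Diff_UNIV)
    have gS: "test_fun_on (- {0}) (\<lambda>\<xi>. inverse (k (nsq \<xi>)) *\<^sub>R ?S \<xi>)"
      by (rule test_fun_radial_scaleR[OF S q])
    have Q0: "pairing u (iFT ?Q) = 0"
      by (rule multiplier_annihilates[OF u \<Phi> eq gS])
    have Qs: "schwartz ?Q"
      by (rule test_fun_schwartz[OF test_fun_radial_scaleR[OF gS, of "\<lambda>t. \<Phi> t - \<Phi> 1"]])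
         (intro smooth_on_diff \<Phi> smooth_on_const, auto)
    have P: "test_fun_on UNIV ?P" by (rule test_fun_cutoff[OF GR]) simp
    have "closure {\<xi>. ?P \<xi> \<noteq> 0} \<subseteq> {\<xi>. 4 * nsq \<xi> \<le> 2}"
    proof (rule closure_minimal)
      show "closed {\<xi>::'a. 4 * nsq \<xi> \<le> 2}" by (intro closed_Collect_le continuous_intros)
      show "{\<xi>. ?P \<xi> \<noteq> 0} \<subseteq> {\<xi>. 4 * nsq \<xi> \<le> 2}"
      proof (rule subsetI, rule ccontr)
        fix \<xi> assume *: "\<xi> \<in> {\<xi>. ?P \<xi> \<noteq> 0}" "\<xi> \<notin> {\<xi>. 4 * nsq \<xi> \<le> 2}"
        then have "cutoff (4 * nsq \<xi>) = 0" by (intro cutoff_eq_0) simp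
        then show False using * by simp
      qed
    qed
    then have "closure {\<xi>. ?P \<xi> \<noteq> 0} \<subseteq> - {\<xi>. norm \<xi> = 1}"
      by auto
    then have P': "test_fun_on (- {\<xi>. norm \<xi> = 1}) ?P"
      using P unfolding test_fun_on_def by blast
    have "?GR \<xi> = ?P \<xi> + ?Q \<xi>" for \<xi>
    proof (cases "\<xi> = 0")
      case True
      then show ?thesis by (simp add: cutoff_eq_1)
    next
      case False
      have "(\<Phi> (nsq \<xi>) - \<Phi> 1) * inverse (k (nsq \<xi>)) = nsq \<xi> - 1"
        using k(2)[of "nsq \<xi>"] k0[of "nsq \<xi>"] False by simp
      moreover have "?Q \<xi> = ((\<Phi> (nsq \<xi>) - \<Phi> 1) * inverse (k (nsq \<xi>))) *\<^sub>R ?S \<xi>"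
        by (rule scaleR_scaleR)
      ultimately have "?Q \<xi> = (nsq \<xi> - 1) *\<^sub>R ?S \<xi>" by (simp only:)
      then show ?thesis by (simp add: scaleR_conv_of_real algebra_simps)
    qed
    then have "pairing u (iFT ?GR) = pairing u (iFT (\<lambda>\<xi>. ?P \<xi> + ?Q \<xi>))" by presburger
    also have "\<dots> = pairing u (iFT ?P) + pairing u (iFT ?Q)"
      by (rule pairing_iFT_add[OF u test_fun_schwartz[OF P] Qs])
    also have "\<dots> = 0" using Q0 off[OF P'] by simp
    finally show "pairing u (iFT ?GR) = 0" .
  qed
qed

theorem theorem1p1:
  fixes \<Phi> :: "real \<Rightarrow> real" and u :: "'a::euclidean_space \<Rightarrow> complex"
  assumes cont: "continuous_on {0..} \<Phi>"
    and smooth_pos: "\<forall>k. \<forall>z>0. (deriv ^^ k) \<Phi> differentiable (at z)"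
    and growth: "\<exists>z0\<ge>2. \<forall>k. \<exists>C>0. \<exists>n::nat. \<forall>z\<ge>z0. \<bar>(deriv ^^ k) \<Phi> z\<bar> \<le> C * z ^ n"
    and small: "\<exists>\<epsilon>0. 0 < \<epsilon>0 \<and> \<epsilon>0 \<le> 1/2 \<and>
        (\<Sum>j\<le>DIM('a) + 1. \<integral>\<^sup>+ z\<in>{0<..\<epsilon>0}. ennreal (\<bar>z\<bar> ^ j * \<bar>(deriv ^^ j) \<Phi> z\<bar> / z) \<partial>lborel) < \<infinity>"
    and d1: "deriv \<Phi> 1 \<noteq> 0"
    and inj1: "\<forall>t. t > 0 \<and> t \<noteq> 1 \<longrightarrow> \<Phi> t \<noteq> \<Phi> 1"
    and uL: "Linfty u"
    and eq: "\<forall>\<psi>. schwartz \<psi> \<longrightarrow> pairing u (fmult \<Phi> \<psi>) = pairing u (\<lambda>x. complex_of_real (\<Phi> 1) * \<psi> x)"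
  shows "(\<forall>\<phi>. test_fun_on (- {\<xi>. \<xi> = 0 \<or> norm \<xi> = 1}) \<phi> \<longrightarrow> dist_FT u \<phi> = 0)
     \<and> (\<Phi> 1 \<noteq> 0 \<longrightarrow>
          (\<forall>\<phi>. test_fun_on (- {\<xi>. norm \<xi> = 1}) \<phi> \<longrightarrow> dist_FT u \<phi> = 0) \<and>
          (\<forall>\<psi>. schwartz \<psi> \<longrightarrow>
             pairing u (iFT (\<lambda>\<xi>. complex_of_real ((norm \<xi>)\<^sup>2 - 1) * \<psi> \<xi>)) = 0))"
proof -
  let ?d = "\<lambda>j z. ennreal (\<bar>z\<bar> ^ j * \<bar>(deriv ^^ j) \<Phi> z\<bar> / z)"
  \<comment> \<open>The iterated \<open>deriv\<close> of the hypotheses form a tower, which yields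
    \<open>smooth_on\<close> and identifies them with \<open>dn k 1 \<Phi>\<close> on the positive
    half line.\<close>
  have tower: "((deriv ^^ k) \<Phi> has_real_derivative (deriv ^^ Suc k) \<Phi> z) (at z)" if "z \<in> {0<..}" for k z
    using smooth_pos that by (auto simp: DERIV_deriv_iff_real_differentiable)
  have "smooth_on {0<..} ((deriv ^^ 0) \<Phi>)"
    by (rule smooth_on_tower[where H="\<lambda>k. (deriv ^^ k) \<Phi>", OF _ tower]) auto
  then have \<Phi>: "smooth_on {0<..} \<Phi>" by simp
  have der: "dn k 1 \<Phi> z = (deriv ^^ k) \<Phi> z" if "z > 0" for k z
    using dderiv_replicate_tower[where H="\<lambda>k. (deriv ^^ k) \<Phi>" and U="{0<..}" and n=k and k=0 and x=z, OF _ tower] that by simp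
  have d1': "dderiv [1] \<Phi> 1 \<noteq> 0" using der[of 1 1] d1 by (simp del: dderiv.simps(2))
  have inj': "\<Phi> t \<noteq> \<Phi> 1" if "t > 0" "t \<noteq> 1" for t using inj1 that by blast
  obtain e where e: "0 < e" "e \<le> 1/2"
    and fin0: "(\<Sum>j\<le>DIM('a) + 1. \<integral>\<^sup>+ z\<in>{0<..e}. ?d j z \<partial>lborel) < \<infinity>"
    using small by blast
  \<comment> \<open>Hypothesis (b) is a sum of integrals, \<open>radial_mass\<close> the integral of
    the sum; measurability of each summand permits the exchange.\<close>
  have fin: "radial_mass \<Phi> (DIM('a) + 1) e < \<infinity>"
  proof -
    have meas: "(\<lambda>z. ?d j z * indicator {0<..e} z) \<in> borel_measurable lborel" for j
    proof -
      have "continuous_on {0<..} ((deriv ^^ j) \<Phi>)"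
        using tower by (intro continuous_at_imp_continuous_on ballI DERIV_isCont) auto
      then have "(\<lambda>z. indicator {0<..} z *\<^sub>R (deriv ^^ j) \<Phi> z) \<in> borel_measurable borel"
        by (intro borel_measurable_continuous_on_indicator) auto
      then have "(\<lambda>z. ennreal (\<bar>z\<bar> ^ j * \<bar>indicator {0<..} z *\<^sub>R (deriv ^^ j) \<Phi> z\<bar> / z) * indicator {0<..e} z) \<in> borel_measurable borel"
        by measurable
      also have "(\<lambda>z. ennreal (\<bar>z\<bar> ^ j * \<bar>indicator {0<..} z *\<^sub>R (deriv ^^ j) \<Phi> z\<bar> / z) * indicator {0<..e} z)
          = (\<lambda>z. ?d j z * indicator {0<..e} z)"
        by (auto simp: indicator_def)
      finally show ?thesis by simp
    qed
    have "radial_mass \<Phi> (DIM('a) + 1) e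
        = (\<integral>\<^sup>+ z. (\<Sum>j\<le>DIM('a) + 1. ?d j z * indicator {0<..e} z) \<partial>lborel)"
    proof (intro nn_integral_cong)
      fix z :: real
      show "indicator {0<..e} z * ennreal (radial_size \<Phi> (DIM('a) + 1) z / z)
          = (\<Sum>j\<le>DIM('a) + 1. ?d j z * indicator {0<..e} z)"
      proof (cases "z \<in> {0<..e}")
        case True
        then have z: "z > 0" by simp
        have "radial_size \<Phi> (DIM('a) + 1) z / z = (\<Sum>j\<le>DIM('a) + 1. \<bar>z\<bar> ^ j * \<bar>(deriv ^^ j) \<Phi> z\<bar> / z)"
          unfolding radial_size_def sum_divide_distrib using z by (intro sum.cong refl) (simp add: der)
        also have "ennreal \<dots> = (\<Sum>j\<le>DIM('a) + 1. ?d j z)"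
          using z by (intro sum_ennreal[symmetric]) auto
        finally show ?thesis using True by simp
      qed simp
    qed
    also have "\<dots> = (\<Sum>j\<le>DIM('a) + 1. \<integral>\<^sup>+ z\<in>{0<..e}. ?d j z \<partial>lborel)"
      by (rule nn_integral_sum) (rule meas)
    finally show ?thesis using fin0 by simp
  qed
  have off: "pairing u (iFT \<phi>) = 0" if "\<Phi> 1 \<noteq> 0" "test_fun_on (- {\<xi>. norm \<xi> = 1}) \<phi>" for \<phi>
    by (rule spectrum_off_sphere[OF uL \<Phi> cont eq inj' e fin that])
  show ?thesis
  proof (intro conjI allI impI)
    fix \<phi> :: "'a \<Rightarrow> complex" assume "test_fun_on (- {\<xi>. \<xi> = 0 \<or> norm \<xi> = 1}) \<phi>"
    from spectrum_off_level_set[OF uL \<Phi> eq inj' this] show "dist_FT u \<phi> = 0"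
      by (simp add: dist_FT_def)
  next
    fix \<phi> :: "'a \<Rightarrow> complex" assume "\<Phi> 1 \<noteq> 0" "test_fun_on (- {\<xi>. norm \<xi> = 1}) \<phi>"
    from off[OF this] show "dist_FT u \<phi> = 0" by (simp add: dist_FT_def)
  next
    fix \<psi> :: "'a \<Rightarrow> complex" assume nz: "\<Phi> 1 \<noteq> 0" and \<psi>: "schwartz \<psi>"
    have "pairing u (iFT (\<lambda>\<xi>. (nsq \<xi> - 1) *\<^sub>R \<psi> \<xi>)) = 0"
      by (rule helmholtz_annihilates[OF uL \<Phi> eq inj' d1' off[OF nz] \<psi>])
    then show "pairing u (iFT (\<lambda>\<xi>. complex_of_real (nsq \<xi> - 1) * \<psi> \<xi>)) = 0"
      by (simp only: scaleR_conv_of_real)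
  qed
qed

end
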